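(* Let $(U^0_i,Z_i,W_i)$, $i\ge1$, be i.i.d. copies of a random element $(U^0,Z,W)\in\mathcal{H}_1\times\mathbb{R}^q\times\mathcal{H}_2$, $q\ge1$, with $\mathbb{E}(U^0\mid Z,W)=0$ a.s., and let $\omega:\mathbb{R}^q\to(0,\infty)$ be measurable. Assume: (D)(a) $\mathbb{E}\|U^0\omega(Z)\|^4_{\mathcal{H}_1}<\infty$. (D)(b)(i) $Z$ admits a density $f_Z$ that is either bounded or satisfies $\int_{\mathbb{R}^q}|\mathcal{F}[f_Z](t)|^{2-a}dt<\infty$ for some $a\in(0,1]$; (ii) $\mathbb{E}[\|W\|^2_{\mathcal{H}_2}]<\infty$; (iii) $\{a_k\}_{k\ge1}$ is a sequence of positive reals with $\sum_{k\ge1}a_k<\infty$. (D)(c) There exist $\underline{\sigma}^2>0$, $C>0$ and $\nu>2$ such that (i) $\underline{\sigma}^2\le\mathbb{E}[\langle U^0_1\omega(Z_1),U^0_2\omega(Z_2)\rangle^2_{\mathcal{H}_1}\mid(Z_1,W_1),(Z_2,W_2)]$ almost surely; (ii) $\mathbb{E}[\|U^0\omega(Z)\|^\nu_{\mathcal{H}_1}\mid Z,W]\le C$ almost surely. (K)(a) $K(z_1,\dots,z_q)=\tilde K(z_1)\cdots\tilde K(z_q)$, where $\tilde K$ is a symmetric probability density of bounded variation on the real line whose Fourier transform $\mathcal{F}[\tilde K]$ is positive and integrable; (K)(b) $h=h_n\to0$ and $nh^q/\ln n\to\infty$. Consider the sequence of alternatives $$H_{1n}:\quad U_{in}=U^0_i+r_n\,\delta(Z_i,W_i),\qquad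 1\le i\le n,\ n\ge1,$$ where $\delta:\mathbb{R}^q\times\mathcal{H}_2\to\mathcal{H}_1$ and the real sequence $\{r_n\}$ satisfy $\mathbb{E}[\delta(Z,W)]=0$, $0<\mathbb{E}[\|\delta(Z,W)\omega(Z)\|^4_{\mathcal{H}_1}]<\infty$ and $r_n^2nh^{q/2}\to\infty$. Let $T_n=I_n(h)/v_n(h)$ be the test statistic computed from the sample $(U_{in},Z_i,W_i)$, $1\le i\le n$. Then the test based on $T_n$ is consistent against the sequence of alternatives $H_{1n}$: for every $\alpha\in(0,1)$, under $H_{1n}$, $\mathbb{P}(T_n\ge z_{1-\alpha})\to1$ as $n\to\infty$, where $z_{1-\alpha}$ is the $(1-\alpha)$-quantile of the standard normal distribution.
   Context: $\mathcal{H}_1,\mathcal{H}_2$ are real separable Hilbert spaces. By convention (without loss of generality) $\mathbb{E}(W)=0$. $\mathcal{F}$ denotes the Fourier transform. $\{\phi_k\}_{k\ge1}$ is a fixed orthonormal basis of $\mathcal{H}_2$ and $\|w\|^2_{\mathcal{A}}=\sum_{k\ge1}a_k\langle w,\phi_k\rangle^2_{\mathcal{H}_2}$ for $w\in\mathcal{H}_2$. For a sample $(U_i,Z_i,W_i)$, $1\le i\le n$ (here with $U_i=U_{in}$), put $K_{ij}(h)=K((Z_i-Z_j)/h)$, $\varphi_{ij}=\exp(-\|W_i-W_j\|^2_{\mathcal{A}}/2)$, and $$I_n(h)=\frac{1}{n(n-1)h^q}\sum_{1\le i\ne j\le n}\langle U_i\omega(Z_i),U_j\omega(Z_j)\rangle_{\mathcal{H}_1}K_{ij}(h)\varphi_{ij},$$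 $$v_n^2(h)=\frac{2}{n^2(n-1)^2h^{2q}}\sum_{1\le i\ne j\le n}\langle U_i\omega(Z_i),U_j\omega(Z_j)\rangle^2_{\mathcal{H}_1}K^2_{ij}(h)\varphi^2_{ij},\qquad v_n(h)\ge0.$$ ($T_n$ may be given an arbitrary value when $v_n(h)=0$.) *)

theory Defs
  imports "HOL-Probability.Probability"
begin

text \<open>The sign and scaling convention is immaterial below: only positivity and integrability
  properties of the transform are used.\<close>

definition fourier :: "('a::euclidean_space \<Rightarrow> real) \<Rightarrow> 'a \<Rightarrow> complex" where
  "fourier f t = (LINT x|lborel. cis (- (t \<bullet> x)) * complex_of_real (f x))"

definition bounded_variation :: "(real \<Rightarrow> real) \<Rightarrow> bool" where
  "bounded_variation f \<longleftrightarrow>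
     (\<exists>V. \<forall>(n::nat) (t::nat \<Rightarrow> real). mono t \<longrightarrow> (\<Sum>i<n. \<bar>f (t (Suc i)) - f (t i)\<bar>) \<le> V)"

definition quantile :: "real measure \<Rightarrow> real \<Rightarrow> real" where
  "quantile \<mu> p = Inf {x. p \<le> cdf \<mu> x}"

text \<open>The sigma-algebra on the space of \<open>M\<close> generated by a random element \<open>X\<close>.\<close>

definition generated_by :: "'a measure \<Rightarrow> ('a \<Rightarrow> 'b::topological_space) \<Rightarrow> 'a measure" where
  "generated_by M X = vimage_algebra (space M) X borel"

text \<open>\<open>g\<close> is a version of the (Bochner) conditional expectation of \<open>f\<close> given the
  sub-sigma-algebra \<open>F\<close>; the library's \<^const>\<open>real_cond_exp\<close> only covers real-valued \<open>f\<close>.\<close>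

definition is_cond_exp ::
  "'a measure \<Rightarrow> 'a measure \<Rightarrow> ('a \<Rightarrow> 'b::{banach, second_countable_topology}) \<Rightarrow> ('a \<Rightarrow> 'b) \<Rightarrow> bool"
  where
  "is_cond_exp M F f g \<longleftrightarrow>
     integrable M f \<and> integrable M g \<and> g \<in> borel_measurable F \<and>
     (\<forall>A\<in>sets F. set_lebesgue_integral M A f = set_lebesgue_integral M A g)"

text \<open>The basis is indexed by a set \<open>J\<close> of naturals, so that finite-dimensional spaces are covered
  along with infinite-dimensional ones.\<close>

definition orthonormal_basis :: "nat set \<Rightarrow> (nat \<Rightarrow> 'b::real_inner) \<Rightarrow> bool" where
  "orthonormal_basis J \<phi> \<longleftrightarrow>
     (\<forall>j\<in>J. \<forall>k\<in>J. \<phi> j \<bullet> \<phi> k = (if j = k then 1 else 0)) \<and> closure (span (\<phi> ` J)) = UNIV"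

definition sq_norm_A :: "nat set \<Rightarrow> (nat \<Rightarrow> 'b::real_inner) \<Rightarrow> (nat \<Rightarrow> real) \<Rightarrow> 'b \<Rightarrow> real" where
  "sq_norm_A J \<phi> a w = (\<Sum>\<^sub>\<infinity>k\<in>J. a k * (w \<bullet> \<phi> k)\<^sup>2)"

definition product_kernel :: "(real \<Rightarrow> real) \<Rightarrow> real ^ 'q \<Rightarrow> real" where
  "product_kernel k z = (\<Prod>i\<in>UNIV. k (z $ i))"

text \<open>
  In the statistics below, \<open>U i\<close>, \<open>Z i\<close>, \<open>W i\<close> (\<open>1 \<le> i \<le> n\<close>) are the observed values, \<open>K\<close> is
  the kernel on \<open>\<real>\<^sup>q\<close>, \<open>w\<close> the weight function, \<open>N\<close> the squared \<open>\<A>\<close>-norm and \<open>h\<close> the bandwidth.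
\<close>

definition I_stat ::
  "(real ^ 'q \<Rightarrow> real) \<Rightarrow> (real ^ 'q \<Rightarrow> real) \<Rightarrow> ('w::real_vector \<Rightarrow> real) \<Rightarrow> nat \<Rightarrow> real \<Rightarrow>
   (nat \<Rightarrow> 'u::real_inner) \<Rightarrow> (nat \<Rightarrow> real ^ 'q) \<Rightarrow> (nat \<Rightarrow> 'w) \<Rightarrow> real" where
  "I_stat K w N n h U Z W =
     1 / (real n * (real n - 1) * h ^ CARD('q)) *
     (\<Sum>i\<in>{1..n}. \<Sum>j\<in>{1..n} - {i}.
        ((w (Z i) *\<^sub>R U i) \<bullet> (w (Z j) *\<^sub>R U j)) *
        K ((1 / h) *\<^sub>R (Z i - Z j)) * exp (- N (W i - W j) / 2))"

definition v_sq_stat ::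
  "(real ^ 'q \<Rightarrow> real) \<Rightarrow> (real ^ 'q \<Rightarrow> real) \<Rightarrow> ('w::real_vector \<Rightarrow> real) \<Rightarrow> nat \<Rightarrow> real \<Rightarrow>
   (nat \<Rightarrow> 'u::real_inner) \<Rightarrow> (nat \<Rightarrow> real ^ 'q) \<Rightarrow> (nat \<Rightarrow> 'w) \<Rightarrow> real" where
  "v_sq_stat K w N n h U Z W =
     2 / ((real n)\<^sup>2 * (real n - 1)\<^sup>2 * h ^ (2 * CARD('q))) *
     (\<Sum>i\<in>{1..n}. \<Sum>j\<in>{1..n} - {i}.
        ((w (Z i) *\<^sub>R U i) \<bullet> (w (Z j) *\<^sub>R U j))\<^sup>2 *
        (K ((1 / h) *\<^sub>R (Z i - Z j)))\<^sup>2 * (exp (- N (W i - W j) / 2))\<^sup>2)"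

definition v_stat ::
  "(real ^ 'q \<Rightarrow> real) \<Rightarrow> (real ^ 'q \<Rightarrow> real) \<Rightarrow> ('w::real_vector \<Rightarrow> real) \<Rightarrow> nat \<Rightarrow> real \<Rightarrow>
   (nat \<Rightarrow> 'u::real_inner) \<Rightarrow> (nat \<Rightarrow> real ^ 'q) \<Rightarrow> (nat \<Rightarrow> 'w) \<Rightarrow> real" where
  "v_stat K w N n h U Z W = sqrt (v_sq_stat K w N n h U Z W)"

text \<open>\<open>c\<close> is the arbitrary value given to the test statistic when the standardization vanishes.\<close>

definition T_stat ::
  "real \<Rightarrow> (real ^ 'q \<Rightarrow> real) \<Rightarrow> (real ^ 'q \<Rightarrow> real) \<Rightarrow> ('w::real_vector \<Rightarrow> real) \<Rightarrow> nat \<Rightarrow> real \<Rightarrow>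
   (nat \<Rightarrow> 'u::real_inner) \<Rightarrow> (nat \<Rightarrow> real ^ 'q) \<Rightarrow> (nat \<Rightarrow> 'w) \<Rightarrow> real" where
  "T_stat c K w N n h U Z W =
     (if v_stat K w N n h U Z W = 0 then c
      else I_stat K w N n h U Z W / v_stat K w N n h U Z W)"

end

(*
  Write V_i = w(Z_i) U0_i, D_i = w(Z_i) delta(Z_i, W_i) and let k(x, y) be the product of the kernel K((z - z')/h)
  and the Gaussian weight exp(-|w - w'|_A^2 / 2).  Up to the common factor 1/(n(n-1)h^q), I_n is the U-statistic S
  of g(x, y) = <V_x + r D_x, V_y + r D_y> k(x, y) and v_n is sqrt(2 sum g^2), so it suffices to show that
  P(S <= |z| sqrt(2 sum g^2)) -> 0.  By the Chebyshev and Markov inequalities this probability is at most a constant times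
  (E g_1^2 / n + E g^2 / n^2) / theta^2, where g_1(x) = E g(x, X) and, since E(U0 | Z, W) = 0,
  theta = E g = r^2 Q with Q = E <D_1, D_2> k_12.

  - All conditions on f_Z enter through E k_12 = O(h^q) and sup_x E k(x, X) = O(h^(q/2)).
  - Both transforms being positive, k is positive semidefinite; if T is the integral operator of k, then
    E|T D|^2 <= sup_x E k(x, X) * Q.  Since g_1 = r <V + r D, T D>, this bounds E g_1^2 in terms of Q itself, which is what
    makes the sharp rate r_n^2 n h^(q/2) -> infinity sufficient even when Q / h^q is unbounded.
  - Q >= c h^q: in Fourier space, Q is the integral of FT(K)(h s) Phi(s) up to the factor h^q (and a constant), with
    Phi(s) = E <D_1, D_2> exp(-|W_1 - W_2|_A^2 / 2) cos(s . (Z_1 - Z_2)) >= 0.  If Phi vanished identically, then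
    positive semidefiniteness on samples augmented by an arbitrary point would give
    E D exp(-|W - w'|_A^2 / 2) cos(s . (Z - z')) = 0 for all z', w', i.e. the Laplace transform in W of
    D exp(-|W|_A^2 / 2) exp(i s . Z) would vanish, whence D = 0 almost surely.
*)
theory Submission
  imports Defs
begin

section \<open>U-statistics of i.i.d. samples\<close>

text \<open>The rate is decided by the noise part of E g_1^2, the second moment of r <V, T D>.
  Schur's bound E|T D|^2 <= \<Lambda>^2 E|D|^2, with \<Lambda> = sup_x E k(x, X) of order h^(q/2),
  would after division by n theta^2 leave 1 / (n r^2 h^q), which the hypothesis on r_n does not
  control. With one factor \<Lambda> traded for Q the quotient is \<Lambda> / (n r^2 Q), at most a
  multiple of 1 / (n r^2 h^(q/2)). Under the Fourier condition on f_Z the exponent q/2 comes from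
  Cauchy-Schwarz in frequency space: a row average pairs FT(K)(t) with the characteristic function
  of Z at t/h, which is only known to be square integrable. Averaging over both points squares that
  function, so E k_12 has the full order h^q, as the noise term of E g^2 demands. The kernel is
  given as a density, so its values on null sets are arbitrary and it need not be positive
  semidefinite pointwise. The estimates are made for the continuous version obtained by Fourier
  inversion; as Z has a density, both versions almost surely give the same statistic.\<close>

lemma sum_off_diagonal:
  fixes f :: "'i \<Rightarrow> 'i \<Rightarrow> 'b::comm_monoid_add"
  assumes "finite A"
  shows "(\<Sum>i\<in>A. \<Sum>j\<in>A - {i}. f i j) = (\<Sum>(i, j)\<in>{p \<in> A \<times> A. fst p \<noteq> snd p}. f i j)"
proof -
  have "{p \<in> A \<times> A. fst p \<noteq> snd p} = Sigma A (\<lambda>i. A - {i})" by auto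
  then show ?thesis using assms by (simp add: sum.Sigma)
qed

text \<open>Each of the four single coincidences between the pairs \<open>(i, j)\<close> and
  \<open>(k, l)\<close> leaves three free indices, each of the two double ones leaves two. In the
  variance bound \<open>a\<close> and \<open>b\<close> are the covariance bounds attached to the two
  kinds of overlap.\<close>

lemma sum_indicator_pairs:
  fixes a b :: real and n :: nat
  shows "(\<Sum>(i, j)\<in>{1..n} \<times> {1..n}. \<Sum>(k, l)\<in>{1..n} \<times> {1..n}.
      (of_bool (i = k) + of_bool (i = l) + of_bool (j = k) + of_bool (j = l)) * a +
      (of_bool (i = k \<and> j = l) + of_bool (i = l \<and> j = k)) * b)
    = 4 * real n ^ 3 * a + 2 * real n ^ 2 * b"
proof -
  define e where "e i k = (of_bool (i = k) :: real)" for i k :: nat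
  have e: "(\<Sum>k = 1..n. e i k) = 1" if "i \<in> {1..n}" for i
  proof -
    have "(\<Sum>k = 1..n. e i k) = (\<Sum>k = 1..n. if i = k then 1 else 0)"
      by (intro sum.cong) (auto simp: e_def)
    then show ?thesis using that by simp
  qed
  have inner: "(\<Sum>k = 1..n. \<Sum>l = 1..n. (e i k + e i l + e j k + e j l) * a + (e i k * e j l + e i l * e j k) * b)
      = 4 * real n * a + 2 * b" if ij: "i \<in> {1..n}" "j \<in> {1..n}" for i j
  proof -
    have "(\<Sum>l = 1..n. (e i k + e i l + e j k + e j l) * a + (e i k * e j l + e i l * e j k) * b)
        = e i k * (real n * a + b) + e j k * (real n * a + b) + 2 * a" for k
    proof -
      have "(\<Sum>l = 1..n. (e i k + e i l + e j k + e j l) * a + (e i k * e j l + e i l * e j k) * b)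
          = (\<Sum>l = 1..n. (e i k * a + e j k * a) + e i l * (a + e j k * b) + e j l * (a + e i k * b))"
        by (intro sum.cong refl) (simp only: algebra_simps)
      also have "\<dots> = real n * (e i k * a + e j k * a) + (a + e j k * b) + (a + e i k * b)"
        by (simp only: sum.distrib sum_distrib_right[symmetric] e[OF ij(1)] e[OF ij(2)])
          (simp add: algebra_simps)
      finally show ?thesis by (simp add: algebra_simps)
    qed
    then have "(\<Sum>k = 1..n. \<Sum>l = 1..n. (e i k + e i l + e j k + e j l) * a + (e i k * e j l + e i l * e j k) * b)
        = (\<Sum>k = 1..n. e i k * (real n * a + b) + e j k * (real n * a + b) + 2 * a)"
      by (simp only:)
    also have "\<dots> = 4 * real n * a + 2 * b"
      by (simp only: sum.distrib sum_distrib_right[symmetric] e[OF ij(1)] e[OF ij(2)])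
        (simp add: algebra_simps)
    finally show ?thesis .
  qed
  have "(\<Sum>(i, j)\<in>{1..n} \<times> {1..n}. \<Sum>(k, l)\<in>{1..n} \<times> {1..n}.
      (of_bool (i = k) + of_bool (i = l) + of_bool (j = k) + of_bool (j = l)) * a +
      (of_bool (i = k \<and> j = l) + of_bool (i = l \<and> j = k)) * b)
    = (\<Sum>i = 1..n. \<Sum>j = 1..n. \<Sum>k = 1..n. \<Sum>l = 1..n.
      (e i k + e i l + e j k + e j l) * a + (e i k * e j l + e i l * e j k) * b)"
    unfolding sum.cartesian_product' by (simp only: of_bool_conj e_def prod.case)
  also have "\<dots> = (\<Sum>i = 1..n. \<Sum>j = 1..n. 4 * real n * a + 2 * b)"
    by (intro sum.cong refl inner)
  also have "\<dots> = 4 * real n ^ 3 * a + 2 * real n ^ 2 * b"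
    by (simp add: power2_eq_square power3_eq_cube algebra_simps)
  finally show ?thesis .
qed

text \<open>\<open>X i\<close> is a whole observation. \<open>P\<close> serves both as the
  sigma-algebra of the values and as their common law, so that integrals over
  \<open>P \<Otimes>\<^sub>M P\<close> are expectations over two independent observations.\<close>

locale iid_sample = prob_space M for M :: "'a measure" +
  fixes X :: "nat \<Rightarrow> 'a \<Rightarrow> 'x" and P :: "'x measure"
  assumes indep_X: "indep_vars (\<lambda>_. P) X {1..}"
    and distr_X: "i \<ge> 1 \<Longrightarrow> distr M P (X i) = P"
begin

lemma measurable_X: "i \<ge> 1 \<Longrightarrow> X i \<in> measurable M P"
  using indep_X by (auto simp: indep_vars_def)

lemma prob_space_P: "prob_space P"
  using prob_space_distr[OF measurable_X[of 1]] distr_X[of 1] by simp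

sublocale P: prob_space P by (rule prob_space_P)
sublocale PP: pair_prob_space P P ..
sublocale P3: pair_prob_space P "P \<Otimes>\<^sub>M P" ..
sublocale P4: pair_prob_space "P \<Otimes>\<^sub>M P" "P \<Otimes>\<^sub>M P" ..

lemma indep_blocks:
  assumes "A \<inter> B = {}" "A \<subseteq> {1..}" "B \<subseteq> {1..}"
    and "f \<in> measurable (PiM A (\<lambda>_. P)) S" "g \<in> measurable (PiM B (\<lambda>_. P)) T"
  shows "indep_var S (\<lambda>\<omega>. f (\<lambda>i\<in>A. X i \<omega>)) T (\<lambda>\<omega>. g (\<lambda>i\<in>B. X i \<omega>))"
  using indep_var_compose[OF indep_var_restrict[OF indep_X assms(1-3)] assms(4,5)]
  by (simp add: comp_def)

lemma distr_pair:
  assumes "i \<ge> 1" "j \<ge> 1" "i \<noteq> j"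
  shows "distr M (P \<Otimes>\<^sub>M P) (\<lambda>\<omega>. (X i \<omega>, X j \<omega>)) = P \<Otimes>\<^sub>M P"
proof -
  have "indep_var P (\<lambda>\<omega>. (\<lambda>f. f i) (\<lambda>m\<in>{i}. X m \<omega>)) P (\<lambda>\<omega>. (\<lambda>f. f j) (\<lambda>m\<in>{j}. X m \<omega>))"
    using assms by (intro indep_blocks) auto
  then show ?thesis
    using assms by (simp add: indep_var_distribution_eq distr_X)
qed

lemma distr_triple:
  assumes "i \<ge> 1" "j \<ge> 1" "k \<ge> 1" "i \<noteq> j" "i \<noteq> k" "j \<noteq> k"
  shows "distr M (P \<Otimes>\<^sub>M (P \<Otimes>\<^sub>M P)) (\<lambda>\<omega>. (X i \<omega>, (X j \<omega>, X k \<omega>))) = P \<Otimes>\<^sub>M (P \<Otimes>\<^sub>M P)"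
proof -
  note [measurable] = measurable_X assms(1-3)
  \<comment> \<open>Both arguments of \<open>indep_var\<close> have the same type, so
    \<open>X i\<close> enters as a pair of two copies of itself; \<open>fst\<close> removes the copy
    afterwards.\<close>
  have "indep_var (P \<Otimes>\<^sub>M P) (\<lambda>\<omega>. (\<lambda>f. (f i, f i)) (\<lambda>m\<in>{i}. X m \<omega>))
      (P \<Otimes>\<^sub>M P) (\<lambda>\<omega>. (\<lambda>f. (f j, f k)) (\<lambda>m\<in>{j, k}. X m \<omega>))"
    using assms by (intro indep_blocks) auto
  then have *: "distr M ((P \<Otimes>\<^sub>M P) \<Otimes>\<^sub>M (P \<Otimes>\<^sub>M P)) (\<lambda>\<omega>. ((X i \<omega>, X i \<omega>), (X j \<omega>, X k \<omega>)))
      = distr M (P \<Otimes>\<^sub>M P) (\<lambda>\<omega>. (X i \<omega>, X i \<omega>)) \<Otimes>\<^sub>M (P \<Otimes>\<^sub>M P)"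
    using assms by (simp add: indep_var_distribution_eq distr_pair)
  have m[measurable]: "(\<lambda>\<omega>. (X i \<omega>, X i \<omega>)) \<in> measurable M (P \<Otimes>\<^sub>M P)"
    "(\<lambda>\<omega>. ((X i \<omega>, X i \<omega>), (X j \<omega>, X k \<omega>))) \<in> measurable M ((P \<Otimes>\<^sub>M P) \<Otimes>\<^sub>M (P \<Otimes>\<^sub>M P))"
    by measurable
  have "distr M (P \<Otimes>\<^sub>M (P \<Otimes>\<^sub>M P)) (\<lambda>\<omega>. (X i \<omega>, (X j \<omega>, X k \<omega>)))
      = distr (distr M ((P \<Otimes>\<^sub>M P) \<Otimes>\<^sub>M (P \<Otimes>\<^sub>M P)) (\<lambda>\<omega>. ((X i \<omega>, X i \<omega>), (X j \<omega>, X k \<omega>))))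
          (P \<Otimes>\<^sub>M (P \<Otimes>\<^sub>M P)) (\<lambda>(a, b). (fst a, b))"
    by (subst distr_distr) (auto simp: comp_def)
  also have "\<dots> = distr (distr M (P \<Otimes>\<^sub>M P) (\<lambda>\<omega>. (X i \<omega>, X i \<omega>))) P fst
      \<Otimes>\<^sub>M distr (P \<Otimes>\<^sub>M P) (P \<Otimes>\<^sub>M P) (\<lambda>b. b)"
    unfolding * by (subst pair_measure_distr) (auto intro: PP.sigma_finite_measure_axioms)
  also have "\<dots> = P \<Otimes>\<^sub>M (P \<Otimes>\<^sub>M P)"
    using assms by (subst distr_distr) (auto simp: comp_def distr_X)
  finally show ?thesis .
qed

lemma distr_quadruple:
  assumes "i \<ge> 1" "j \<ge> 1" "k \<ge> 1" "l \<ge> 1" "i \<noteq> j" "i \<noteq> k" "i \<noteq> l" "j \<noteq> k" "j \<noteq> l" "k \<noteq> l"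
  shows "distr M ((P \<Otimes>\<^sub>M P) \<Otimes>\<^sub>M (P \<Otimes>\<^sub>M P)) (\<lambda>\<omega>. ((X i \<omega>, X j \<omega>), (X k \<omega>, X l \<omega>)))
    = (P \<Otimes>\<^sub>M P) \<Otimes>\<^sub>M (P \<Otimes>\<^sub>M P)"
proof -
  have "indep_var (P \<Otimes>\<^sub>M P) (\<lambda>\<omega>. (\<lambda>f. (f i, f j)) (\<lambda>m\<in>{i, j}. X m \<omega>))
      (P \<Otimes>\<^sub>M P) (\<lambda>\<omega>. (\<lambda>f. (f k, f l)) (\<lambda>m\<in>{k, l}. X m \<omega>))"
    using assms by (intro indep_blocks) auto
  then show ?thesis
    using assms by (simp add: indep_var_distribution_eq distr_pair)
qed

lemma integral_pair:
  fixes g :: "'x \<times> 'x \<Rightarrow> 'b::{banach, second_countable_topology}"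
  assumes "g \<in> borel_measurable (P \<Otimes>\<^sub>M P)" "i \<ge> 1" "j \<ge> 1" "i \<noteq> j"
  shows "expectation (\<lambda>\<omega>. g (X i \<omega>, X j \<omega>)) = integral\<^sup>L (P \<Otimes>\<^sub>M P) g"
    and "integrable M (\<lambda>\<omega>. g (X i \<omega>, X j \<omega>)) \<longleftrightarrow> integrable (P \<Otimes>\<^sub>M P) g"
proof -
  note [measurable] = measurable_X assms(1)
  have m: "(\<lambda>\<omega>. (X i \<omega>, X j \<omega>)) \<in> measurable M (P \<Otimes>\<^sub>M P)" using assms by measurable
  show "expectation (\<lambda>\<omega>. g (X i \<omega>, X j \<omega>)) = integral\<^sup>L (P \<Otimes>\<^sub>M P) g"
    using integral_distr[OF m assms(1)] assms by (simp add: distr_pair)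
  show "integrable M (\<lambda>\<omega>. g (X i \<omega>, X j \<omega>)) \<longleftrightarrow> integrable (P \<Otimes>\<^sub>M P) g"
    using integrable_distr_eq[OF m assms(1)] assms by (simp add: distr_pair)
qed

lemma integral_single:
  fixes f :: "'x \<Rightarrow> 'b::{banach, second_countable_topology}"
  assumes "f \<in> borel_measurable P" "i \<ge> 1"
  shows "expectation (\<lambda>\<omega>. f (X i \<omega>)) = integral\<^sup>L P f"
    and "integrable M (\<lambda>\<omega>. f (X i \<omega>)) \<longleftrightarrow> integrable P f"
  using integral_distr[OF measurable_X assms(1)] integrable_distr_eq[OF measurable_X assms(1)] assms
  by (simp_all add: distr_X)

lemma AE_pair:
  assumes "AE x in P \<Otimes>\<^sub>M P. Q x" "i \<ge> 1" "j \<ge> 1" "i \<noteq> j"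
  shows "AE \<omega> in M. Q (X i \<omega>, X j \<omega>)"
proof -
  have m: "(\<lambda>\<omega>. (X i \<omega>, X j \<omega>)) \<in> measurable M (P \<Otimes>\<^sub>M P)"
    using measurable_X assms by measurable
  show ?thesis
    using AE_distrD[OF m, of Q] assms(1) unfolding distr_pair[OF assms(2-4)] by simp
qed

lemma integral_mult_independent:
  fixes f g :: "'x \<Rightarrow> real"
  assumes "integrable P f" "integrable P g"
  shows "(\<integral>p. f (fst p) * g (snd p) \<partial>(P \<Otimes>\<^sub>M P)) = integral\<^sup>L P f * integral\<^sup>L P g"
proof -
  have [measurable]: "f \<in> borel_measurable P" "g \<in> borel_measurable P" using assms by auto
  have "integrable (P \<Otimes>\<^sub>M P) (\<lambda>p. f (fst p) * g (snd p))"
    by (rule PP.Fubini_integrable) (use assms in \<open>auto simp: abs_mult\<close>)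
  then show ?thesis
    by (subst PP.integral_fst'[symmetric]) (simp_all add: assms)
qed

text \<open>The variance is a double sum of covariances over pairs of index pairs. Disjoint pairs
  are independent and contribute zero; pairs with one common index contribute at most the second
  moment of the projection \<open>\<integral>y. g (x, y) \<partial>P\<close>, coinciding pairs at
  most that of \<open>g\<close>. The negative term \<open>- \<theta>\<^sup>2\<close> is dropped
  whenever the pairs overlap.\<close>

lemma ustatistic_variance:
  fixes g :: "'x \<times> 'x \<Rightarrow> real" and n :: nat
  assumes meas[measurable]: "g \<in> borel_measurable (P \<Otimes>\<^sub>M P)"
    and sym: "\<And>x y. g (x, y) = g (y, x)"
    and sq: "integrable (P \<Otimes>\<^sub>M P) (\<lambda>p. (g p)\<^sup>2)"
  defines "S \<equiv> \<lambda>\<omega>. \<Sum>i\<in>{1..n}. \<Sum>j\<in>{1..n} - {i}. g (X i \<omega>, X j \<omega>)"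
    and "\<theta> \<equiv> integral\<^sup>L (P \<Otimes>\<^sub>M P) g"
  shows "integrable M (\<lambda>\<omega>. (S \<omega> - real n * (real n - 1) * \<theta>)\<^sup>2)"
    and "expectation (\<lambda>\<omega>. (S \<omega> - real n * (real n - 1) * \<theta>)\<^sup>2)
      \<le> 4 * real n ^ 3 * (\<integral>x. (\<integral>y. g (x, y) \<partial>P)\<^sup>2 \<partial>P) + 2 * real n ^ 2 * (\<integral>p. (g p)\<^sup>2 \<partial>(P \<Otimes>\<^sub>M P))"
proof -
  define A where "A = {p \<in> {1..n} \<times> {1..n}. fst p \<noteq> snd p}"
  define G where "G p \<omega> = g (X (fst p) \<omega>, X (snd p) \<omega>)" for p \<omega>
  define V1 where "V1 = (\<integral>x. (\<integral>y. g (x, y) \<partial>P)\<^sup>2 \<partial>P)"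
  define V2 where "V2 = (\<integral>p. (g p)\<^sup>2 \<partial>(P \<Otimes>\<^sub>M P))"
  have nonneg: "V1 \<ge> 0" "V2 \<ge> 0" by (simp_all add: V1_def V2_def)
  have finA: "finite A" by (simp add: A_def)
  have "A = {1..n} \<times> {1..n} - (\<lambda>i. (i, i)) ` {1..n}" by (auto simp: A_def)
  then have "card A = n * n - n"
    by (simp add: card_Diff_subset card_image inj_on_def image_subset_iff)
  then have cardA: "real (card A) = real n * (real n - 1)"
    by (simp add: of_nat_diff algebra_simps)
  have G_meas: "G p \<in> borel_measurable M" if "p \<in> A" for p
  proof -
    have [measurable]: "X (fst p) \<in> measurable M P" "X (snd p) \<in> measurable M P"
      using that by (auto simp: A_def measurable_X)
    show ?thesis unfolding G_def by measurable
  qed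
  have G_sq: "integrable M (\<lambda>\<omega>. (G p \<omega>)\<^sup>2)" "expectation (\<lambda>\<omega>. (G p \<omega>)\<^sup>2) = V2" if "p \<in> A" for p
    using that integral_pair[of "\<lambda>p. (g p)\<^sup>2" "fst p" "snd p"] sq
    by (auto simp: G_def A_def V2_def)
  have G_prod: "integrable M (\<lambda>\<omega>. G p \<omega> * G p' \<omega>)" if "p \<in> A" "p' \<in> A" for p p'
  proof (rule Bochner_Integration.integrable_bound)
    show "integrable M (\<lambda>\<omega>. (G p \<omega>)\<^sup>2 + (G p' \<omega>)\<^sup>2)" using G_sq that by auto
    show "(\<lambda>\<omega>. G p \<omega> * G p' \<omega>) \<in> borel_measurable M" using G_meas that by measurable
    have "\<bar>a * b\<bar> \<le> a\<^sup>2 + b\<^sup>2" for a b :: real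
    proof -
      have "0 \<le> \<bar>a\<bar> * \<bar>b\<bar>" by simp
      moreover have "2 * (\<bar>a\<bar> * \<bar>b\<bar>) \<le> a\<^sup>2 + b\<^sup>2"
        using sum_squares_bound[of "\<bar>a\<bar>" "\<bar>b\<bar>"] by (simp add: mult.assoc)
      ultimately show ?thesis unfolding abs_mult by linarith
    qed
    then show "AE \<omega> in M. norm (G p \<omega> * G p' \<omega>) \<le> norm ((G p \<omega>)\<^sup>2 + (G p' \<omega>)\<^sup>2)" by simp
  qed
  have G_int: "integrable M (G p)" "expectation (G p) = \<theta>" if "p \<in> A" for p
  proof -
    show "integrable M (G p)"
      using G_sq that G_meas square_integrable_imp_integrable by blast
    show "expectation (G p) = \<theta>"
      using that integral_pair(1)[OF meas, of "fst p" "snd p"] by (auto simp: G_def[abs_def] A_def \<theta>_def)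
  qed
  have G_sym: "G (i, j) = G (j, i)" for i j by (simp add: G_def sym fun_eq_iff)
  have sq_sec: "AE x in P. integrable P (\<lambda>y. (g (x, y))\<^sup>2)"
    using PP.AE_integrable_fst'[OF sq] .
  \<comment> \<open>Given the common coordinate the two factors are independent with the same
    conditional mean, so the expectation is that of a square.\<close>
  have share: "expectation (\<lambda>\<omega>. G (i, j) \<omega> * G (i, k) \<omega>) = V1"
    if "i \<in> {1..n}" "j \<in> {1..n}" "k \<in> {1..n}" "i \<noteq> j" "i \<noteq> k" "j \<noteq> k" for i j k
  proof -
    have "1 \<le> i" "1 \<le> j" "1 \<le> k" using that by auto
    note [measurable] = this[THEN measurable_X]
    have m: "(\<lambda>\<omega>. (X i \<omega>, (X j \<omega>, X k \<omega>))) \<in> measurable M (P \<Otimes>\<^sub>M (P \<Otimes>\<^sub>M P))"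
      by measurable
    define f where "f q = g (fst q, fst (snd q)) * g (fst q, snd (snd q))" for q
    have f[measurable]: "f \<in> borel_measurable (P \<Otimes>\<^sub>M (P \<Otimes>\<^sub>M P))" unfolding f_def by measurable
    have d: "distr M (P \<Otimes>\<^sub>M (P \<Otimes>\<^sub>M P)) (\<lambda>\<omega>. (X i \<omega>, (X j \<omega>, X k \<omega>))) = P \<Otimes>\<^sub>M (P \<Otimes>\<^sub>M P)"
      using that by (intro distr_triple) auto
    have fG: "f (X i \<omega>, (X j \<omega>, X k \<omega>)) = G (i, j) \<omega> * G (i, k) \<omega>" for \<omega>
      by (simp add: f_def G_def)
    have "integrable M (\<lambda>\<omega>. f (X i \<omega>, (X j \<omega>, X k \<omega>)))"
      unfolding fG using that by (intro G_prod) (auto simp: A_def)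
    then have int: "integrable (P \<Otimes>\<^sub>M (P \<Otimes>\<^sub>M P)) f"
      using integrable_distr_eq[OF m f] d by simp
    have "expectation (\<lambda>\<omega>. G (i, j) \<omega> * G (i, k) \<omega>) = integral\<^sup>L (P \<Otimes>\<^sub>M (P \<Otimes>\<^sub>M P)) f"
      using integral_distr[OF m f] d fG by simp
    moreover have "integral\<^sup>L (P \<Otimes>\<^sub>M (P \<Otimes>\<^sub>M P)) f = (\<integral>x. (\<integral>q. f (x, q) \<partial>(P \<Otimes>\<^sub>M P)) \<partial>P)"
      by (rule P3.integral_fst'[OF int, symmetric])
    moreover have "(\<integral>x. (\<integral>q. f (x, q) \<partial>(P \<Otimes>\<^sub>M P)) \<partial>P) = V1"
      unfolding V1_def
    proof (rule integral_cong_AE)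
      show "AE x in P. (\<integral>q. f (x, q) \<partial>(P \<Otimes>\<^sub>M P)) = (\<integral>y. g (x, y) \<partial>P)\<^sup>2"
        using sq_sec AE_space
      proof eventually_elim
        case (elim x)
        have [measurable]: "(\<lambda>y. g (x, y)) \<in> borel_measurable P"
          using elim(2) by measurable
        have "integrable P (\<lambda>y. g (x, y))"
          by (rule P.square_integrable_imp_integrable[OF _ elim(1)]) measurable
        then have "(\<integral>q. g (x, fst q) * g (x, snd q) \<partial>(P \<Otimes>\<^sub>M P)) = (\<integral>y. g (x, y) \<partial>P) * (\<integral>y. g (x, y) \<partial>P)"
          by (intro integral_mult_independent)
        then show ?case
          unfolding f_def power2_eq_square fst_conv snd_conv .
      qed
    qed measurable
    ultimately show ?thesis by simp
  qed
  have disjoint: "expectation (\<lambda>\<omega>. G (i, j) \<omega> * G (k, l) \<omega>) = \<theta>\<^sup>2"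
    if "i \<in> {1..n}" "j \<in> {1..n}" "k \<in> {1..n}" "l \<in> {1..n}" "i \<noteq> j" "i \<noteq> k" "i \<noteq> l" "j \<noteq> k" "j \<noteq> l" "k \<noteq> l"
    for i j k l
  proof -
    have "1 \<le> i" "1 \<le> j" "1 \<le> k" "1 \<le> l" using that by auto
    note [measurable] = this[THEN measurable_X]
    have m: "(\<lambda>\<omega>. ((X i \<omega>, X j \<omega>), (X k \<omega>, X l \<omega>))) \<in> measurable M ((P \<Otimes>\<^sub>M P) \<Otimes>\<^sub>M (P \<Otimes>\<^sub>M P))"
      by measurable
    define f where "f q = g (fst q) * g (snd q)" for q
    have f[measurable]: "f \<in> borel_measurable ((P \<Otimes>\<^sub>M P) \<Otimes>\<^sub>M (P \<Otimes>\<^sub>M P))" unfolding f_def by measurable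
    have d: "distr M ((P \<Otimes>\<^sub>M P) \<Otimes>\<^sub>M (P \<Otimes>\<^sub>M P)) (\<lambda>\<omega>. ((X i \<omega>, X j \<omega>), (X k \<omega>, X l \<omega>)))
        = (P \<Otimes>\<^sub>M P) \<Otimes>\<^sub>M (P \<Otimes>\<^sub>M P)"
      using that by (intro distr_quadruple) auto
    have fG: "f ((X i \<omega>, X j \<omega>), (X k \<omega>, X l \<omega>)) = G (i, j) \<omega> * G (k, l) \<omega>" for \<omega>
      by (simp add: f_def G_def)
    have "integrable M (\<lambda>\<omega>. f ((X i \<omega>, X j \<omega>), (X k \<omega>, X l \<omega>)))"
      unfolding fG using that by (intro G_prod) (auto simp: A_def)
    then have int: "integrable ((P \<Otimes>\<^sub>M P) \<Otimes>\<^sub>M (P \<Otimes>\<^sub>M P)) f"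
      using integrable_distr_eq[OF m f] d by simp
    have "expectation (\<lambda>\<omega>. G (i, j) \<omega> * G (k, l) \<omega>) = integral\<^sup>L ((P \<Otimes>\<^sub>M P) \<Otimes>\<^sub>M (P \<Otimes>\<^sub>M P)) f"
      using integral_distr[OF m f] d fG by simp
    also have "\<dots> = (\<integral>x. (\<integral>q. f (x, q) \<partial>(P \<Otimes>\<^sub>M P)) \<partial>(P \<Otimes>\<^sub>M P))"
      by (rule P4.integral_fst'[OF int, symmetric])
    also have "\<dots> = \<theta>\<^sup>2"
      by (simp add: f_def \<theta>_def power2_eq_square)
    finally show ?thesis .
  qed
  \<comment> \<open>The seven cases list how two pairs of distinct indices can meet;
    \<open>G_sym\<close> reduces each of them to \<open>share\<close>, \<open>disjoint\<close> or
    the second moment, and any further summand on the right is nonnegative.\<close>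
  have cov: "expectation (\<lambda>\<omega>. G (i, j) \<omega> * G (k, l) \<omega>) - \<theta>\<^sup>2 \<le>
      (of_bool (i = k) + of_bool (i = l) + of_bool (j = k) + of_bool (j = l)) * V1 +
      (of_bool (i = k \<and> j = l) + of_bool (i = l \<and> j = k)) * V2" (is "_ \<le> ?R")
    if "(i, j) \<in> A" "(k, l) \<in> A" for i j k l
  proof -
    have ne: "i \<noteq> j" "k \<noteq> l" and I: "i \<in> {1..n}" "j \<in> {1..n}" "k \<in> {1..n}" "l \<in> {1..n}"
      using that by (auto simp: A_def)
    have sqr: "expectation (\<lambda>\<omega>. G (i, j) \<omega> * G (i, j) \<omega>) = V2"
      using G_sq(2)[OF that(1)] by (simp add: power2_eq_square)
    define t where "t = \<theta>\<^sup>2"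
    have \<theta>: "0 \<le> t" by (simp add: t_def)
    consider "i = k" "j = l" | "i = l" "j = k" | "i = k" "j \<noteq> l" | "i = l" "j \<noteq> k"
      | "j = k" "i \<noteq> l" | "j = l" "i \<noteq> k" | "i \<noteq> k" "i \<noteq> l" "j \<noteq> k" "j \<noteq> l" by blast
    then show ?thesis
    proof cases
      case 1 then show ?thesis unfolding t_def[symmetric] using sqr nonneg \<theta> ne by simp
    next
      case 2 then show ?thesis unfolding t_def[symmetric] using sqr nonneg \<theta> ne G_sym[of k l] by simp
    next
      case 3 then show ?thesis unfolding t_def[symmetric] using share[of i j l] I ne nonneg \<theta> by simp
    next
      case 4 then show ?thesis unfolding t_def[symmetric] using share[of i j k] I ne nonneg \<theta> G_sym[of k l] by simp
    next
      case 5 then show ?thesis unfolding t_def[symmetric] using share[of j i l] I ne nonneg \<theta> G_sym[of i j] by simp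
    next
      case 6 then show ?thesis unfolding t_def[symmetric] using share[of j i k] I ne nonneg \<theta> G_sym[of i j] G_sym[of k l] by simp
    next
      case 7 then show ?thesis unfolding t_def[symmetric] using disjoint[of i j k l, folded t_def] I ne by simp
    qed
  qed
  have S: "S \<omega> = (\<Sum>p\<in>A. G p \<omega>)" for \<omega>
    by (simp add: S_def sum_off_diagonal A_def G_def case_prod_beta)
  have expand: "(S \<omega> - real n * (real n - 1) * \<theta>)\<^sup>2 =
      (\<Sum>p\<in>A. \<Sum>p'\<in>A. G p \<omega> * G p' \<omega> - \<theta> * G p \<omega> - \<theta> * G p' \<omega> + \<theta>\<^sup>2)" for \<omega>
  proof -
    have "S \<omega> - real n * (real n - 1) * \<theta> = (\<Sum>p\<in>A. G p \<omega> - \<theta>)"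
      by (simp add: S cardA[symmetric] sum_subtractf)
    then have "(S \<omega> - real n * (real n - 1) * \<theta>)\<^sup>2 = (\<Sum>p\<in>A. \<Sum>p'\<in>A. (G p \<omega> - \<theta>) * (G p' \<omega> - \<theta>))"
      by (simp add: power2_eq_square sum_product)
    also have "\<dots> = (\<Sum>p\<in>A. \<Sum>p'\<in>A. G p \<omega> * G p' \<omega> - \<theta> * G p \<omega> - \<theta> * G p' \<omega> + \<theta>\<^sup>2)"
      by (intro sum.cong refl) (simp add: algebra_simps power2_eq_square)
    finally show ?thesis .
  qed
  show "integrable M (\<lambda>\<omega>. (S \<omega> - real n * (real n - 1) * \<theta>)\<^sup>2)"
    unfolding expand using G_prod G_int
    by (intro Bochner_Integration.integrable_sum Bochner_Integration.integrable_add
        Bochner_Integration.integrable_diff) auto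
  have "expectation (\<lambda>\<omega>. (S \<omega> - real n * (real n - 1) * \<theta>)\<^sup>2)
      = (\<Sum>p\<in>A. \<Sum>p'\<in>A. expectation (\<lambda>\<omega>. G p \<omega> * G p' \<omega>) - \<theta>\<^sup>2)"
    unfolding expand using G_prod G_int
    by (simp add: Bochner_Integration.integral_sum Bochner_Integration.integral_add
        Bochner_Integration.integral_diff prob_space power2_eq_square)
  also have "\<dots> \<le> (\<Sum>(i, j)\<in>A. \<Sum>(k, l)\<in>A.
      (of_bool (i = k) + of_bool (i = l) + of_bool (j = k) + of_bool (j = l)) * V1 +
      (of_bool (i = k \<and> j = l) + of_bool (i = l \<and> j = k)) * V2)"
    using cov by (intro sum_mono) (auto intro!: sum_mono simp del: of_bool_eq_iff)
  \<comment> \<open>Admitting the diagonal pairs only adds nonnegative terms and gives the full sum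
    evaluated by \<open>sum_indicator_pairs\<close>.\<close>
  also have "\<dots> \<le> (\<Sum>(i, j)\<in>{1..n} \<times> {1..n}. \<Sum>(k, l)\<in>{1..n} \<times> {1..n}.
      (of_bool (i = k) + of_bool (i = l) + of_bool (j = k) + of_bool (j = l)) * V1 +
      (of_bool (i = k \<and> j = l) + of_bool (i = l \<and> j = k)) * V2)"
  proof -
    have AB: "A \<subseteq> {1..n} \<times> {1..n}" by (auto simp: A_def)
    have mono: "(\<Sum>p\<in>A. \<Sum>p'\<in>A. F p p') \<le> (\<Sum>p\<in>{1..n} \<times> {1..n}. \<Sum>p'\<in>{1..n} \<times> {1..n}. F p p')"
      if "\<And>p p'. F p p' \<ge> 0" for F :: "nat \<times> nat \<Rightarrow> nat \<times> nat \<Rightarrow> real"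
    proof -
      have "(\<Sum>p\<in>A. \<Sum>p'\<in>A. F p p') \<le> (\<Sum>p\<in>A. \<Sum>p'\<in>{1..n} \<times> {1..n}. F p p')"
        using AB that by (intro sum_mono sum_mono2) auto
      also have "\<dots> \<le> (\<Sum>p\<in>{1..n} \<times> {1..n}. \<Sum>p'\<in>{1..n} \<times> {1..n}. F p p')"
        using AB that by (intro sum_mono2) (auto intro: sum_nonneg)
      finally show ?thesis .
    qed
    show ?thesis
      unfolding case_prod_beta
      by (rule mono, intro add_nonneg_nonneg mult_nonneg_nonneg nonneg) simp_all
  qed
  finally show "expectation (\<lambda>\<omega>. (S \<omega> - real n * (real n - 1) * \<theta>)\<^sup>2)
      \<le> 4 * real n ^ 3 * (\<integral>x. (\<integral>y. g (x, y) \<partial>P)\<^sup>2 \<partial>P) + 2 * real n ^ 2 * (\<integral>p. (g p)\<^sup>2 \<partial>(P \<Otimes>\<^sub>M P))"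
    unfolding sum_indicator_pairs V1_def V2_def .
qed

end

section \<open>Positive semidefinite kernels\<close>

text \<open>The weights are vectors of the inner product space \<open>'u\<close> because the forms
  to be estimated are E <F, F'> k; the \<open>itself\<close> argument fixes this type. Only finite
  index families occur, so the notion passes to pointwise limits and to mixtures.\<close>

definition psd :: "'u::real_inner itself \<Rightarrow> ('s \<Rightarrow> 's \<Rightarrow> real) \<Rightarrow> bool" where
  "psd _ k \<longleftrightarrow> (\<forall>(I::nat set) d x. finite I \<longrightarrow>
     0 \<le> (\<Sum>i\<in>I. \<Sum>j\<in>I. ((d i :: 'u) \<bullet> d j) * k (x i) (x j)))"

lemma psdD:
  fixes I :: "nat set"
  assumes "psd TYPE('u::real_inner) k" "finite I"
  shows "0 \<le> (\<Sum>i\<in>I. \<Sum>j\<in>I. ((d i :: 'u) \<bullet> d j) * k (x i) (x j))"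
  by (rule assms(1)[unfolded psd_def, rule_format, OF assms(2)])

lemma psd_one: "psd TYPE('u::real_inner) (\<lambda>x y. 1)"
proof -
  have "(\<Sum>i\<in>I. \<Sum>j\<in>I. (d i :: 'u) \<bullet> d j) = (\<Sum>i\<in>I. d i) \<bullet> (\<Sum>i\<in>I. d i)" for I :: "nat set" and d
    by (subst inner_sum_left) (simp add: inner_sum_right)
  then show ?thesis by (simp add: psd_def)
qed

text \<open>The factors \<open>u (x i)\<close> are absorbed into the weights.\<close>

lemma psd_scale:
  assumes "psd TYPE('u::real_inner) k"
  shows "psd TYPE('u) (\<lambda>x y. u x * u y * k x y)"
  unfolding psd_def
proof (intro allI impI)
  fix I :: "nat set" and d :: "nat \<Rightarrow> 'u" and x :: "nat \<Rightarrow> 'a"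
  assume "finite I"
  then have "0 \<le> (\<Sum>i\<in>I. \<Sum>j\<in>I. ((u (x i) *\<^sub>R d i) \<bullet> (u (x j) *\<^sub>R d j)) * k (x i) (x j))"
    by (rule psdD[OF assms])
  then show "0 \<le> (\<Sum>i\<in>I. \<Sum>j\<in>I. (d i \<bullet> d j) * (u (x i) * u (x j) * k (x i) (x j)))"
    by (simp add: mult_ac)
qed

lemma psd_add:
  assumes "psd TYPE('u::real_inner) k" "psd TYPE('u) l"
  shows "psd TYPE('u) (\<lambda>x y. k x y + l x y)"
  unfolding psd_def distrib_left sum.distrib
proof (intro allI impI)
  fix I :: "nat set" and d :: "nat \<Rightarrow> 'u" and x :: "nat \<Rightarrow> 'a"
  assume I: "finite I"
  show "0 \<le> (\<Sum>i\<in>I. \<Sum>j\<in>I. (d i \<bullet> d j) * k (x i) (x j)) + (\<Sum>i\<in>I. \<Sum>j\<in>I. (d i \<bullet> d j) * l (x i) (x j))"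
    by (rule add_nonneg_nonneg[OF psdD[OF assms(1) I] psdD[OF assms(2) I]])
qed

lemma psd_zero: "psd TYPE('u::real_inner) (\<lambda>x y. 0)"
  by (simp add: psd_def)

lemma psd_sum:
  assumes "\<And>t. t \<in> T \<Longrightarrow> psd TYPE('u::real_inner) (k t)"
  shows "psd TYPE('u) (\<lambda>x y. \<Sum>t\<in>T. k t x y)"
  using assms by (induction T rule: infinite_finite_induct) (simp_all add: psd_zero psd_add)

lemma psd_tendsto:
  fixes l :: "'s \<Rightarrow> 's \<Rightarrow> real"
  assumes "\<And>t. psd TYPE('u::real_inner) (k t)" "\<And>x y. ((\<lambda>t. k t x y) \<longlongrightarrow> l x y) F" "F \<noteq> bot"
  shows "psd TYPE('u) l"
  unfolding psd_def
proof (intro allI impI)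
  fix I :: "nat set" and d :: "nat \<Rightarrow> 'u" and x :: "nat \<Rightarrow> 's"
  assume "finite I"
  show "0 \<le> (\<Sum>i\<in>I. \<Sum>j\<in>I. (d i \<bullet> d j) * l (x i) (x j))"
  proof (rule tendsto_lowerbound[OF _ _ \<open>F \<noteq> bot\<close>])
    show "((\<lambda>t. \<Sum>i\<in>I. \<Sum>j\<in>I. (d i \<bullet> d j) * k t (x i) (x j)) \<longlongrightarrow>
        (\<Sum>i\<in>I. \<Sum>j\<in>I. (d i \<bullet> d j) * l (x i) (x j))) F"
      by (intro tendsto_intros assms)
    show "\<forall>\<^sub>F t in F. 0 \<le> (\<Sum>i\<in>I. \<Sum>j\<in>I. (d i \<bullet> d j) * k t (x i) (x j))"
      using psdD[OF assms(1) \<open>finite I\<close>] by auto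
  qed
qed

lemma psd_integral:
  fixes k :: "'t \<Rightarrow> 's \<Rightarrow> 's \<Rightarrow> real"
  assumes "\<And>t. psd TYPE('u::real_inner) (k t)" "\<And>x y. integrable N (\<lambda>t. k t x y)"
  shows "psd TYPE('u) (\<lambda>x y. \<integral>t. k t x y \<partial>N)"
  unfolding psd_def
proof (intro allI impI)
  fix I :: "nat set" and d :: "nat \<Rightarrow> 'u" and x :: "nat \<Rightarrow> 's"
  assume "finite I"
  have "0 \<le> (\<integral>t. (\<Sum>i\<in>I. \<Sum>j\<in>I. (d i \<bullet> d j) * k t (x i) (x j)) \<partial>N)"
    using psdD[OF assms(1) \<open>finite I\<close>] by (intro Bochner_Integration.integral_nonneg)
  also have "\<dots> = (\<Sum>i\<in>I. \<Sum>j\<in>I. (d i \<bullet> d j) * (\<integral>t. k t (x i) (x j) \<partial>N))"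
    using assms(2) by (simp add: Bochner_Integration.integral_sum)
  finally show "0 \<le> (\<Sum>i\<in>I. \<Sum>j\<in>I. (d i \<bullet> d j) * (\<integral>t. k t (x i) (x j) \<partial>N))" .
qed

text \<open>The addition theorem writes cos (f x - f y) as a sum of two products of the form u(x)
  u(y), so \<open>psd_scale\<close> applies twice.\<close>

lemma psd_cos:
  assumes "psd TYPE('u::real_inner) k"
  shows "psd TYPE('u) (\<lambda>x y. k x y * cos (f x - f y))"
proof -
  have "psd TYPE('u) (\<lambda>x y. cos (f x) * cos (f y) * k x y + sin (f x) * sin (f y) * k x y)"
    by (intro psd_add psd_scale assms)
  moreover have "cos (f x) * cos (f y) * k x y + sin (f x) * sin (f y) * k x y = k x y * cos (f x - f y)"
    for x y by (simp add: cos_diff algebra_simps)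
  ultimately show ?thesis by (simp only:)
qed

text \<open>The second hypothesis, that multiplication by \<open>b\<close> preserves positivity,
  stands in for the Schur product theorem: iterating it handles the powers of \<open>b\<close>, and
  exp is a limit of sums of powers with positive coefficients.\<close>

lemma psd_exp:
  fixes b :: "'s \<Rightarrow> 's \<Rightarrow> real"
  assumes "psd TYPE('u::real_inner) k"
    and "\<And>l. psd TYPE('u) l \<Longrightarrow> psd TYPE('u) (\<lambda>x y. b x y * l x y)"
  shows "psd TYPE('u) (\<lambda>x y. exp (b x y) * k x y)"
proof -
  have pow: "psd TYPE('u) (\<lambda>x y. b x y ^ m * k x y)" for m
  proof (induction m)
    case 0
    then show ?case using assms(1) by simp
  next
    case (Suc m)
    then show ?case using assms(2)[OF Suc] by (simp add: mult.assoc)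
  qed
  \<comment> \<open>A positive constant is a scaling by its square root, split between the two
    arguments.\<close>
  have "psd TYPE('u) (\<lambda>x y. sqrt (1 / fact m) * sqrt (1 / fact m) * (b x y ^ m * k x y))" for m
    by (intro psd_scale pow)
  then have "psd TYPE('u) (\<lambda>x y. 1 / fact m * (b x y ^ m * k x y))" for m
    by (subst (asm) real_sqrt_mult_self) simp
  then have partial: "psd TYPE('u) (\<lambda>x y. \<Sum>m<n. 1 / fact m * (b x y ^ m * k x y))" for n
    by (intro psd_sum) auto
  have lim: "(\<lambda>n. \<Sum>m<n. 1 / fact m * (b x y ^ m * k x y)) \<longlonglongrightarrow> exp (b x y) * k x y" for x y
    using sums_mult2[OF exp_converges[of "b x y"], of "k x y"]
    by (simp add: sums_def divide_inverse scaleR_conv_of_real mult_ac)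
  show ?thesis by (rule psd_tendsto[OF partial lim]) simp
qed

section \<open>The weighted inner product and its Gaussian kernel\<close>

definition inner_A :: "nat set \<Rightarrow> (nat \<Rightarrow> 'b::real_inner) \<Rightarrow> (nat \<Rightarrow> real) \<Rightarrow> 'b \<Rightarrow> 'b \<Rightarrow> real" where
  "inner_A J \<phi> a v w = (\<Sum>\<^sub>\<infinity>k\<in>J. a k * ((v \<bullet> \<phi> k) * (w \<bullet> \<phi> k)))"

context
  fixes J :: "nat set" and \<phi> :: "nat \<Rightarrow> 'b::real_inner" and a :: "nat \<Rightarrow> real"
  assumes basis: "orthonormal_basis J \<phi>" and a_pos: "\<And>k. k \<in> J \<Longrightarrow> 0 < a k" and a_sum: "a summable_on J"
begin

lemma norm_basis: "k \<in> J \<Longrightarrow> norm (\<phi> k) = 1"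
  using basis by (auto simp: orthonormal_basis_def norm_eq_sqrt_inner)

lemma abs_inner_basis: "k \<in> J \<Longrightarrow> \<bar>w \<bullet> \<phi> k\<bar> \<le> norm w"
  using Cauchy_Schwarz_ineq2[of w "\<phi> k"] norm_basis[of k] by simp

lemma summable_inner_A: "(\<lambda>k. a k * ((v \<bullet> \<phi> k) * (w \<bullet> \<phi> k))) summable_on J"
proof -
  have "(\<lambda>k. norm (a k * ((v \<bullet> \<phi> k) * (w \<bullet> \<phi> k)))) summable_on J"
  proof (rule Infinite_Sum.abs_summable_on_comparison_test')
    show "(\<lambda>k. (norm v * norm w) * a k) summable_on J"
      using a_sum by (rule summable_on_cmult_right)
    show "norm (a k * ((v \<bullet> \<phi> k) * (w \<bullet> \<phi> k))) \<le> norm v * norm w * a k" if "k \<in> J" for k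
    proof -
      have "\<bar>v \<bullet> \<phi> k\<bar> * \<bar>w \<bullet> \<phi> k\<bar> \<le> norm v * norm w"
        using that by (intro mult_mono abs_inner_basis) auto
      from mult_left_mono[OF this, of "a k"] show ?thesis
        using a_pos[OF that] by (simp add: abs_mult mult_ac)
    qed
  qed
  then show ?thesis by (rule abs_summable_summable)
qed

lemma sq_norm_A_eq: "sq_norm_A J \<phi> a w = inner_A J \<phi> a w w"
  by (simp add: sq_norm_A_def inner_A_def power2_eq_square)

lemma inner_A_add_left: "inner_A J \<phi> a (u + v) w = inner_A J \<phi> a u w + inner_A J \<phi> a v w"
  unfolding inner_A_def
  by (subst infsum_add[OF summable_inner_A summable_inner_A, symmetric])
    (simp add: inner_add_left algebra_simps)

lemma inner_A_scale_left: "inner_A J \<phi> a (c *\<^sub>R v) w = c * inner_A J \<phi> a v w"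
  unfolding inner_A_def by (subst infsum_cmult_right'[symmetric]) (simp add: mult_ac)

lemma inner_A_commute: "inner_A J \<phi> a v w = inner_A J \<phi> a w v"
  by (simp add: inner_A_def mult_ac)

lemma inner_A_nonneg: "0 \<le> inner_A J \<phi> a w w"
  unfolding inner_A_def using a_pos by (intro infsum_nonneg) (simp add: less_imp_le)

lemma sq_norm_A_diff:
  "sq_norm_A J \<phi> a (v - w) = sq_norm_A J \<phi> a v + sq_norm_A J \<phi> a w - 2 * inner_A J \<phi> a v w"
proof -
  have "inner_A J \<phi> a (v + (-1) *\<^sub>R w) u = inner_A J \<phi> a v u - inner_A J \<phi> a w u" for u
    unfolding inner_A_add_left inner_A_scale_left by simp
  then have *: "inner_A J \<phi> a (v - w) u = inner_A J \<phi> a v u - inner_A J \<phi> a w u" for u by simp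
  show ?thesis
    unfolding sq_norm_A_eq *
    using *[of v] *[of w] inner_A_commute[of v "v - w"] inner_A_commute[of w "v - w"] inner_A_commute[of v w]
    by simp
qed

lemma sq_norm_A_nonneg: "0 \<le> sq_norm_A J \<phi> a w"
  by (simp add: sq_norm_A_eq inner_A_nonneg)

text \<open>Every summand a_k <v, \<phi>_k> <w, \<phi>_k> has product form once \<open>a k\<close>
  is split into square roots, so multiplication by it is a scaling; finite sums and the limit over
  finite subsets of \<open>J\<close> keep positivity. This is the property of \<open>b\<close>
  required in \<open>psd_exp\<close>.\<close>

lemma psd_inner_A:
  assumes "psd TYPE('u::real_inner) l"
  shows "psd TYPE('u) (\<lambda>x y. inner_A J \<phi> a (g x) (g y) * l x y)"
proof (rule psd_tendsto[where F = "finite_subsets_at_top J"])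
  show "psd TYPE('u) (\<lambda>x y. (\<Sum>k\<in>T. if k \<in> J then (sqrt (a k) * (g x \<bullet> \<phi> k)) * (sqrt (a k) * (g y \<bullet> \<phi> k)) * l x y else 0))"
    for T
  proof (rule psd_sum)
    fix k
    show "psd TYPE('u) (\<lambda>x y. if k \<in> J then (sqrt (a k) * (g x \<bullet> \<phi> k)) * (sqrt (a k) * (g y \<bullet> \<phi> k)) * l x y else 0)"
      using psd_scale[OF assms, of "\<lambda>x. sqrt (a k) * (g x \<bullet> \<phi> k)"] psd_zero
      by (cases "k \<in> J") simp_all
  qed
  show "((\<lambda>T. \<Sum>k\<in>T. if k \<in> J then (sqrt (a k) * (g x \<bullet> \<phi> k)) * (sqrt (a k) * (g y \<bullet> \<phi> k)) * l x y else 0)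
      \<longlongrightarrow> inner_A J \<phi> a (g x) (g y) * l x y) (finite_subsets_at_top J)" for x y
  proof (rule Lim_transform_eventually)
    have "((\<lambda>k. a k * ((g x \<bullet> \<phi> k) * (g y \<bullet> \<phi> k))) has_sum inner_A J \<phi> a (g x) (g y)) J"
      unfolding inner_A_def by (rule has_sum_infsum[OF summable_inner_A])
    then show "((\<lambda>T. (\<Sum>k\<in>T. a k * ((g x \<bullet> \<phi> k) * (g y \<bullet> \<phi> k))) * l x y)
        \<longlongrightarrow> inner_A J \<phi> a (g x) (g y) * l x y) (finite_subsets_at_top J)"
      unfolding has_sum_def by (intro tendsto_intros)
    have "(\<Sum>k\<in>T. a k * ((g x \<bullet> \<phi> k) * (g y \<bullet> \<phi> k))) * l x y
        = (\<Sum>k\<in>T. if k \<in> J then (sqrt (a k) * (g x \<bullet> \<phi> k)) * (sqrt (a k) * (g y \<bullet> \<phi> k)) * l x y else 0)"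
      if "T \<subseteq> J" for T
      unfolding sum_distrib_right
    proof (rule sum.cong)
      fix k assume "k \<in> T"
      then have "k \<in> J" "sqrt (a k) * sqrt (a k) = a k" using that a_pos[of k] by auto
      then show "a k * ((g x \<bullet> \<phi> k) * (g y \<bullet> \<phi> k)) * l x y
          = (if k \<in> J then (sqrt (a k) * (g x \<bullet> \<phi> k)) * (sqrt (a k) * (g y \<bullet> \<phi> k)) * l x y else 0)"
        by (metis (no_types, lifting) mult.assoc mult.left_commute)
    qed simp
    then show "\<forall>\<^sub>F T in finite_subsets_at_top J. (\<Sum>k\<in>T. a k * ((g x \<bullet> \<phi> k) * (g y \<bullet> \<phi> k))) * l x y
        = (\<Sum>k\<in>T. if k \<in> J then (sqrt (a k) * (g x \<bullet> \<phi> k)) * (sqrt (a k) * (g y \<bullet> \<phi> k)) * l x y else 0)"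
      by (intro eventually_finite_subsets_at_top_weakI) auto
  qed
qed simp

text \<open>Polarisation splits the Gaussian into e^(-|u|^2/2) e^(-|v|^2/2) e^(<u, v>): two factors
  to scale by and the exponential of a kernel covered by \<open>psd_inner_A\<close>.\<close>

lemma psd_gauss:
  assumes "psd TYPE('u::real_inner) l"
  shows "psd TYPE('u) (\<lambda>x y. exp (- sq_norm_A J \<phi> a (g x - g y) / 2) * l x y)"
proof -
  let ?N = "sq_norm_A J \<phi> a"
  have "psd TYPE('u) (\<lambda>x y. exp (- ?N (g x) / 2) * exp (- ?N (g y) / 2) * (exp (inner_A J \<phi> a (g x) (g y)) * l x y))"
    by (intro psd_scale psd_exp psd_inner_A assms)
  moreover have "exp (- ?N (g x) / 2) * exp (- ?N (g y) / 2) * (exp (inner_A J \<phi> a (g x) (g y)) * l x y)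
      = exp (- ?N (g x - g y) / 2) * l x y" for x y
    unfolding sq_norm_A_diff mult.assoc[symmetric] exp_add[symmetric] by (simp add: field_simps)
  ultimately show ?thesis by (simp only:)
qed

lemma borel_measurable_sq_norm_A: "sq_norm_A J \<phi> a \<in> borel_measurable borel"
proof -
  \<comment> \<open>Extending the summands by zero outside \<open>J\<close> turns the unordered sum
    into a series over the naturals, whose measurability is that of its terms.\<close>
  have "sq_norm_A J \<phi> a w = (\<Sum>k. if k \<in> J then a k * ((w \<bullet> \<phi> k) * (w \<bullet> \<phi> k)) else 0)" for w
  proof -
    have "((\<lambda>k. a k * ((w \<bullet> \<phi> k) * (w \<bullet> \<phi> k))) has_sum sq_norm_A J \<phi> a w) J"
      unfolding sq_norm_A_eq inner_A_def by (rule has_sum_infsum[OF summable_inner_A])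
    then have "((\<lambda>k. if k \<in> J then a k * ((w \<bullet> \<phi> k) * (w \<bullet> \<phi> k)) else 0) has_sum sq_norm_A J \<phi> a w) UNIV"
      by (subst (asm) has_sum_cong_neutral[where T = UNIV and g = "\<lambda>k. if k \<in> J then a k * ((w \<bullet> \<phi> k) * (w \<bullet> \<phi> k)) else 0"]) auto
    then show ?thesis by (intro sums_unique has_sum_imp_sums)
  qed
  then have "sq_norm_A J \<phi> a = (\<lambda>w. \<Sum>k. if k \<in> J then a k * ((w \<bullet> \<phi> k) * (w \<bullet> \<phi> k)) else 0)" by auto
  moreover have "(\<lambda>w. \<Sum>k. if k \<in> J then a k * ((w \<bullet> \<phi> k) * (w \<bullet> \<phi> k)) else 0) \<in> borel_measurable borel"
  proof (rule borel_measurable_suminf)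
    show "(\<lambda>w. if k \<in> J then a k * ((w \<bullet> \<phi> k) * (w \<bullet> \<phi> k)) else 0) \<in> borel_measurable borel" for k
      by (cases "k \<in> J") (auto intro!: borel_measurable_continuous_onI continuous_intros)
  qed
  ultimately show ?thesis by simp
qed

end

section \<open>Self-normalised tails and limits of quadratic forms\<close>

context iid_sample
begin

lemma measurable_X': "i \<in> {1..n} \<Longrightarrow> X i \<in> measurable M P"
  by (rule measurable_X) simp

text \<open>On the event either \<open>S\<close> deviates from its mean by at least half of it,
  which Chebyshev's inequality bounds through \<open>ustatistic_variance\<close>, or
  \<open>\<bar>z\<bar> * sqrt (2 * V)\<close> reaches half the mean, which Markov's inequality
  bounds through E V. As n (n - 1) >= n^2 / 2, the squared threshold is at least n^4 \<theta>^2 /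
  16; this turns the variance factors 4 and 2 into 64 and 32.\<close>

lemma ustatistic_selfnormalized:
  fixes g :: "'x \<times> 'x \<Rightarrow> real" and n :: nat and z :: real
  assumes meas[measurable]: "g \<in> borel_measurable (P \<Otimes>\<^sub>M P)"
    and sym: "\<And>x y. g (x, y) = g (y, x)"
    and sq: "integrable (P \<Otimes>\<^sub>M P) (\<lambda>p. (g p)\<^sup>2)"
    and n: "n \<ge> 2"
  defines "S \<equiv> \<lambda>\<omega>. \<Sum>i\<in>{1..n}. \<Sum>j\<in>{1..n} - {i}. g (X i \<omega>, X j \<omega>)"
    and "V \<equiv> \<lambda>\<omega>. \<Sum>i\<in>{1..n}. \<Sum>j\<in>{1..n} - {i}. (g (X i \<omega>, X j \<omega>))\<^sup>2"
    and "\<theta> \<equiv> integral\<^sup>L (P \<Otimes>\<^sub>M P) g"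
  assumes \<theta>: "\<theta> > 0"
  shows "S \<in> borel_measurable M" "V \<in> borel_measurable M"
    and "prob {\<omega> \<in> space M. S \<omega> \<le> \<bar>z\<bar> * sqrt (2 * V \<omega>)}
      \<le> (64 * (\<integral>x. (\<integral>y. g (x, y) \<partial>P)\<^sup>2 \<partial>P) / real n
          + 32 * (1 + z\<^sup>2) * (\<integral>p. (g p)\<^sup>2 \<partial>(P \<Otimes>\<^sub>M P)) / (real n)\<^sup>2) / \<theta>\<^sup>2"
proof -
  note [measurable] = measurable_X'
  define e1 where "e1 = (\<integral>x. (\<integral>y. g (x, y) \<partial>P)\<^sup>2 \<partial>P)"
  define e2 where "e2 = (\<integral>p. (g p)\<^sup>2 \<partial>(P \<Otimes>\<^sub>M P))"
  define m where "m = real n * (real n - 1)"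
  have e: "e1 \<ge> 0" "e2 \<ge> 0" by (simp_all add: e1_def e2_def)
  have pm: "(\<lambda>\<omega>. (X i \<omega>, X j \<omega>)) \<in> measurable M (P \<Otimes>\<^sub>M P)" if "i \<in> {1..n}" "j \<in> {1..n} - {i}" for i j
    using that by (intro measurable_Pair measurable_X') auto
  have gm: "(\<lambda>\<omega>. g (X i \<omega>, X j \<omega>)) \<in> borel_measurable M" if "i \<in> {1..n}" "j \<in> {1..n} - {i}" for i j
    using measurable_compose[OF pm[OF that] meas] .
  show S_meas[measurable]: "S \<in> borel_measurable M"
    unfolding S_def by (intro borel_measurable_sum gm)
  show V_meas[measurable]: "V \<in> borel_measurable M"
    unfolding V_def by (intro borel_measurable_sum borel_measurable_power gm)
  have n2: "real n \<ge> 2" using n by simp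
  have m_ge: "m \<ge> (real n)\<^sup>2 / 2" and m_le: "m \<le> (real n)\<^sup>2"
  proof -
    have "real n * (real n / 2) \<le> real n * (real n - 1)" using n2 by (intro mult_left_mono) auto
    then show "m \<ge> (real n)\<^sup>2 / 2" by (simp add: m_def power2_eq_square)
    show "m \<le> (real n)\<^sup>2" by (simp add: m_def power2_eq_square algebra_simps)
  qed
  have n0: "(real n)\<^sup>2 > 0" using n2 by simp
  then have m0: "m > 0" using m_ge by linarith
  have m\<theta>: "m * \<theta> / 2 > 0" using m0 \<theta> by simp
  have var: "integrable M (\<lambda>\<omega>. (S \<omega> - m * \<theta>)\<^sup>2)"
    "expectation (\<lambda>\<omega>. (S \<omega> - m * \<theta>)\<^sup>2) \<le> 4 * real n ^ 3 * e1 + 2 * real n ^ 2 * e2"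
    unfolding S_def m_def \<theta>_def e1_def e2_def by (rule ustatistic_variance[OF meas sym sq])+
  have V_int: "integrable M V"
    unfolding V_def
  proof (intro Bochner_Integration.integrable_sum)
    fix i j assume ij: "i \<in> {1..n}" "j \<in> {1..n} - {i}"
    show "integrable M (\<lambda>x. (g (X i x, X j x))\<^sup>2)"
      using ij sq by (subst integral_pair(2)[of "\<lambda>p. (g p)\<^sup>2"]) auto
  qed
  have V_exp: "expectation V = m * e2"
  proof -
    have "expectation V = (\<Sum>i\<in>{1..n}. \<Sum>j\<in>{1..n} - {i}. e2)"
      unfolding V_def
    proof (subst Bochner_Integration.integral_sum)
      show "integrable M (\<lambda>x. \<Sum>j\<in>{1..n} - {i}. (g (X i x, X j x))\<^sup>2)" if "i \<in> {1..n}" for i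
      proof (intro Bochner_Integration.integrable_sum)
        fix j assume "j \<in> {1..n} - {i}"
        then show "integrable M (\<lambda>x. (g (X i x, X j x))\<^sup>2)"
          using that sq by (subst integral_pair(2)[of "\<lambda>p. (g p)\<^sup>2"]) auto
      qed
      show "(\<Sum>i = 1..n. \<integral>x. (\<Sum>j\<in>{1..n} - {i}. (g (X i x, X j x))\<^sup>2) \<partial>M) = (\<Sum>i\<in>{1..n}. \<Sum>j\<in>{1..n} - {i}. e2)"
      proof (rule sum.cong[OF refl])
        fix i assume i: "i \<in> {1..n}"
        have 1: "integrable M (\<lambda>x. (g (X i x, X j x))\<^sup>2)" if "j \<in> {1..n} - {i}" for j
          using i that sq by (subst integral_pair(2)[of "\<lambda>p. (g p)\<^sup>2"]) auto
        have 2: "(\<integral>x. (g (X i x, X j x))\<^sup>2 \<partial>M) = e2" if "j \<in> {1..n} - {i}" for j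
          unfolding e2_def using i that sq by (subst integral_pair(1)[of "\<lambda>p. (g p)\<^sup>2"]) auto
        have "(\<integral>x. (\<Sum>j\<in>{1..n} - {i}. (g (X i x, X j x))\<^sup>2) \<partial>M) = (\<Sum>j\<in>{1..n} - {i}. \<integral>x. (g (X i x, X j x))\<^sup>2 \<partial>M)"
          by (rule Bochner_Integration.integral_sum[OF 1])
        also have "\<dots> = (\<Sum>j\<in>{1..n} - {i}. e2)" by (rule sum.cong[OF refl 2])
        finally show "(\<integral>x. (\<Sum>j\<in>{1..n} - {i}. (g (X i x, X j x))\<^sup>2) \<partial>M) = (\<Sum>j\<in>{1..n} - {i}. e2)" .
      qed
    qed
    also have "\<dots> = m * e2"
      using n by (simp add: m_def card_Diff_singleton_if of_nat_diff)
    finally show ?thesis .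
  qed
  have V_nonneg: "V \<omega> \<ge> 0" for \<omega> by (simp add: V_def sum_nonneg)
  define A where "A = {\<omega> \<in> space M. (m * \<theta> / 2)\<^sup>2 \<le> (S \<omega> - m * \<theta>)\<^sup>2}"
  define B where "B = {\<omega> \<in> space M. (m * \<theta> / 2)\<^sup>2 \<le> z\<^sup>2 * (2 * V \<omega>)}"
  have [measurable]: "A \<in> sets M" "B \<in> sets M" unfolding A_def B_def by measurable
  have sub: "{\<omega> \<in> space M. S \<omega> \<le> \<bar>z\<bar> * sqrt (2 * V \<omega>)} \<subseteq> A \<union> B"
  proof (safe)
    fix \<omega> assume \<omega>: "\<omega> \<in> space M" "S \<omega> \<le> \<bar>z\<bar> * sqrt (2 * V \<omega>)" "\<omega> \<notin> B"
    have "\<not> (m * \<theta> / 2 \<le> \<bar>z\<bar> * sqrt (2 * V \<omega>))"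
    proof
      assume "m * \<theta> / 2 \<le> \<bar>z\<bar> * sqrt (2 * V \<omega>)"
      then have "(m * \<theta> / 2)\<^sup>2 \<le> (\<bar>z\<bar> * sqrt (2 * V \<omega>))\<^sup>2" using m\<theta> by (intro power_mono) auto
      then show False using \<omega> V_nonneg[of \<omega>] by (simp add: B_def power_mult_distrib)
    qed
    then have "m * \<theta> / 2 \<le> \<bar>S \<omega> - m * \<theta>\<bar>" using \<omega> by linarith
    then have "(m * \<theta> / 2)\<^sup>2 \<le> \<bar>S \<omega> - m * \<theta>\<bar>\<^sup>2" using m\<theta> by (intro power_mono) auto
    then show "\<omega> \<in> A" using \<omega> by (simp add: A_def)
  qed
  have pos: "(m * \<theta> / 2)\<^sup>2 > 0" using m\<theta> by (intro zero_less_power) auto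
  have PA: "prob A \<le> (4 * real n ^ 3 * e1 + 2 * real n ^ 2 * e2) / (m * \<theta> / 2)\<^sup>2"
  proof -
    have "prob A \<le> expectation (\<lambda>\<omega>. (S \<omega> - m * \<theta>)\<^sup>2) / (m * \<theta> / 2)\<^sup>2"
      unfolding A_def using pos var(1)
      by (intro integral_Markov_inequality_measure[where A = "{}"]) auto
    also have "\<dots> \<le> (4 * real n ^ 3 * e1 + 2 * real n ^ 2 * e2) / (m * \<theta> / 2)\<^sup>2"
      using var(2) by (intro divide_right_mono) auto
    finally show ?thesis .
  qed
  have PB: "prob B \<le> 2 * z\<^sup>2 * m * e2 / (m * \<theta> / 2)\<^sup>2"
  proof -
    have "prob B \<le> expectation (\<lambda>\<omega>. z\<^sup>2 * (2 * V \<omega>)) / (m * \<theta> / 2)\<^sup>2"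
      unfolding B_def using pos V_int V_nonneg
      by (intro integral_Markov_inequality_measure[where A = "{}"]) auto
    also have "expectation (\<lambda>\<omega>. z\<^sup>2 * (2 * V \<omega>)) = 2 * z\<^sup>2 * m * e2"
      using V_exp by simp
    finally show ?thesis .
  qed
  have "prob {\<omega> \<in> space M. S \<omega> \<le> \<bar>z\<bar> * sqrt (2 * V \<omega>)} \<le> prob (A \<union> B)"
    by (rule finite_measure_mono[OF sub]) measurable
  also have "\<dots> \<le> prob A + prob B" by (rule measure_Un_le) measurable
  also have "\<dots> \<le> (4 * real n ^ 3 * e1 + 2 * real n ^ 2 * e2 + 2 * z\<^sup>2 * m * e2) / (m * \<theta> / 2)\<^sup>2"
    using PA PB by (simp add: add_divide_distrib)
  also have "\<dots> \<le> (4 * real n ^ 3 * e1 + 2 * real n ^ 2 * e2 + 2 * z\<^sup>2 * (real n)\<^sup>2 * e2) / ((real n)\<^sup>2 / 2 * \<theta> / 2)\<^sup>2"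
  proof (rule frac_le)
    show "4 * real n ^ 3 * e1 + 2 * real n ^ 2 * e2 + 2 * z\<^sup>2 * m * e2
        \<le> 4 * real n ^ 3 * e1 + 2 * real n ^ 2 * e2 + 2 * z\<^sup>2 * (real n)\<^sup>2 * e2"
      using m_le e by (intro add_mono order_refl mult_right_mono mult_left_mono) auto
    show "0 \<le> 4 * real n ^ 3 * e1 + 2 * real n ^ 2 * e2 + 2 * z\<^sup>2 * (real n)\<^sup>2 * e2"
      using e by (intro add_nonneg_nonneg mult_nonneg_nonneg) auto
    show "0 < ((real n)\<^sup>2 / 2 * \<theta> / 2)\<^sup>2" using n0 \<theta> by simp
    show "((real n)\<^sup>2 / 2 * \<theta> / 2)\<^sup>2 \<le> (m * \<theta> / 2)\<^sup>2"
      using m_ge n0 \<theta> by (intro power_mono divide_right_mono mult_right_mono) auto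
  qed
  also have "\<dots> = (64 * e1 / real n + 32 * (1 + z\<^sup>2) * e2 / (real n)\<^sup>2) / \<theta>\<^sup>2"
    using n2 \<theta> by (simp add: field_simps power2_eq_square power3_eq_cube)
  finally show "prob {\<omega> \<in> space M. S \<omega> \<le> \<bar>z\<bar> * sqrt (2 * V \<omega>)}
      \<le> (64 * (\<integral>x. (\<integral>y. g (x, y) \<partial>P)\<^sup>2 \<partial>P) / real n
          + 32 * (1 + z\<^sup>2) * (\<integral>p. (g p)\<^sup>2 \<partial>(P \<Otimes>\<^sub>M P)) / (real n)\<^sup>2) / \<theta>\<^sup>2"
    unfolding e1_def e2_def .
qed

lemma integrable_comp_fst:
  fixes f :: "'x \<Rightarrow> 'b::{banach, second_countable_topology}"
  assumes "integrable P f"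
  shows "integrable (P \<Otimes>\<^sub>M P) (\<lambda>p. f (fst p))" "(\<integral>p. f (fst p) \<partial>(P \<Otimes>\<^sub>M P)) = integral\<^sup>L P f"
  using integrable_distr_eq[of fst "P \<Otimes>\<^sub>M P" P f] integral_distr[of fst "P \<Otimes>\<^sub>M P" P f] assms
  by (auto simp: P.distr_pair_fst)

lemma integral_swap:
  fixes f :: "'x \<times> 'x \<Rightarrow> 'b::{banach, second_countable_topology}"
  assumes [measurable]: "f \<in> borel_measurable (P \<Otimes>\<^sub>M P)"
  shows "(\<integral>p. f (snd p, fst p) \<partial>(P \<Otimes>\<^sub>M P)) = integral\<^sup>L (P \<Otimes>\<^sub>M P) f"
    and "integrable (P \<Otimes>\<^sub>M P) (\<lambda>p. f (snd p, fst p)) \<longleftrightarrow> integrable (P \<Otimes>\<^sub>M P) f"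
  subgoal using PP.integral_product_swap[OF assms] by (simp add: case_prod_beta')
  subgoal using PP.integrable_product_swap_iff[of f] by (simp add: case_prod_beta')
  done

lemma integrable_comp_snd:
  fixes f :: "'x \<Rightarrow> 'b::{banach, second_countable_topology}"
  assumes "integrable P f"
  shows "integrable (P \<Otimes>\<^sub>M P) (\<lambda>p. f (snd p))"
  using integral_swap(2)[of "\<lambda>p. f (fst p)"] integrable_comp_fst[OF assms] assms by auto

lemma integrable_square_product:
  fixes F G :: "'x \<Rightarrow> 'u::{real_inner, banach, second_countable_topology}" and k :: "'x \<times> 'x \<Rightarrow> real"
  assumes [measurable]: "F \<in> borel_measurable P" "G \<in> borel_measurable P" "k \<in> borel_measurable (P \<Otimes>\<^sub>M P)"
    and "integrable P (\<lambda>x. (norm (F x))\<^sup>2)" "integrable P (\<lambda>x. (norm (G x))\<^sup>2)"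
    and bound: "\<And>p. \<bar>k p\<bar> \<le> B"
  shows "integrable (P \<Otimes>\<^sub>M P) (\<lambda>p. (F (fst p) \<bullet> G (snd p)) * k p)"
proof (rule Bochner_Integration.integrable_bound)
  show "integrable (P \<Otimes>\<^sub>M P) (\<lambda>p. B * ((norm (F (fst p)))\<^sup>2 + (norm (G (snd p)))\<^sup>2))"
    using assms by (intro integrable_mult_right Bochner_Integration.integrable_add
        integrable_comp_fst integrable_comp_snd)
  show "AE p in P \<Otimes>\<^sub>M P. norm ((F (fst p) \<bullet> G (snd p)) * k p)
      \<le> norm (B * ((norm (F (fst p)))\<^sup>2 + (norm (G (snd p)))\<^sup>2))"
  proof (rule AE_I2)
    fix p
    have "\<bar>F (fst p) \<bullet> G (snd p)\<bar> \<le> norm (F (fst p)) * norm (G (snd p))" by (rule Cauchy_Schwarz_ineq2)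
    also have "\<dots> \<le> (norm (F (fst p)))\<^sup>2 + (norm (G (snd p)))\<^sup>2"
    proof -
      have "0 \<le> norm (F (fst p)) * norm (G (snd p))" by simp
      then show ?thesis using sum_squares_bound[of "norm (F (fst p))" "norm (G (snd p))"] by linarith
    qed
    finally have "\<bar>F (fst p) \<bullet> G (snd p)\<bar> * \<bar>k p\<bar> \<le> ((norm (F (fst p)))\<^sup>2 + (norm (G (snd p)))\<^sup>2) * B"
      using bound[of p] by (intro mult_mono) auto
    moreover have "0 \<le> B" using bound[of p] by linarith
    ultimately show "norm ((F (fst p) \<bullet> G (snd p)) * k p)
      \<le> norm (B * ((norm (F (fst p)))\<^sup>2 + (norm (G (snd p)))\<^sup>2))"
      by (simp add: abs_mult mult_ac)
  qed
qed measurable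

text \<open>The quadratic form is the limit of \<open>n\<^sup>-\<^sup>2\<close> times its empirical version on an i.i.d. sample,
  augmented with one deterministic point \<open>y\<close> of weight \<open>n\<close>.\<close>

lemma psd_quadratic:
  fixes k :: "'x \<Rightarrow> 'x \<Rightarrow> real" and F :: "'x \<Rightarrow> 'u::{real_inner, banach, second_countable_topology}"
  assumes psd: "psd TYPE('u) k"
    and [measurable]: "(\<lambda>p. k (fst p) (snd p)) \<in> borel_measurable (P \<Otimes>\<^sub>M P)" "F \<in> borel_measurable P"
    and bound: "\<And>x y. \<bar>k x y\<bar> \<le> B" and sym: "\<And>x y. k x y = k y x"
    and F2: "integrable P (\<lambda>x. (norm (F x))\<^sup>2)" and y: "y \<in> space P"
  shows "0 \<le> (\<integral>p. (F (fst p) \<bullet> F (snd p)) * k (fst p) (snd p) \<partial>(P \<Otimes>\<^sub>M P))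
    + 2 * (\<integral>x. (F x \<bullet> c) * k x y \<partial>P) + (c \<bullet> c) * k y y"
proof -
  define Q where "Q = (\<integral>p. (F (fst p) \<bullet> F (snd p)) * k (fst p) (snd p) \<partial>(P \<Otimes>\<^sub>M P))"
  define L where "L = (\<integral>x. (F x \<bullet> c) * k x y \<partial>P)"
  define d where "d = (\<integral>x. (F x \<bullet> F x) * k x x \<partial>P)"
  have ky[measurable]: "(\<lambda>x. k x y) \<in> borel_measurable P"
    using measurable_compose[OF measurable_Pair1'[OF y, of P] assms(2)] sym by simp
  have kxx[measurable]: "(\<lambda>x. k x x) \<in> borel_measurable P"
    using measurable_compose[OF _ assms(2), of "\<lambda>x. (x, x)" P] by simp
  have normF: "integrable P (\<lambda>x. norm (F x))"
    by (rule P.square_integrable_imp_integrable) (use F2 in auto)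
  have intQ: "integrable (P \<Otimes>\<^sub>M P) (\<lambda>p. (F (fst p) \<bullet> F (snd p)) * k (fst p) (snd p))"
    using F2 bound by (intro integrable_square_product) auto
  have intL: "integrable P (\<lambda>x. (F x \<bullet> c) * k x y)"
  proof (rule Bochner_Integration.integrable_bound)
    show "integrable P (\<lambda>x. B * norm c * norm (F x))" using normF by simp
    show "AE x in P. norm ((F x \<bullet> c) * k x y) \<le> norm (B * norm c * norm (F x))"
    proof (rule AE_I2)
      fix x
      have "\<bar>F x \<bullet> c\<bar> * \<bar>k x y\<bar> \<le> (norm (F x) * norm c) * B"
        using Cauchy_Schwarz_ineq2[of "F x" c] bound[of x y] by (intro mult_mono) auto
      moreover have "0 \<le> B" using bound[of x y] by linarith
      ultimately show "norm ((F x \<bullet> c) * k x y) \<le> norm (B * norm c * norm (F x))"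
        by (simp add: abs_mult mult_ac)
    qed
  qed measurable
  have intd: "integrable P (\<lambda>x. (F x \<bullet> F x) * k x x)"
  proof (rule Bochner_Integration.integrable_bound)
    show "integrable P (\<lambda>x. B * (norm (F x))\<^sup>2)" using F2 by simp
    show "AE x in P. norm ((F x \<bullet> F x) * k x x) \<le> norm (B * (norm (F x))\<^sup>2)"
    proof (rule AE_I2)
      fix x
      have "(F x \<bullet> F x) * \<bar>k x x\<bar> \<le> (F x \<bullet> F x) * B"
        using bound[of x x] by (intro mult_left_mono) auto
      moreover have "0 \<le> B" using bound[of x x] by linarith
      ultimately show "norm ((F x \<bullet> F x) * k x x) \<le> norm (B * (norm (F x))\<^sup>2)"
        by (simp add: abs_mult mult_ac power2_norm_eq_inner)
    qed
  qed measurable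
  \<comment> \<open>This is the expectation of the empirical form divided by n^2; the diagonal part
    has only n terms, so \<open>d\<close> carries a factor 1/n that removes it in the limit.\<close>
  have main: "0 \<le> (c \<bullet> c) * k y y + 2 * L + d * (1 / real n) + (1 - 1 / real n) * Q" if n: "n \<ge> 1" for n
  proof -
    define qd where "qd \<omega> = (real n)\<^sup>2 * (c \<bullet> c) * k y y + 2 * real n * (\<Sum>i = 1..n. (F (X i \<omega>) \<bullet> c) * k (X i \<omega>) y)
      + (\<Sum>i = 1..n. (F (X i \<omega>) \<bullet> F (X i \<omega>)) * k (X i \<omega>) (X i \<omega>))
      + (\<Sum>i = 1..n. \<Sum>j\<in>{1..n} - {i}. (F (X i \<omega>) \<bullet> F (X j \<omega>)) * k (X i \<omega>) (X j \<omega>))" for \<omega>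
    have nonneg: "0 \<le> qd \<omega>" for \<omega>
    proof -
      \<comment> \<open>The sample starts at index 1, so index 0 is free for the deterministic point
        \<open>y\<close>; its weight n c balances the n random points.\<close>
      define v where "v i = (if i = 0 then real n *\<^sub>R c else F (X i \<omega>))" for i
      define x where "x i = (if i = 0 then y else X i \<omega>)" for i :: nat
      define f where "f i j = (v i \<bullet> v j) * k (x i) (x j)" for i j
      have f_sym: "f i j = f j i" for i j unfolding f_def by (simp add: inner_commute sym[of "x i"])
      have "0 \<le> (\<Sum>i\<in>insert 0 {1..n}. \<Sum>j\<in>insert 0 {1..n}. f i j)"
        unfolding f_def by (rule psdD[OF psd]) simp
      also have "\<dots> = f 0 0 + (\<Sum>j = 1..n. f 0 j) + ((\<Sum>i = 1..n. f i 0) + (\<Sum>i = 1..n. \<Sum>j = 1..n. f i j))"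
        by (simp add: sum.distrib)
      also have "(\<Sum>i = 1..n. \<Sum>j = 1..n. f i j) = (\<Sum>i = 1..n. f i i + (\<Sum>j\<in>{1..n} - {i}. f i j))"
        by (intro sum.cong refl sum.remove) auto
      also have "\<dots> = (\<Sum>i = 1..n. f i i) + (\<Sum>i = 1..n. \<Sum>j\<in>{1..n} - {i}. f i j)" by (rule sum.distrib)
      also have "(\<Sum>i = 1..n. f i i) = (\<Sum>i = 1..n. (F (X i \<omega>) \<bullet> F (X i \<omega>)) * k (X i \<omega>) (X i \<omega>))"
        by (intro sum.cong refl) (auto simp: f_def v_def x_def)
      also have "(\<Sum>i = 1..n. \<Sum>j\<in>{1..n} - {i}. f i j)
          = (\<Sum>i = 1..n. \<Sum>j\<in>{1..n} - {i}. (F (X i \<omega>) \<bullet> F (X j \<omega>)) * k (X i \<omega>) (X j \<omega>))"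
        by (intro sum.cong refl) (auto simp: f_def v_def x_def)
      also have "(\<Sum>j = 1..n. f 0 j) = (\<Sum>i = 1..n. f i 0)" by (intro sum.cong refl f_sym)
      also have "(\<Sum>i = 1..n. f i 0) = (\<Sum>i = 1..n. real n * ((F (X i \<omega>) \<bullet> c) * k (X i \<omega>) y))"
        by (intro sum.cong refl) (auto simp: f_def v_def x_def)
      also have "\<dots> = real n * (\<Sum>i = 1..n. (F (X i \<omega>) \<bullet> c) * k (X i \<omega>) y)" by (simp add: sum_distrib_left)
      also have "f 0 0 = (real n)\<^sup>2 * (c \<bullet> c) * k y y" by (simp add: f_def v_def x_def power2_eq_square)
      finally show ?thesis unfolding qd_def by linarith
    qed
    have i1: "integrable M (\<lambda>\<omega>. (F (X i \<omega>) \<bullet> c) * k (X i \<omega>) y)"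
      "expectation (\<lambda>\<omega>. (F (X i \<omega>) \<bullet> c) * k (X i \<omega>) y) = L" if "i \<in> {1..n}" for i
      using integral_single[of "\<lambda>x. (F x \<bullet> c) * k x y" i] intL that by (auto simp: L_def)
    have i2: "integrable M (\<lambda>\<omega>. (F (X i \<omega>) \<bullet> F (X i \<omega>)) * k (X i \<omega>) (X i \<omega>))"
      "expectation (\<lambda>\<omega>. (F (X i \<omega>) \<bullet> F (X i \<omega>)) * k (X i \<omega>) (X i \<omega>)) = d" if "i \<in> {1..n}" for i
      using integral_single[of "\<lambda>x. (F x \<bullet> F x) * k x x" i] intd that by (auto simp: d_def)
    have i3: "integrable M (\<lambda>\<omega>. (F (X i \<omega>) \<bullet> F (X j \<omega>)) * k (X i \<omega>) (X j \<omega>))"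
      "expectation (\<lambda>\<omega>. (F (X i \<omega>) \<bullet> F (X j \<omega>)) * k (X i \<omega>) (X j \<omega>)) = Q"
      if "i \<in> {1..n}" "j \<in> {1..n} - {i}" for i j
      using integral_pair[of "\<lambda>p. (F (fst p) \<bullet> F (snd p)) * k (fst p) (snd p)" i j] intQ that
      by (auto simp: Q_def)
    have i4: "integrable M (\<lambda>\<omega>. \<Sum>i = 1..n. \<Sum>j\<in>{1..n} - {i}. (F (X i \<omega>) \<bullet> F (X j \<omega>)) * k (X i \<omega>) (X j \<omega>))"
      using i3 by (intro Bochner_Integration.integrable_sum)
    have "expectation (\<lambda>\<omega>. \<Sum>i = 1..n. \<Sum>j\<in>{1..n} - {i}. (F (X i \<omega>) \<bullet> F (X j \<omega>)) * k (X i \<omega>) (X j \<omega>))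
        = (\<Sum>i = 1..n. expectation (\<lambda>\<omega>. \<Sum>j\<in>{1..n} - {i}. (F (X i \<omega>) \<bullet> F (X j \<omega>)) * k (X i \<omega>) (X j \<omega>)))"
      using i3 by (intro Bochner_Integration.integral_sum Bochner_Integration.integrable_sum)
    also have "\<dots> = (\<Sum>i = 1..n. \<Sum>j\<in>{1..n} - {i}. Q)"
    proof (rule sum.cong[OF refl])
      fix i assume i: "i \<in> {1..n}"
      have "expectation (\<lambda>\<omega>. \<Sum>j\<in>{1..n} - {i}. (F (X i \<omega>) \<bullet> F (X j \<omega>)) * k (X i \<omega>) (X j \<omega>))
          = (\<Sum>j\<in>{1..n} - {i}. expectation (\<lambda>\<omega>. (F (X i \<omega>) \<bullet> F (X j \<omega>)) * k (X i \<omega>) (X j \<omega>)))"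
        using i3(1)[OF i] by (intro Bochner_Integration.integral_sum)
      also have "\<dots> = (\<Sum>j\<in>{1..n} - {i}. Q)" by (rule sum.cong[OF refl i3(2)[OF i]])
      finally show "expectation (\<lambda>\<omega>. \<Sum>j\<in>{1..n} - {i}. (F (X i \<omega>) \<bullet> F (X j \<omega>)) * k (X i \<omega>) (X j \<omega>))
          = (\<Sum>j\<in>{1..n} - {i}. Q)" .
    qed
    also have "\<dots> = real n * (real n - 1) * Q"
      using n by (simp add: card_Diff_singleton_if of_nat_diff)
    finally have e4: "expectation (\<lambda>\<omega>. \<Sum>i = 1..n. \<Sum>j\<in>{1..n} - {i}. (F (X i \<omega>) \<bullet> F (X j \<omega>)) * k (X i \<omega>) (X j \<omega>))
        = real n * (real n - 1) * Q" .
    have e1: "expectation (\<lambda>\<omega>. \<Sum>i = 1..n. (F (X i \<omega>) \<bullet> c) * k (X i \<omega>) y) = real n * L"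
      using i1 by (simp add: Bochner_Integration.integral_sum)
    have e2: "expectation (\<lambda>\<omega>. \<Sum>i = 1..n. (F (X i \<omega>) \<bullet> F (X i \<omega>)) * k (X i \<omega>) (X i \<omega>)) = real n * d"
      using i2 by (simp add: Bochner_Integration.integral_sum)
    have s1: "integrable M (\<lambda>\<omega>. \<Sum>i = 1..n. (F (X i \<omega>) \<bullet> c) * k (X i \<omega>) y)"
      using i1 by (intro Bochner_Integration.integrable_sum)
    have s2: "integrable M (\<lambda>\<omega>. \<Sum>i = 1..n. (F (X i \<omega>) \<bullet> F (X i \<omega>)) * k (X i \<omega>) (X i \<omega>))"
      using i2 by (intro Bochner_Integration.integrable_sum)
    have "0 \<le> expectation qd" using nonneg by (rule Bochner_Integration.integral_nonneg)
    also have "expectation qd = (real n)\<^sup>2 * (c \<bullet> c) * k y y + 2 * real n * (real n * L) + real n * d + real n * (real n - 1) * Q"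
      unfolding qd_def e1[symmetric] e2[symmetric] e4[symmetric]
      using s1 s2 i4 by (simp add: prob_space)
    also have "\<dots> = (real n)\<^sup>2 * ((c \<bullet> c) * k y y + 2 * L + d * (1 / real n) + (1 - 1 / real n) * Q)"
      using n by (simp add: field_simps power2_eq_square)
    finally show ?thesis using n by (simp add: zero_le_mult_iff)
  qed
  have "(\<lambda>n. (c \<bullet> c) * k y y + 2 * L + d * (1 / real n) + (1 - 1 / real n) * Q)
      \<longlonglongrightarrow> (c \<bullet> c) * k y y + 2 * L + d * 0 + (1 - 0) * Q"
    by (intro tendsto_intros lim_1_over_n)
  then have "0 \<le> (c \<bullet> c) * k y y + 2 * L + d * 0 + (1 - 0) * Q"
    by (rule LIMSEQ_le_const) (use main in auto)
  then show ?thesis unfolding Q_def L_def by simp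
qed

end

section \<open>The Schur test for positive kernels\<close>

lemma norm_add_sq_le: "(norm (x + y :: 'u::real_inner))\<^sup>2 \<le> 2 * (norm x)\<^sup>2 + 2 * (norm y)\<^sup>2"
proof -
  have "(norm (x + y))\<^sup>2 + (norm (x - y))\<^sup>2 = 2 * (norm x)\<^sup>2 + 2 * (norm y)\<^sup>2"
    by (simp add: power2_norm_eq_inner algebra_simps inner_commute)
  moreover have "0 \<le> (norm (x - y))\<^sup>2" by simp
  ultimately show ?thesis by linarith
qed

text \<open>\<open>\<Lambda>\<close> bounds the row integrals and by symmetry the column integrals,
  hence the integral operator on L^2; \<open>B\<close> is a pointwise bound. In the application
  \<open>B\<close> is fixed while \<open>\<Lambda>\<close> tends to zero with the bandwidth.\<close>

locale iid_kernel = iid_sample M X P for M :: "'a measure" and X :: "nat \<Rightarrow> 'a \<Rightarrow> 'x" and P +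
  fixes \<kappa> :: "'x \<Rightarrow> 'x \<Rightarrow> real" and B \<Lambda> :: real
  assumes kernel_meas[measurable]: "(\<lambda>p. \<kappa> (fst p) (snd p)) \<in> borel_measurable (P \<Otimes>\<^sub>M P)"
    and kernel_nonneg: "0 \<le> \<kappa> x y" and kernel_le: "\<kappa> x y \<le> B" and kernel_sym: "\<kappa> x y = \<kappa> y x"
    and row: "x \<in> space P \<Longrightarrow> (\<integral>y. \<kappa> x y \<partial>P) \<le> \<Lambda>" and \<Lambda>: "\<Lambda> > 0"
begin

lemma abs_kernel_le: "\<bar>\<kappa> x y\<bar> \<le> B"
  using kernel_nonneg[of x y] kernel_le[of x y] by simp

lemma B_nonneg: "0 \<le> B"
  using kernel_nonneg kernel_le by (rule order_trans)

lemma kernel_section: "x \<in> space P \<Longrightarrow> (\<lambda>y. \<kappa> x y) \<in> borel_measurable P"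
  using measurable_compose[OF measurable_Pair1' kernel_meas] by simp

lemma integrable_kernel_mult:
  fixes f :: "'x \<Rightarrow> 'b::{banach, second_countable_topology}"
  assumes "integrable P f" "x \<in> space P"
  shows "integrable P (\<lambda>y. \<kappa> x y *\<^sub>R f y)"
proof (rule Bochner_Integration.integrable_bound)
  show "integrable P (\<lambda>y. B * norm (f y))" using assms by simp
  show "(\<lambda>y. \<kappa> x y *\<^sub>R f y) \<in> borel_measurable P"
    using kernel_section[OF assms(2)] assms(1) by measurable
  show "AE y in P. norm (\<kappa> x y *\<^sub>R f y) \<le> norm (B * norm (f y))"
    using abs_kernel_le B_nonneg by (intro AE_I2) (auto simp: abs_mult intro!: mult_right_mono)
qed

lemma integrable_kernel: "x \<in> space P \<Longrightarrow> integrable P (\<lambda>y. \<kappa> x y)"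
  using integrable_kernel_mult[of "\<lambda>_. 1 :: real" x] by simp

lemma integrable_kernel_pair:
  fixes f :: "'x \<times> 'x \<Rightarrow> real"
  assumes "integrable (P \<Otimes>\<^sub>M P) f"
  shows "integrable (P \<Otimes>\<^sub>M P) (\<lambda>p. f p * \<kappa> (fst p) (snd p))"
proof (rule Bochner_Integration.integrable_bound)
  show "integrable (P \<Otimes>\<^sub>M P) (\<lambda>p. \<bar>f p\<bar> * B)" using assms by simp
  show "(\<lambda>p. f p * \<kappa> (fst p) (snd p)) \<in> borel_measurable (P \<Otimes>\<^sub>M P)" using assms by measurable
  show "AE p in P \<Otimes>\<^sub>M P. norm (f p * \<kappa> (fst p) (snd p)) \<le> norm (\<bar>f p\<bar> * B)"
    using abs_kernel_le B_nonneg by (intro AE_I2) (auto simp: abs_mult intro!: mult_left_mono)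
qed

lemma row_bound:
  fixes f :: "'x \<Rightarrow> real"
  assumes f: "integrable P f" and nonneg: "\<And>x. 0 \<le> f x"
  shows "(\<integral>p. f (fst p) * \<kappa> (fst p) (snd p) \<partial>(P \<Otimes>\<^sub>M P)) \<le> \<Lambda> * integral\<^sup>L P f"
proof -
  have int: "integrable (P \<Otimes>\<^sub>M P) (\<lambda>p. f (fst p) * \<kappa> (fst p) (snd p))"
    by (intro integrable_kernel_pair integrable_comp_fst f)
  have "(\<integral>p. f (fst p) * \<kappa> (fst p) (snd p) \<partial>(P \<Otimes>\<^sub>M P)) = (\<integral>x. (\<integral>y. f x * \<kappa> x y \<partial>P) \<partial>P)"
    using PP.integral_fst'[OF int] by simp
  also have "\<dots> \<le> (\<integral>x. \<Lambda> * f x \<partial>P)"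
  proof (rule integral_mono_AE)
    show "integrable P (\<lambda>x. \<integral>y. f x * \<kappa> x y \<partial>P)" using PP.integrable_fst'[OF int] by simp
    show "AE x in P. (\<integral>y. f x * \<kappa> x y \<partial>P) \<le> \<Lambda> * f x"
      using AE_space
    proof eventually_elim
      case (elim x)
      have "f x * (\<integral>y. \<kappa> x y \<partial>P) \<le> f x * \<Lambda>" using row[OF elim] nonneg by (intro mult_left_mono)
      then show ?case by (simp add: mult.commute)
    qed
  qed (use f in simp)
  finally show ?thesis by simp
qed

lemma col_bound:
  fixes f :: "'x \<Rightarrow> real"
  assumes f: "integrable P f" and nonneg: "\<And>x. 0 \<le> f x"
  shows "(\<integral>p. f (snd p) * \<kappa> (fst p) (snd p) \<partial>(P \<Otimes>\<^sub>M P)) \<le> \<Lambda> * integral\<^sup>L P f"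
proof -
  have [measurable]: "f \<in> borel_measurable P" using f by simp
  have "(\<integral>p. f (snd p) * \<kappa> (fst p) (snd p) \<partial>(P \<Otimes>\<^sub>M P))
      = (\<integral>p. f (fst p) * \<kappa> (fst p) (snd p) \<partial>(P \<Otimes>\<^sub>M P))"
    using integral_swap(1)[of "\<lambda>p. f (fst p) * \<kappa> (fst p) (snd p)"] kernel_sym by simp
  then show ?thesis using row_bound[OF assms] by simp
qed

text \<open>The integral operator of the kernel applied to \<open>F\<close>; \<open>form F G\<close>
  below is the pairing of \<open>F\<close> with \<open>smooth G\<close>.\<close>

definition smooth :: "('x \<Rightarrow> 'u::{real_inner, banach, second_countable_topology}) \<Rightarrow> 'x \<Rightarrow> 'u" where
  "smooth F x = (\<integral>y. \<kappa> x y *\<^sub>R F y \<partial>P)"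

definition form :: "('x \<Rightarrow> 'u::{real_inner, banach, second_countable_topology}) \<Rightarrow> ('x \<Rightarrow> 'u) \<Rightarrow> real" where
  "form F G = (\<integral>p. (F (fst p) \<bullet> G (snd p)) * \<kappa> (fst p) (snd p) \<partial>(P \<Otimes>\<^sub>M P))"

context
  fixes F :: "'x \<Rightarrow> 'u::{real_inner, banach, second_countable_topology}"
  assumes F[measurable]: "F \<in> borel_measurable P" and F2: "integrable P (\<lambda>x. (norm (F x))\<^sup>2)"
begin

lemma integrable_norm: "integrable P (\<lambda>x. norm (F x))"
  by (rule P.square_integrable_imp_integrable) (use F2 in auto)

lemma integrable_F: "integrable P F"
  using integrable_norm F by (simp add: integrable_norm_iff)

lemma smooth_measurable: "smooth F \<in> borel_measurable P"
  unfolding smooth_def[abs_def]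
  by (rule P.borel_measurable_lebesgue_integral) (simp add: case_prod_beta')

lemma norm_smooth_le: "x \<in> space P \<Longrightarrow> norm (smooth F x) \<le> (\<integral>y. \<kappa> x y * norm (F y) \<partial>P)"
  unfolding smooth_def
  using integral_norm_bound[of P "\<lambda>y. \<kappa> x y *\<^sub>R F y"] kernel_nonneg by simp

lemma norm_smooth_bounded:
  assumes "x \<in> space P"
  shows "norm (smooth F x) \<le> B * (\<integral>y. norm (F y) \<partial>P)"
proof -
  have "(\<integral>y. \<kappa> x y * norm (F y) \<partial>P) \<le> (\<integral>y. B * norm (F y) \<partial>P)"
    using integrable_kernel_mult[OF integrable_norm assms] integrable_norm kernel_le
    by (intro integral_mono) (auto intro: mult_right_mono)
  then show ?thesis using norm_smooth_le[OF assms] by simp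
qed

text \<open>Cauchy-Schwarz for the measure with density \<open>\<kappa> x\<close> with respect to
  \<open>P\<close>, whose total mass is at most \<open>\<Lambda>\<close>.\<close>

lemma norm_smooth_sq_le:
  assumes x: "x \<in> space P"
  shows "(norm (smooth F x))\<^sup>2 \<le> \<Lambda> * (\<integral>y. \<kappa> x y * (norm (F y))\<^sup>2 \<partial>P)"
proof -
  define L where "L = (\<integral>y. \<kappa> x y * norm (F y) \<partial>P)"
  define S where "S = (\<integral>y. \<kappa> x y * (norm (F y))\<^sup>2 \<partial>P)"
  \<comment> \<open>The minimiser of t^2 \<Lambda> - 2 t L. Dividing by \<open>\<Lambda>\<close>
    instead of the row integral avoids the case where the latter is zero.\<close>
  define t where "t = L / \<Lambda>"
  note i = integrable_kernel_mult[OF integrable_norm x, simplified] integrable_kernel_mult[OF F2 x, simplified]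
    integrable_kernel[OF x]
  have "0 \<le> (\<integral>y. \<kappa> x y * (t - norm (F y))\<^sup>2 \<partial>P)"
    using kernel_nonneg by (intro Bochner_Integration.integral_nonneg) simp
  also have "\<dots> = (\<integral>y. t\<^sup>2 * \<kappa> x y - 2 * t * (\<kappa> x y * norm (F y)) + \<kappa> x y * (norm (F y))\<^sup>2 \<partial>P)"
    by (intro Bochner_Integration.integral_cong refl) (simp add: power2_eq_square algebra_simps)
  also have "\<dots> = t\<^sup>2 * (\<integral>y. \<kappa> x y \<partial>P) - 2 * t * L + S"
    using i by (simp add: L_def S_def)
  also have "\<dots> \<le> t\<^sup>2 * \<Lambda> - 2 * t * L + S"
    using mult_left_mono[OF row[OF x], of "t\<^sup>2"] by simp
  also have "\<dots> = S - L\<^sup>2 / \<Lambda>"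
    using \<Lambda> by (simp add: t_def field_simps power2_eq_square)
  finally have "L\<^sup>2 \<le> \<Lambda> * S" using \<Lambda> by (simp add: field_simps)
  moreover have "(norm (smooth F x))\<^sup>2 \<le> L\<^sup>2"
    using norm_smooth_le[OF x] by (intro power_mono) (auto simp: L_def)
  ultimately show ?thesis by (simp add: S_def)
qed

lemma integrable_smooth_sq: "integrable P (\<lambda>x. (norm (smooth F x))\<^sup>2)"
proof (rule P.integrable_const_bound)
  show "AE x in P. norm ((norm (smooth F x))\<^sup>2) \<le> (B * (\<integral>y. norm (F y) \<partial>P))\<^sup>2"
    using AE_space by eventually_elim (simp add: norm_smooth_bounded power_mono)
qed (use smooth_measurable in measurable)

lemma form_smooth:
  assumes G[measurable]: "G \<in> borel_measurable P" and G2: "integrable P (\<lambda>x. (norm (G x))\<^sup>2)"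
  shows "form G F = (\<integral>x. G x \<bullet> smooth F x \<partial>P)"
proof -
  have int: "integrable (P \<Otimes>\<^sub>M P) (\<lambda>p. (G (fst p) \<bullet> F (snd p)) * \<kappa> (fst p) (snd p))"
    using G2 F2 abs_kernel_le by (intro integrable_square_product) auto
  have "form G F = (\<integral>x. (\<integral>y. (G x \<bullet> F y) * \<kappa> x y \<partial>P) \<partial>P)"
    unfolding form_def using PP.integral_fst'[OF int] by simp
  also have "\<dots> = (\<integral>x. G x \<bullet> smooth F x \<partial>P)"
  proof (rule Bochner_Integration.integral_cong[OF refl])
    fix x assume "x \<in> space P"
    then have "G x \<bullet> smooth F x = (\<integral>y. G x \<bullet> (\<kappa> x y *\<^sub>R F y) \<partial>P)"
      unfolding smooth_def by (intro integral_inner_right[symmetric] integrable_kernel_mult integrable_F)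
    then show "(\<integral>y. (G x \<bullet> F y) * \<kappa> x y \<partial>P) = G x \<bullet> smooth F x"
      by (simp add: mult.commute)
  qed
  finally show ?thesis .
qed

end

lemma form_sym:
  fixes F G :: "'x \<Rightarrow> 'u::{real_inner, banach, second_countable_topology}"
  assumes [measurable]: "F \<in> borel_measurable P" "G \<in> borel_measurable P"
  shows "form F G = form G F"
proof -
  have "form F G = (\<integral>p. (F (snd p) \<bullet> G (fst p)) * \<kappa> (snd p) (fst p) \<partial>(P \<Otimes>\<^sub>M P))"
    unfolding form_def
    using integral_swap(1)[of "\<lambda>p. (F (fst p) \<bullet> G (snd p)) * \<kappa> (fst p) (snd p)"] by simp
  also have "\<dots> = form G F"
    unfolding form_def
  proof (rule Bochner_Integration.integral_cong[OF refl])
    fix p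
    show "(F (snd p) \<bullet> G (fst p)) * \<kappa> (snd p) (fst p) = (G (fst p) \<bullet> F (snd p)) * \<kappa> (fst p) (snd p)"
      by (simp only: kernel_sym[of "snd p" "fst p"] inner_commute[of "F (snd p)"])
  qed
  finally show ?thesis .
qed

text \<open>Schur's test in quadratic form: 2 <F, F'> <= |F|^2 + |F'|^2, and by the row and column
  bounds each square integrates against the kernel to at most \<open>\<Lambda>\<close> times the
  squared norm.\<close>

lemma form_le:
  fixes F :: "'x \<Rightarrow> 'u::{real_inner, banach, second_countable_topology}"
  assumes [measurable]: "F \<in> borel_measurable P" and F2: "integrable P (\<lambda>x. (norm (F x))\<^sup>2)"
  shows "form F F \<le> \<Lambda> * (\<integral>x. (norm (F x))\<^sup>2 \<partial>P)"
proof -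
  have i1: "integrable (P \<Otimes>\<^sub>M P) (\<lambda>p. (norm (F (fst p)))\<^sup>2 * \<kappa> (fst p) (snd p))"
    by (intro integrable_kernel_pair integrable_comp_fst F2)
  have i2: "integrable (P \<Otimes>\<^sub>M P) (\<lambda>p. (norm (F (snd p)))\<^sup>2 * \<kappa> (fst p) (snd p))"
    by (intro integrable_kernel_pair integrable_comp_snd F2)
  have "form F F \<le> (\<integral>p. ((norm (F (fst p)))\<^sup>2 * \<kappa> (fst p) (snd p) + (norm (F (snd p)))\<^sup>2 * \<kappa> (fst p) (snd p)) / 2 \<partial>(P \<Otimes>\<^sub>M P))"
    unfolding form_def
  proof (rule integral_mono)
    show "integrable (P \<Otimes>\<^sub>M P) (\<lambda>p. (F (fst p) \<bullet> F (snd p)) * \<kappa> (fst p) (snd p))"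
      using F2 abs_kernel_le by (intro integrable_square_product) auto
    fix p
    have "2 * (F (fst p) \<bullet> F (snd p)) \<le> (norm (F (fst p)))\<^sup>2 + (norm (F (snd p)))\<^sup>2"
      using norm_cauchy_schwarz[of "F (fst p)" "F (snd p)"]
        sum_squares_bound[of "norm (F (fst p))" "norm (F (snd p))"] by linarith
    from mult_right_mono[OF this kernel_nonneg[of "fst p" "snd p"]]
    show "(F (fst p) \<bullet> F (snd p)) * \<kappa> (fst p) (snd p)
      \<le> ((norm (F (fst p)))\<^sup>2 * \<kappa> (fst p) (snd p) + (norm (F (snd p)))\<^sup>2 * \<kappa> (fst p) (snd p)) / 2"
      by (simp add: algebra_simps)
  qed (use i1 i2 in simp)
  also have "\<dots> \<le> \<Lambda> * (\<integral>x. (norm (F x))\<^sup>2 \<partial>P)"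
    using i1 i2 row_bound[OF F2] col_bound[OF F2] by simp
  finally show ?thesis .
qed

text \<open>With \<open>T\<close> the integral operator of \<open>\<kappa>\<close>, this is \<open>\<parallel>T F\<parallel>\<^sup>2 \<le> \<parallel>T\<parallel> \<langle>F, T F\<rangle>\<close>, obtained from
  positivity of the form at \<open>F - T F / \<Lambda>\<close> and Schur's test \<open>\<parallel>T\<parallel> \<le> \<Lambda>\<close>.\<close>

lemma smooth_sq_le_form:
  fixes F :: "'x \<Rightarrow> 'u::{real_inner, banach, second_countable_topology}"
  assumes psd: "psd TYPE('u) \<kappa>"
    and F[measurable]: "F \<in> borel_measurable P" and F2: "integrable P (\<lambda>x. (norm (F x))\<^sup>2)"
  shows "(\<integral>x. (norm (smooth F x))\<^sup>2 \<partial>P) \<le> \<Lambda> * form F F"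
proof -
  define T where "T = smooth F"
  have T[measurable]: "T \<in> borel_measurable P" unfolding T_def by (rule smooth_measurable[OF F F2])
  have T2: "integrable P (\<lambda>x. (norm (T x))\<^sup>2)" unfolding T_def by (rule integrable_smooth_sq[OF F F2])
  \<comment> \<open>With H = F - s T F the form expands to <F, T F> - 2 s |T F|^2 + s^2 <T F, T T
    F>, whose last term is at most s^2 \<Lambda> |T F|^2; s = 1/\<Lambda> minimises -2 s + s^2
    \<Lambda>.\<close>
  define s where "s = 1 / \<Lambda>"
  define H where "H x = F x - s *\<^sub>R T x" for x
  have H[measurable]: "H \<in> borel_measurable P" unfolding H_def by measurable
  have H2: "integrable P (\<lambda>x. (norm (H x))\<^sup>2)"
  proof (rule Bochner_Integration.integrable_bound)
    show "integrable P (\<lambda>x. 2 * (norm (F x))\<^sup>2 + 2 * (norm (- s *\<^sub>R T x))\<^sup>2)"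
      using F2 T2 by (simp add: power_mult_distrib)
    show "AE x in P. norm ((norm (H x))\<^sup>2) \<le> norm (2 * (norm (F x))\<^sup>2 + 2 * (norm (- s *\<^sub>R T x))\<^sup>2)"
      using norm_add_sq_le[of "F _" "- s *\<^sub>R T _"] by (intro AE_I2) (simp add: H_def)
  qed measurable
  obtain y where y: "y \<in> space P" using P.not_empty by auto
  have "0 \<le> form H H"
    using psd_quadratic[OF psd kernel_meas H abs_kernel_le kernel_sym H2 y, of 0] by (simp add: form_def)
  also have "form H H = (\<integral>p. (F (fst p) \<bullet> F (snd p)) * \<kappa> (fst p) (snd p)
      - s * ((F (fst p) \<bullet> T (snd p)) * \<kappa> (fst p) (snd p)) - s * ((T (fst p) \<bullet> F (snd p)) * \<kappa> (fst p) (snd p))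
      + s\<^sup>2 * ((T (fst p) \<bullet> T (snd p)) * \<kappa> (fst p) (snd p)) \<partial>(P \<Otimes>\<^sub>M P))"
    unfolding form_def H_def
    by (intro Bochner_Integration.integral_cong refl) (simp add: inner_diff algebra_simps power2_eq_square)
  also have "\<dots> = form F F - s * form F T - s * form T F + s\<^sup>2 * form T T"
  proof -
    have "integrable (P \<Otimes>\<^sub>M P) (\<lambda>p. (F (fst p) \<bullet> F (snd p)) * \<kappa> (fst p) (snd p))"
      "integrable (P \<Otimes>\<^sub>M P) (\<lambda>p. (F (fst p) \<bullet> T (snd p)) * \<kappa> (fst p) (snd p))"
      "integrable (P \<Otimes>\<^sub>M P) (\<lambda>p. (T (fst p) \<bullet> F (snd p)) * \<kappa> (fst p) (snd p))"
      "integrable (P \<Otimes>\<^sub>M P) (\<lambda>p. (T (fst p) \<bullet> T (snd p)) * \<kappa> (fst p) (snd p))"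
      using F2 T2 abs_kernel_le by (auto intro!: integrable_square_product)
    then show ?thesis by (simp add: form_def)
  qed
  also have "form F T = form T F" by (rule form_sym) measurable
  also have "form T F = (\<integral>x. (norm (T x))\<^sup>2 \<partial>P)"
    unfolding form_smooth[OF F F2 T T2] T_def[symmetric] by (simp add: power2_norm_eq_inner)
  finally have "0 \<le> form F F - 2 * s * (\<integral>x. (norm (T x))\<^sup>2 \<partial>P) + s\<^sup>2 * form T T" by simp
  also have "\<dots> \<le> form F F - 2 * s * (\<integral>x. (norm (T x))\<^sup>2 \<partial>P) + s\<^sup>2 * (\<Lambda> * (\<integral>x. (norm (T x))\<^sup>2 \<partial>P))"
    using form_le[OF T T2] by (intro add_left_mono mult_left_mono) auto
  also have "\<dots> = form F F - s * (\<integral>x. (norm (T x))\<^sup>2 \<partial>P)"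
    using \<Lambda> by (simp add: s_def power2_eq_square field_simps)
  finally show ?thesis using \<Lambda> by (simp add: s_def T_def field_simps)
qed

end

text \<open>\<open>C\<close> is the sigma-algebra generated by the regressors, \<open>V\<close> the
  weighted noise and \<open>D\<close> the weighted alternative. \<open>V_orth\<close> and
  \<open>V_var\<close> state E(V | C) = 0 and E(|V|^2 | C) <= v through test functions, bounded in
  the first case and nonnegative in the second. \<open>kernel_C\<close> makes kernel averages over
  the second argument measurable with respect to \<open>C\<close>, hence admissible as
  tests.\<close>

locale regression_kernel = iid_kernel M X P \<kappa> B \<Lambda>
  for M :: "'a measure" and X :: "nat \<Rightarrow> 'a \<Rightarrow> 'x" and P \<kappa> B \<Lambda> +
  fixes C :: "'x measure" and V D :: "'x \<Rightarrow> 'u::{real_inner, banach, second_countable_topology}"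
    and v r :: real
  assumes subalg: "subalgebra P C"
    and kernel_C[measurable]: "(\<lambda>p. \<kappa> (fst p) (snd p)) \<in> borel_measurable (C \<Otimes>\<^sub>M P)"
    and psd: "psd TYPE('u) \<kappa>"
    and V_meas[measurable]: "V \<in> borel_measurable P"
    and D_meas_C[measurable]: "D \<in> borel_measurable C"
    and D4: "integrable P (\<lambda>x. norm (D x) ^ 4)"
    and V_orth: "\<And>G K. G \<in> borel_measurable C \<Longrightarrow> (\<And>x. x \<in> space P \<Longrightarrow> norm (G x) \<le> K) \<Longrightarrow>
      (\<integral>x. V x \<bullet> G x \<partial>P) = 0"
    and v: "0 \<le> v"
    and V_var: "\<And>G. G \<in> borel_measurable C \<Longrightarrow>
      (\<integral>\<^sup>+x. ennreal ((norm (V x))\<^sup>2) * G x \<partial>P) \<le> (\<integral>\<^sup>+x. ennreal v * G x \<partial>P)"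
begin

lemma measurable_CP: "f \<in> measurable C N \<Longrightarrow> f \<in> measurable P N"
  by (rule measurable_from_subalg[OF subalg])

lemma D_meas[measurable]: "D \<in> borel_measurable P"
  by (rule measurable_CP) measurable

lemma D2: "integrable P (\<lambda>x. (norm (D x))\<^sup>2)"
proof (rule P.square_integrable_imp_integrable)
  show "integrable P (\<lambda>x. ((norm (D x))\<^sup>2)\<^sup>2)" using D4 by (simp flip: power_mult)
qed measurable

lemma V_var_real:
  assumes G[measurable]: "G \<in> borel_measurable C" and "\<And>x. x \<in> space P \<Longrightarrow> 0 \<le> G x"
    and "\<And>x. x \<in> space P \<Longrightarrow> G x \<le> K"
  shows "integrable P (\<lambda>x. (norm (V x))\<^sup>2 * G x)"
    and "(\<integral>x. (norm (V x))\<^sup>2 * G x \<partial>P) \<le> v * (\<integral>x. G x \<partial>P)"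
proof -
  have [measurable]: "G \<in> borel_measurable P" by (rule measurable_CP[OF G])
  have intG: "integrable P G"
    by (rule P.integrable_const_bound[of _ K]) (use assms in auto)
  have G0: "0 \<le> (\<integral>x. G x \<partial>P)" using assms by (intro Bochner_Integration.integral_nonneg)
  have "(\<integral>\<^sup>+x. ennreal ((norm (V x))\<^sup>2 * G x) \<partial>P) = (\<integral>\<^sup>+x. ennreal ((norm (V x))\<^sup>2) * ennreal (G x) \<partial>P)"
    by (intro nn_integral_cong) (simp add: ennreal_mult assms)
  also have "\<dots> \<le> (\<integral>\<^sup>+x. ennreal v * ennreal (G x) \<partial>P)" by (intro V_var) measurable
  also have "\<dots> = ennreal v * (\<integral>\<^sup>+x. ennreal (G x) \<partial>P)" by (intro nn_integral_cmult) measurable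
  also have "(\<integral>\<^sup>+x. ennreal (G x) \<partial>P) = ennreal (\<integral>x. G x \<partial>P)"
    using intG assms by (intro nn_integral_eq_integral) auto
  also have "ennreal v * ennreal (\<integral>x. G x \<partial>P) = ennreal (v * (\<integral>x. G x \<partial>P))"
    using v G0 by (simp add: ennreal_mult)
  finally have *: "(\<integral>\<^sup>+x. ennreal ((norm (V x))\<^sup>2 * G x) \<partial>P) \<le> ennreal (v * (\<integral>x. G x \<partial>P))" .
  show "integrable P (\<lambda>x. (norm (V x))\<^sup>2 * G x)"
  proof (rule integrableI_bounded)
    have "(\<integral>\<^sup>+x. ennreal (norm ((norm (V x))\<^sup>2 * G x)) \<partial>P) = (\<integral>\<^sup>+x. ennreal ((norm (V x))\<^sup>2 * G x) \<partial>P)"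
      by (intro nn_integral_cong) (simp add: assms)
    then show "(\<integral>\<^sup>+x. ennreal (norm ((norm (V x))\<^sup>2 * G x)) \<partial>P) < \<infinity>"
      using * by (simp add: le_less_trans[OF _ ennreal_less_top])
  qed measurable
  show "(\<integral>x. (norm (V x))\<^sup>2 * G x \<partial>P) \<le> v * (\<integral>x. G x \<partial>P)"
    by (rule integral_real_bounded[OF _ *]) (use v G0 in simp)
qed

lemma V2: "integrable P (\<lambda>x. (norm (V x))\<^sup>2)"
  using V_var_real(1)[of "\<lambda>_. 1" 1] by simp

definition Y where "Y x = V x + r *\<^sub>R D x"

lemma Y_meas[measurable]: "Y \<in> borel_measurable P"
  unfolding Y_def by measurable

lemma norm_Y_sq: "(norm (Y x))\<^sup>2 \<le> 2 * (norm (V x))\<^sup>2 + 2 * r\<^sup>2 * (norm (D x))\<^sup>2"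
  using norm_add_sq_le[of "V x" "r *\<^sub>R D x"] by (simp add: Y_def power_mult_distrib)

lemma Y2: "integrable P (\<lambda>x. (norm (Y x))\<^sup>2)"
proof (rule Bochner_Integration.integrable_bound)
  show "integrable P (\<lambda>x. 2 * (norm (V x))\<^sup>2 + 2 * r\<^sup>2 * (norm (D x))\<^sup>2)" using V2 D2 by simp
  show "AE x in P. norm ((norm (Y x))\<^sup>2) \<le> norm (2 * (norm (V x))\<^sup>2 + 2 * r\<^sup>2 * (norm (D x))\<^sup>2)"
    using norm_Y_sq by (intro AE_I2) simp
qed measurable

definition g where "g p = (Y (fst p) \<bullet> Y (snd p)) * \<kappa> (fst p) (snd p)"

lemma g_meas[measurable]: "g \<in> borel_measurable (P \<Otimes>\<^sub>M P)"
  unfolding g_def by measurable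

lemma g_sym: "g (x, y) = g (y, x)"
  by (simp add: g_def inner_commute kernel_sym[of x y])

lemma integrable_g: "integrable (P \<Otimes>\<^sub>M P) g"
  unfolding g_def using Y2 abs_kernel_le by (intro integrable_square_product) auto

abbreviation T where "T \<equiv> smooth D"

lemma T_meas_C[measurable]: "T \<in> borel_measurable C"
  unfolding smooth_def[abs_def]
  by (rule P.borel_measurable_lebesgue_integral) (simp add: case_prod_beta')

lemma T_meas[measurable]: "T \<in> borel_measurable P"
  by (rule measurable_CP) measurable

lemma kernel_section_C:
  assumes "x \<in> space P"
  shows "(\<lambda>y. \<kappa> x y) \<in> borel_measurable C"
proof -
  have "(\<lambda>y. (\<lambda>p. \<kappa> (fst p) (snd p)) (y, x)) \<in> borel_measurable C"
    using measurable_compose[OF measurable_Pair2' kernel_C] assms by simp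
  then show ?thesis by (simp add: kernel_sym[of x])
qed

text \<open>For fixed \<open>x\<close> the kernel section times \<open>Y x\<close> is bounded and
  measurable with respect to \<open>C\<close> as a function of \<open>y\<close>, so the noise at
  \<open>y\<close> integrates to zero against it and only the alternative is left.\<close>

lemma g_section:
  assumes x: "x \<in> space P"
  shows "(\<integral>y. g (x, y) \<partial>P) = r * (Y x \<bullet> T x)"
proof -
  have [measurable]: "(\<lambda>y. \<kappa> x y) \<in> borel_measurable C" by (rule kernel_section_C[OF x])
  have iV: "integrable P V" and iD: "integrable P D"
    by (rule integrable_F[OF V_meas V2], rule integrable_F[OF D_meas D2])
  have i: "integrable P (\<lambda>y. \<kappa> x y *\<^sub>R V y)" "integrable P (\<lambda>y. \<kappa> x y *\<^sub>R D y)"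
    by (rule integrable_kernel_mult[OF iV x], rule integrable_kernel_mult[OF iD x])
  have "(\<integral>y. g (x, y) \<partial>P) = (\<integral>y. Y x \<bullet> (\<kappa> x y *\<^sub>R V y) + r * (Y x \<bullet> (\<kappa> x y *\<^sub>R D y)) \<partial>P)"
    by (intro Bochner_Integration.integral_cong refl) (simp add: g_def Y_def inner_add algebra_simps)
  also have "\<dots> = (\<integral>y. Y x \<bullet> (\<kappa> x y *\<^sub>R V y) \<partial>P) + r * (Y x \<bullet> T x)"
    using i by (simp add: integral_inner_right smooth_def del: inner_scaleR_right)
  also have "(\<integral>y. Y x \<bullet> (\<kappa> x y *\<^sub>R V y) \<partial>P) = (\<integral>y. V y \<bullet> (\<kappa> x y *\<^sub>R Y x) \<partial>P)"
    by (simp add: inner_commute)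
  also have "\<dots> = 0"
  proof (rule V_orth)
    show "norm (\<kappa> x y *\<^sub>R Y x) \<le> B * norm (Y x)" for y
      using abs_kernel_le[of x y] by (auto intro!: mult_right_mono)
  qed measurable
  finally show ?thesis by simp
qed

lemma integral_V_T: "(\<integral>x. V x \<bullet> T x \<partial>P) = 0"
  by (rule V_orth[OF T_meas_C norm_smooth_bounded[OF D_meas D2]])

lemma integrable_inner_T:
  assumes F[measurable]: "F \<in> borel_measurable P" and F2: "integrable P (\<lambda>x. (norm (F x))\<^sup>2)"
  shows "integrable P (\<lambda>x. F x \<bullet> T x)"
proof (rule Bochner_Integration.integrable_bound)
  show "integrable P (\<lambda>x. norm (F x) * (B * (\<integral>y. norm (D y) \<partial>P)))"
    using integrable_norm[OF F F2] by simp
  show "AE x in P. norm (F x \<bullet> T x) \<le> norm (norm (F x) * (B * (\<integral>y. norm (D y) \<partial>P)))"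
    using AE_space
  proof eventually_elim
    case (elim x)
    have "\<bar>F x \<bullet> T x\<bar> \<le> norm (F x) * norm (T x)" by (rule Cauchy_Schwarz_ineq2)
    also have "\<dots> \<le> norm (F x) * (B * (\<integral>y. norm (D y) \<partial>P))"
      using norm_smooth_bounded[OF D_meas D2 elim] by (intro mult_left_mono) auto
    finally show ?case by (metis abs_ge_self order_trans real_norm_def)
  qed
qed measurable

text \<open>The remaining noise term vanishes because T D is itself a bounded test function for
  \<open>V_orth\<close>.\<close>

lemma integral_g: "integral\<^sup>L (P \<Otimes>\<^sub>M P) g = r\<^sup>2 * form D D"
proof -
  have "integral\<^sup>L (P \<Otimes>\<^sub>M P) g = (\<integral>x. (\<integral>y. g (x, y) \<partial>P) \<partial>P)"
    using PP.integral_fst'[OF integrable_g] by simp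
  also have "\<dots> = (\<integral>x. r * (V x \<bullet> T x) + r\<^sup>2 * (D x \<bullet> T x) \<partial>P)"
    by (intro Bochner_Integration.integral_cong refl)
      (simp add: g_section Y_def inner_add_left distrib_left power2_eq_square)
  also have "\<dots> = r * (\<integral>x. V x \<bullet> T x \<partial>P) + r\<^sup>2 * (\<integral>x. D x \<bullet> T x \<partial>P)"
    using integrable_inner_T[OF V_meas V2] integrable_inner_T[OF D_meas D2] by simp
  finally show ?thesis by (simp add: integral_V_T form_smooth[OF D_meas D2 D_meas D2])
qed

text \<open>The projection is r <V + r D, T D>. Its noise part is bounded by \<open>V_var\<close>,
  applied with |T D|^2 as test function, and then by \<open>smooth_sq_le_form\<close>; its drift
  part uses the fourth moment of \<open>D\<close>.\<close>

lemma g_section_sq: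
  "(\<integral>x. (\<integral>y. g (x, y) \<partial>P)\<^sup>2 \<partial>P)
    \<le> 2 * r\<^sup>2 * v * \<Lambda> * form D D + 2 * r ^ 4 * \<Lambda>\<^sup>2 * (\<integral>x. norm (D x) ^ 4 \<partial>P)"
proof -
  define K where "K = (B * (\<integral>y. norm (D y) \<partial>P))\<^sup>2"
  have TK: "(norm (T x))\<^sup>2 \<le> K" if "x \<in> space P" for x
    unfolding K_def using norm_smooth_bounded[OF D_meas D2 that] by (intro power_mono) auto
  have [measurable]: "(\<lambda>x. (norm (T x))\<^sup>2) \<in> borel_measurable C" by measurable
  have iV: "integrable P (\<lambda>x. (norm (V x))\<^sup>2 * (norm (T x))\<^sup>2)"
    and bV: "(\<integral>x. (norm (V x))\<^sup>2 * (norm (T x))\<^sup>2 \<partial>P) \<le> v * (\<integral>x. (norm (T x))\<^sup>2 \<partial>P)"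
    using V_var_real[of "\<lambda>x. (norm (T x))\<^sup>2" K] TK by auto
  have iD: "integrable P (\<lambda>x. (norm (D x))\<^sup>2 * (norm (T x))\<^sup>2)"
  proof (rule Bochner_Integration.integrable_bound)
    show "integrable P (\<lambda>x. (norm (D x))\<^sup>2 * K)" using D2 by simp
    show "AE x in P. norm ((norm (D x))\<^sup>2 * (norm (T x))\<^sup>2) \<le> norm ((norm (D x))\<^sup>2 * K)"
    proof (rule AE_I2)
      fix x assume "x \<in> space P"
      moreover have "0 \<le> K" by (simp add: K_def)
      ultimately show "norm ((norm (D x))\<^sup>2 * (norm (T x))\<^sup>2) \<le> norm ((norm (D x))\<^sup>2 * K)"
        using TK by (auto simp: abs_mult intro!: mult_left_mono)
    qed
  qed measurable
  have D2': "integrable P (\<lambda>x. (norm ((norm (D x))\<^sup>2))\<^sup>2)" using D4 by (simp flip: power_mult)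
  have form2: "form (\<lambda>x. (norm (D x))\<^sup>2) (\<lambda>x. (norm (D x))\<^sup>2) \<le> \<Lambda> * (\<integral>x. norm (D x) ^ 4 \<partial>P)"
    using form_le[of "\<lambda>x. (norm (D x))\<^sup>2", OF _ D2'] by (simp flip: power_mult)
  have int2: "integrable (P \<Otimes>\<^sub>M P) (\<lambda>p. ((norm (D (fst p)))\<^sup>2 \<bullet> (norm (D (snd p)))\<^sup>2) * \<kappa> (fst p) (snd p))"
    using D2' abs_kernel_le by (intro integrable_square_product) auto
  \<comment> \<open>Bounding |T D|^2 pointwise by \<Lambda> times the smoothed |D|^2 leaves the form
    of the scalar function |D|^2 with itself, to which Schur's test applies once more.\<close>
  have bD: "(\<integral>x. (norm (D x))\<^sup>2 * (norm (T x))\<^sup>2 \<partial>P) \<le> \<Lambda>\<^sup>2 * (\<integral>x. norm (D x) ^ 4 \<partial>P)"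
  proof -
    have "(\<integral>x. (norm (D x))\<^sup>2 * (norm (T x))\<^sup>2 \<partial>P)
        \<le> (\<integral>x. \<Lambda> * (\<integral>y. ((norm (D x))\<^sup>2 \<bullet> (norm (D y))\<^sup>2) * \<kappa> x y \<partial>P) \<partial>P)"
    proof (rule integral_mono_AE)
      show "integrable P (\<lambda>x. \<Lambda> * (\<integral>y. ((norm (D x))\<^sup>2 \<bullet> (norm (D y))\<^sup>2) * \<kappa> x y \<partial>P))"
        using PP.integrable_fst'[OF int2] by simp
      show "AE x in P. (norm (D x))\<^sup>2 * (norm (T x))\<^sup>2
          \<le> \<Lambda> * (\<integral>y. ((norm (D x))\<^sup>2 \<bullet> (norm (D y))\<^sup>2) * \<kappa> x y \<partial>P)"
        using AE_space
      proof eventually_elim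
        case (elim x)
        have "(norm (D x))\<^sup>2 * (norm (T x))\<^sup>2 \<le> (norm (D x))\<^sup>2 * (\<Lambda> * (\<integral>y. \<kappa> x y * (norm (D y))\<^sup>2 \<partial>P))"
          using norm_smooth_sq_le[OF D_meas D2 elim] by (intro mult_left_mono) auto
        also have "\<dots> = \<Lambda> * (\<integral>y. (norm (D x))\<^sup>2 * (\<kappa> x y * (norm (D y))\<^sup>2) \<partial>P)" by simp
        also have "\<dots> = \<Lambda> * (\<integral>y. ((norm (D x))\<^sup>2 \<bullet> (norm (D y))\<^sup>2) * \<kappa> x y \<partial>P)"
          by (simp add: mult_ac)
        finally show ?case .
      qed
    qed (rule iD)
    also have "\<dots> = \<Lambda> * form (\<lambda>x. (norm (D x))\<^sup>2) (\<lambda>x. (norm (D x))\<^sup>2)"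
      unfolding form_def using PP.integral_fst'[OF int2] by simp
    also have "\<dots> \<le> \<Lambda> * (\<Lambda> * (\<integral>x. norm (D x) ^ 4 \<partial>P))"
      using form2 \<Lambda> by (intro mult_left_mono) auto
    finally show ?thesis by (simp add: power2_eq_square mult.assoc)
  qed
  have "(\<integral>x. (\<integral>y. g (x, y) \<partial>P)\<^sup>2 \<partial>P) = (\<integral>x. r\<^sup>2 * (Y x \<bullet> T x)\<^sup>2 \<partial>P)"
    by (intro Bochner_Integration.integral_cong refl) (simp add: g_section power_mult_distrib)
  also have "\<dots> \<le> (\<integral>x. 2 * r\<^sup>2 * ((norm (V x))\<^sup>2 * (norm (T x))\<^sup>2) + 2 * r ^ 4 * ((norm (D x))\<^sup>2 * (norm (T x))\<^sup>2) \<partial>P)"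
  proof (rule integral_mono_AE')
    show "integrable P (\<lambda>x. 2 * r\<^sup>2 * ((norm (V x))\<^sup>2 * (norm (T x))\<^sup>2) + 2 * r ^ 4 * ((norm (D x))\<^sup>2 * (norm (T x))\<^sup>2))"
      using iV iD by simp
    show "AE x in P. r\<^sup>2 * (Y x \<bullet> T x)\<^sup>2
        \<le> 2 * r\<^sup>2 * ((norm (V x))\<^sup>2 * (norm (T x))\<^sup>2) + 2 * r ^ 4 * ((norm (D x))\<^sup>2 * (norm (T x))\<^sup>2)"
    proof (rule AE_I2)
      fix x
      have "(Y x \<bullet> T x)\<^sup>2 \<le> (norm (Y x))\<^sup>2 * (norm (T x))\<^sup>2"
        using Cauchy_Schwarz_ineq[of "Y x" "T x"] by (simp add: power2_norm_eq_inner)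
      also have "\<dots> \<le> (2 * (norm (V x))\<^sup>2 + 2 * r\<^sup>2 * (norm (D x))\<^sup>2) * (norm (T x))\<^sup>2"
        using norm_Y_sq by (intro mult_right_mono) auto
      finally have "r\<^sup>2 * (Y x \<bullet> T x)\<^sup>2
          \<le> r\<^sup>2 * ((2 * (norm (V x))\<^sup>2 + 2 * r\<^sup>2 * (norm (D x))\<^sup>2) * (norm (T x))\<^sup>2)"
        by (intro mult_left_mono) auto
      also have "\<dots> = 2 * r\<^sup>2 * ((norm (V x))\<^sup>2 * (norm (T x))\<^sup>2) + 2 * r ^ 4 * ((norm (D x))\<^sup>2 * (norm (T x))\<^sup>2)"
        by (simp add: algebra_simps power2_eq_square power4_eq_xxxx)
      finally show "r\<^sup>2 * (Y x \<bullet> T x)\<^sup>2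
        \<le> 2 * r\<^sup>2 * ((norm (V x))\<^sup>2 * (norm (T x))\<^sup>2) + 2 * r ^ 4 * ((norm (D x))\<^sup>2 * (norm (T x))\<^sup>2)" .
    qed
  qed simp
  also have "\<dots> = 2 * r\<^sup>2 * (\<integral>x. (norm (V x))\<^sup>2 * (norm (T x))\<^sup>2 \<partial>P) + 2 * r ^ 4 * (\<integral>x. (norm (D x))\<^sup>2 * (norm (T x))\<^sup>2 \<partial>P)"
    using iV iD by simp
  also have "\<dots> \<le> 2 * r\<^sup>2 * (v * (\<Lambda> * form D D)) + 2 * r ^ 4 * (\<Lambda>\<^sup>2 * (\<integral>x. norm (D x) ^ 4 \<partial>P))"
  proof (intro add_mono mult_left_mono bD)
    have "v * (\<integral>x. (norm (T x))\<^sup>2 \<partial>P) \<le> v * (\<Lambda> * form D D)"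
      using smooth_sq_le_form[OF psd D_meas D2] v by (intro mult_left_mono)
    then show "(\<integral>x. (norm (V x))\<^sup>2 * (norm (T x))\<^sup>2 \<partial>P) \<le> v * (\<Lambda> * form D D)" using bV by linarith
  qed auto
  finally show ?thesis by (simp add: mult_ac)
qed

text \<open>Since g^2 <= B |Y|^2 |Y'|^2 \<kappa>, the noise can be averaged out one argument at a
  time. The three summands of \<open>b\<close> use three different estimates: the pure noise term
  keeps E \<kappa>, because \<open>\<Lambda>\<close> would be too large there for the final rate,
  the mixed terms use \<open>\<Lambda>\<close>, and the pure drift term the pointwise bound
  \<open>B\<close>.\<close>

lemma g_sq:
  defines "m \<equiv> \<integral>x. (norm (D x))\<^sup>2 \<partial>P"
  defines "b \<equiv> B * (4 * v\<^sup>2 * (\<integral>p. \<kappa> (fst p) (snd p) \<partial>(P \<Otimes>\<^sub>M P)) + 8 * v * r\<^sup>2 * \<Lambda> * m + 4 * r ^ 4 * B * m\<^sup>2)"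
  shows "integrable (P \<Otimes>\<^sub>M P) (\<lambda>p. (g p)\<^sup>2)" and "(\<integral>p. (g p)\<^sup>2 \<partial>(P \<Otimes>\<^sub>M P)) \<le> b"
proof -
  \<comment> \<open>\<open>A\<close> dominates |Y|^2; \<open>a\<close> is the same with the
    conditional bound \<open>v\<close> in place of |V|^2 and is measurable with respect to
    \<open>C\<close>.\<close>
  define A where "A x = 2 * (norm (V x))\<^sup>2 + 2 * r\<^sup>2 * (norm (D x))\<^sup>2" for x
  define a where "a x = 2 * v + 2 * r\<^sup>2 * (norm (D x))\<^sup>2" for x
  have A0: "0 \<le> A x" and a0: "0 \<le> a x" for x using v by (simp_all add: A_def a_def)
  have [measurable]: "A \<in> borel_measurable P" "a \<in> borel_measurable C"
    unfolding A_def a_def by measurable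
  have a_P[measurable]: "a \<in> borel_measurable P" by (rule measurable_CP) measurable
  have swap_var: "(\<integral>\<^sup>+x. ennreal (A x) * G x \<partial>P) \<le> (\<integral>\<^sup>+x. ennreal (a x) * G x \<partial>P)"
    if G[measurable]: "G \<in> borel_measurable C" for G
  proof -
    have [measurable]: "G \<in> borel_measurable P" by (rule measurable_CP[OF G])
    have "(\<integral>\<^sup>+x. ennreal (A x) * G x \<partial>P)
        = (\<integral>\<^sup>+x. 2 * (ennreal ((norm (V x))\<^sup>2) * G x) + ennreal (2 * r\<^sup>2 * (norm (D x))\<^sup>2) * G x \<partial>P)"
      by (intro nn_integral_cong) (simp add: A_def ennreal_plus ennreal_mult distrib_right mult.assoc)
    also have "\<dots> = 2 * (\<integral>\<^sup>+x. ennreal ((norm (V x))\<^sup>2) * G x \<partial>P) + (\<integral>\<^sup>+x. ennreal (2 * r\<^sup>2 * (norm (D x))\<^sup>2) * G x \<partial>P)"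
      by (simp add: nn_integral_add nn_integral_cmult)
    also have "\<dots> \<le> 2 * (\<integral>\<^sup>+x. ennreal v * G x \<partial>P) + (\<integral>\<^sup>+x. ennreal (2 * r\<^sup>2 * (norm (D x))\<^sup>2) * G x \<partial>P)"
      by (intro add_mono mult_left_mono V_var[OF G] order_refl) auto
    also have "\<dots> = (\<integral>\<^sup>+x. 2 * (ennreal v * G x) + ennreal (2 * r\<^sup>2 * (norm (D x))\<^sup>2) * G x \<partial>P)"
      by (simp add: nn_integral_add nn_integral_cmult)
    also have "\<dots> = (\<integral>\<^sup>+x. ennreal (a x) * G x \<partial>P)"
      using v by (intro nn_integral_cong) (simp add: a_def ennreal_plus ennreal_mult distrib_right mult.assoc)
    finally show ?thesis .
  qed
  have a2: "integrable P (\<lambda>x. (norm (a x))\<^sup>2)"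
  proof -
    have "integrable P (\<lambda>x. 4 * v\<^sup>2 + 8 * v * r\<^sup>2 * (norm (D x))\<^sup>2 + 4 * r ^ 4 * norm (D x) ^ 4)"
      using D2 D4 by simp
    moreover have "4 * v\<^sup>2 + 8 * v * r\<^sup>2 * (norm (D x))\<^sup>2 + 4 * r ^ 4 * norm (D x) ^ 4 = (norm (a x))\<^sup>2" for x
      by (simp add: a_def algebra_simps power2_eq_square power4_eq_xxxx)
    ultimately show ?thesis by simp
  qed
  have int_aa: "integrable (P \<Otimes>\<^sub>M P) (\<lambda>p. a (fst p) * a (snd p) * \<kappa> (fst p) (snd p))"
    using integrable_square_product[of a a "\<lambda>p. \<kappa> (fst p) (snd p)" B] a2 abs_kernel_le by simp
  have int1: "integrable (P \<Otimes>\<^sub>M P) (\<lambda>p. \<kappa> (fst p) (snd p))"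
    using integrable_kernel_pair[of "\<lambda>_. 1"] by simp
  have int2: "integrable (P \<Otimes>\<^sub>M P) (\<lambda>p. (norm (D (fst p)))\<^sup>2 * \<kappa> (fst p) (snd p))"
    "integrable (P \<Otimes>\<^sub>M P) (\<lambda>p. (norm (D (snd p)))\<^sup>2 * \<kappa> (fst p) (snd p))"
    by (intro integrable_kernel_pair integrable_comp_fst integrable_comp_snd D2)+
  have D2': "integrable P (\<lambda>x. (norm ((norm (D x))\<^sup>2))\<^sup>2)" using D4 by (simp flip: power_mult)
  have int3: "integrable (P \<Otimes>\<^sub>M P) (\<lambda>p. (norm (D (fst p)))\<^sup>2 * (norm (D (snd p)))\<^sup>2)"
    using integrable_square_product[of "\<lambda>x. (norm (D x))\<^sup>2" "\<lambda>x. (norm (D x))\<^sup>2" "\<lambda>_. 1" 1] D2' by simp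
  note int4 = integrable_kernel_pair[OF int3]
  have "(\<integral>p. a (fst p) * a (snd p) * \<kappa> (fst p) (snd p) \<partial>(P \<Otimes>\<^sub>M P))
      = (\<integral>p. 4 * v\<^sup>2 * \<kappa> (fst p) (snd p) + 4 * v * r\<^sup>2 * ((norm (D (fst p)))\<^sup>2 * \<kappa> (fst p) (snd p))
        + 4 * v * r\<^sup>2 * ((norm (D (snd p)))\<^sup>2 * \<kappa> (fst p) (snd p))
        + 4 * r ^ 4 * ((norm (D (fst p)))\<^sup>2 * (norm (D (snd p)))\<^sup>2 * \<kappa> (fst p) (snd p)) \<partial>(P \<Otimes>\<^sub>M P))"
    by (intro Bochner_Integration.integral_cong refl)
      (simp add: a_def algebra_simps power2_eq_square power4_eq_xxxx)
  also have "\<dots> = 4 * v\<^sup>2 * (\<integral>p. \<kappa> (fst p) (snd p) \<partial>(P \<Otimes>\<^sub>M P))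
        + 4 * v * r\<^sup>2 * (\<integral>p. (norm (D (fst p)))\<^sup>2 * \<kappa> (fst p) (snd p) \<partial>(P \<Otimes>\<^sub>M P))
        + 4 * v * r\<^sup>2 * (\<integral>p. (norm (D (snd p)))\<^sup>2 * \<kappa> (fst p) (snd p) \<partial>(P \<Otimes>\<^sub>M P))
        + 4 * r ^ 4 * (\<integral>p. (norm (D (fst p)))\<^sup>2 * (norm (D (snd p)))\<^sup>2 * \<kappa> (fst p) (snd p) \<partial>(P \<Otimes>\<^sub>M P))"
    using int1 int2 int4 by simp
  also have "\<dots> \<le> 4 * v\<^sup>2 * (\<integral>p. \<kappa> (fst p) (snd p) \<partial>(P \<Otimes>\<^sub>M P))
        + 4 * v * r\<^sup>2 * (\<Lambda> * m) + 4 * v * r\<^sup>2 * (\<Lambda> * m) + 4 * r ^ 4 * (m\<^sup>2 * B)"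
  proof (intro add_mono mult_left_mono order_refl)
    show "(\<integral>p. (norm (D (fst p)))\<^sup>2 * \<kappa> (fst p) (snd p) \<partial>(P \<Otimes>\<^sub>M P)) \<le> \<Lambda> * m"
      unfolding m_def by (rule row_bound[OF D2]) simp
    show "(\<integral>p. (norm (D (snd p)))\<^sup>2 * \<kappa> (fst p) (snd p) \<partial>(P \<Otimes>\<^sub>M P)) \<le> \<Lambda> * m"
      unfolding m_def by (rule col_bound[OF D2]) simp
    have "(\<integral>p. (norm (D (fst p)))\<^sup>2 * (norm (D (snd p)))\<^sup>2 * \<kappa> (fst p) (snd p) \<partial>(P \<Otimes>\<^sub>M P))
        \<le> (\<integral>p. (norm (D (fst p)))\<^sup>2 * (norm (D (snd p)))\<^sup>2 * B \<partial>(P \<Otimes>\<^sub>M P))"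
      using int3 int4 kernel_le by (intro integral_mono mult_left_mono) auto
    also have "\<dots> = m\<^sup>2 * B"
      using integral_mult_independent[OF D2 D2] by (simp add: m_def power2_eq_square)
    finally show "(\<integral>p. (norm (D (fst p)))\<^sup>2 * (norm (D (snd p)))\<^sup>2 * \<kappa> (fst p) (snd p) \<partial>(P \<Otimes>\<^sub>M P)) \<le> m\<^sup>2 * B" .
  qed (use v in auto)
  finally have aa_le: "B * (\<integral>p. a (fst p) * a (snd p) * \<kappa> (fst p) (snd p) \<partial>(P \<Otimes>\<^sub>M P)) \<le> b"
    unfolding b_def using B_nonneg by (intro mult_left_mono) (auto simp: algebra_simps)
  have "0 \<le> (\<integral>p. a (fst p) * a (snd p) * \<kappa> (fst p) (snd p) \<partial>(P \<Otimes>\<^sub>M P))"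
    using a0 kernel_nonneg by (intro Bochner_Integration.integral_nonneg) simp
  then have b0: "0 \<le> b" using aa_le B_nonneg by (meson mult_nonneg_nonneg order_trans)
  have "(\<integral>\<^sup>+p. ennreal ((g p)\<^sup>2) \<partial>(P \<Otimes>\<^sub>M P))
      \<le> (\<integral>\<^sup>+p. ennreal B * ennreal (A (fst p) * A (snd p) * \<kappa> (fst p) (snd p)) \<partial>(P \<Otimes>\<^sub>M P))"
  proof (rule nn_integral_mono)
    fix p
    have "(Y (fst p) \<bullet> Y (snd p))\<^sup>2 \<le> (norm (Y (fst p)))\<^sup>2 * (norm (Y (snd p)))\<^sup>2"
      using Cauchy_Schwarz_ineq[of "Y (fst p)" "Y (snd p)"] by (simp add: power2_norm_eq_inner)
    also have "\<dots> \<le> A (fst p) * A (snd p)"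
      unfolding A_def using norm_Y_sq by (intro mult_mono) auto
    finally have *: "(Y (fst p) \<bullet> Y (snd p))\<^sup>2 \<le> A (fst p) * A (snd p)" .
    have "(g p)\<^sup>2 = (Y (fst p) \<bullet> Y (snd p))\<^sup>2 * (\<kappa> (fst p) (snd p) * \<kappa> (fst p) (snd p))"
      by (simp add: g_def power2_eq_square)
    also have "\<dots> \<le> (A (fst p) * A (snd p)) * (B * \<kappa> (fst p) (snd p))"
      using * kernel_nonneg kernel_le A0 by (intro mult_mono mult_right_mono) auto
    finally have "(g p)\<^sup>2 \<le> B * (A (fst p) * A (snd p) * \<kappa> (fst p) (snd p))" by (simp add: mult_ac)
    then show "ennreal ((g p)\<^sup>2) \<le> ennreal B * ennreal (A (fst p) * A (snd p) * \<kappa> (fst p) (snd p))"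
      using B_nonneg A0 kernel_nonneg by (subst ennreal_mult[symmetric]) (auto intro: ennreal_leI)
  qed
  also have "\<dots> = ennreal B * (\<integral>\<^sup>+p. ennreal (A (fst p) * A (snd p) * \<kappa> (fst p) (snd p)) \<partial>(P \<Otimes>\<^sub>M P))"
    by (rule nn_integral_cmult) measurable
  also have "(\<integral>\<^sup>+p. ennreal (A (fst p) * A (snd p) * \<kappa> (fst p) (snd p)) \<partial>(P \<Otimes>\<^sub>M P))
      = (\<integral>\<^sup>+x. \<integral>\<^sup>+y. ennreal (A x * A y * \<kappa> x y) \<partial>P \<partial>P)"
    by (subst P.nn_integral_fst[symmetric]) simp_all
  also have "\<dots> = (\<integral>\<^sup>+x. ennreal (A x) * (\<integral>\<^sup>+y. ennreal (A y) * ennreal (\<kappa> x y) \<partial>P) \<partial>P)"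
  proof (rule nn_integral_cong)
    fix x assume "x \<in> space P"
    then have [measurable]: "(\<lambda>y. \<kappa> x y) \<in> borel_measurable P" by (rule kernel_section)
    show "(\<integral>\<^sup>+y. ennreal (A x * A y * \<kappa> x y) \<partial>P) = ennreal (A x) * (\<integral>\<^sup>+y. ennreal (A y) * ennreal (\<kappa> x y) \<partial>P)"
      using A0 kernel_nonneg by (subst nn_integral_cmult[symmetric]) (simp_all add: ennreal_mult mult.assoc)
  qed
  \<comment> \<open>First \<open>A y\<close> is replaced with \<open>x\<close> fixed, where the
    kernel section is the test function; then \<open>A x\<close>, where the inner integral is.
    Nonnegative integrals make these steps legitimate before finiteness is known.\<close>
  also have "\<dots> \<le> (\<integral>\<^sup>+x. ennreal (A x) * (\<integral>\<^sup>+y. ennreal (a y) * ennreal (\<kappa> x y) \<partial>P) \<partial>P)"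
  proof (rule nn_integral_mono)
    fix x assume "x \<in> space P"
    then have [measurable]: "(\<lambda>y. \<kappa> x y) \<in> borel_measurable C" by (rule kernel_section_C)
    show "ennreal (A x) * (\<integral>\<^sup>+y. ennreal (A y) * ennreal (\<kappa> x y) \<partial>P)
        \<le> ennreal (A x) * (\<integral>\<^sup>+y. ennreal (a y) * ennreal (\<kappa> x y) \<partial>P)"
      by (intro mult_left_mono swap_var) auto
  qed
  also have "\<dots> \<le> (\<integral>\<^sup>+x. ennreal (a x) * (\<integral>\<^sup>+y. ennreal (a y) * ennreal (\<kappa> x y) \<partial>P) \<partial>P)"
  proof (rule swap_var)
    show "(\<lambda>x. \<integral>\<^sup>+y. ennreal (a y) * ennreal (\<kappa> x y) \<partial>P) \<in> borel_measurable C"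
      by (rule P.borel_measurable_nn_integral) (simp add: case_prod_beta')
  qed
  also have "\<dots> = (\<integral>\<^sup>+x. \<integral>\<^sup>+y. ennreal (a x * a y * \<kappa> x y) \<partial>P \<partial>P)"
  proof (rule nn_integral_cong)
    fix x assume "x \<in> space P"
    then have [measurable]: "(\<lambda>y. \<kappa> x y) \<in> borel_measurable P" by (rule kernel_section)
    show "ennreal (a x) * (\<integral>\<^sup>+y. ennreal (a y) * ennreal (\<kappa> x y) \<partial>P) = (\<integral>\<^sup>+y. ennreal (a x * a y * \<kappa> x y) \<partial>P)"
      using a0 kernel_nonneg by (subst nn_integral_cmult[symmetric]) (simp_all add: ennreal_mult mult.assoc)
  qed
  also have "\<dots> = (\<integral>\<^sup>+p. ennreal (a (fst p) * a (snd p) * \<kappa> (fst p) (snd p)) \<partial>(P \<Otimes>\<^sub>M P))"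
    by (subst P.nn_integral_fst[symmetric]) simp_all
  also have "\<dots> = ennreal (\<integral>p. a (fst p) * a (snd p) * \<kappa> (fst p) (snd p) \<partial>(P \<Otimes>\<^sub>M P))"
    using a0 kernel_nonneg by (intro nn_integral_eq_integral int_aa) auto
  finally have "(\<integral>\<^sup>+p. ennreal ((g p)\<^sup>2) \<partial>(P \<Otimes>\<^sub>M P))
      \<le> ennreal B * ennreal (\<integral>p. a (fst p) * a (snd p) * \<kappa> (fst p) (snd p) \<partial>(P \<Otimes>\<^sub>M P))"
    by (simp add: mult_left_mono)
  also have "\<dots> \<le> ennreal b"
    using aa_le B_nonneg a0 kernel_nonneg
    by (subst ennreal_mult[symmetric]) (auto intro!: ennreal_leI Bochner_Integration.integral_nonneg)
  finally have *: "(\<integral>\<^sup>+p. ennreal ((g p)\<^sup>2) \<partial>(P \<Otimes>\<^sub>M P)) \<le> ennreal b" .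
  show "integrable (P \<Otimes>\<^sub>M P) (\<lambda>p. (g p)\<^sup>2)"
  proof (rule integrableI_bounded)
    show "(\<integral>\<^sup>+p. ennreal (norm ((g p)\<^sup>2)) \<partial>(P \<Otimes>\<^sub>M P)) < \<infinity>"
      using * by (simp add: le_less_trans[OF _ ennreal_less_top])
  qed measurable
  show "(\<integral>p. (g p)\<^sup>2 \<partial>(P \<Otimes>\<^sub>M P)) \<le> b"
    by (rule integral_real_bounded[OF b0 *])
qed

end

section \<open>Fourier inversion of the smoothing kernel\<close>

locale fourier_kernel =
  fixes Kt :: "real \<Rightarrow> real"
  assumes Kt_meas[measurable]: "Kt \<in> borel_measurable borel"
    and Kt_nonneg: "0 \<le> Kt x"
    and Kt_integral: "has_bochner_integral lborel Kt 1"
    and fourier_pos: "fourier Kt t \<in> \<real> \<and> 0 < Re (fourier Kt t)"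
    and fourier_integrable: "integrable lborel (fourier Kt)"
begin

definition ft where "ft t = Re (fourier Kt t)"

lemma fourier_eq_ft: "fourier Kt t = complex_of_real (ft t)"
  using fourier_pos[of t] by (simp add: ft_def complex_is_Real_iff complex_eq_iff)

lemma ft_pos: "0 < ft t"
  using fourier_pos[of t] by (simp add: ft_def)

lemma ft_integrable: "integrable lborel ft"
  unfolding ft_def[abs_def] using fourier_integrable by simp

lemma ft_meas[measurable]: "ft \<in> borel_measurable borel"
  using ft_integrable by simp

definition law where "law = density lborel (\<lambda>x. ennreal (Kt x))"

lemma real_distribution_law: "real_distribution law"
proof -
  interpret prob_space law
  proof (rule prob_spaceI)
    have "(\<integral>\<^sup>+x. ennreal (Kt x) \<partial>lborel) = ennreal 1"
      using Kt_integral Kt_nonneg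
      by (subst nn_integral_eq_integral) (auto simp: has_bochner_integral_iff)
    then show "emeasure law (space law) = 1"
      by (simp add: law_def emeasure_density)
  qed
  show ?thesis by unfold_locales (simp_all add: law_def)
qed

sublocale law: real_distribution law by (rule real_distribution_law)

text \<open>The transform at -t is the complex conjugate of the transform at t, and it is
  real.\<close>

lemma ft_uminus: "ft (- t) = ft t"
proof -
  have "cnj (fourier Kt t) = (\<integral>x. cnj (cis (- (t \<bullet> x)) * complex_of_real (Kt x)) \<partial>lborel)"
    unfolding fourier_def by (rule Bochner_Integration.integral_cnj[symmetric])
  also have "\<dots> = fourier Kt (- t)"
    unfolding fourier_def by (intro Bochner_Integration.integral_cong refl) (simp add: cis_cnj)
  finally have "fourier Kt (- t) = cnj (fourier Kt t)" by simp
  then show ?thesis by (simp add: ft_def)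
qed

lemma char_law: "char law t = complex_of_real (ft t)"
proof -
  have "char law t = (\<integral>x. Kt x *\<^sub>R iexp (t * x) \<partial>lborel)"
    unfolding char_def law_def by (rule integral_density) (simp_all add: Kt_nonneg)
  also have "\<dots> = fourier Kt (- t)"
    unfolding fourier_def by (intro Bochner_Integration.integral_cong refl)
      (simp add: cis_conv_exp scaleR_conv_of_real mult_ac)
  finally show ?thesis by (simp add: fourier_eq_ft ft_uminus)
qed

lemma ft_le_1: "ft t \<le> 1"
  using law.cmod_char_le_1[of t] ft_pos[of t] by (simp add: char_law)

lemma ft_0: "ft 0 = 1"
  using law.char_zero char_law[of 0] by simp

lemma isCont_ft: "isCont ft t"
proof -
  have "isCont (\<lambda>t. Re (char law t)) t" 
    using law.isCont_char[of t] unfolding isCont_def by (rule tendsto_Re)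
  then show ?thesis by (simp add: char_law)
qed

text \<open>Fourier inversion of \<open>ft\<close>, in cosine form because \<open>ft\<close> is
  even. It is the continuous representative of the kernel: at every point it is a mixture of cosines
  with positive weights, whereas \<open>Kt\<close> is so only up to a null set.\<close>

definition Kc where "Kc x = (1 / (2 * pi)) * (\<integral>t. cos (t * x) * ft t \<partial>lborel)"

lemma integrable_trig_ft:
  "integrable lborel (\<lambda>t. cos (t * x) * ft t)" "integrable lborel (\<lambda>t. sin (t * x) * ft t)"
  "integrable lborel (\<lambda>t. iexp (t * x) * complex_of_real (ft t))"
proof -
  show "integrable lborel (\<lambda>t. cos (t * x) * ft t)"
    by (rule Bochner_Integration.integrable_bound[OF ft_integrable])
      (auto simp: abs_mult intro!: mult_left_le_one_le)
  show "integrable lborel (\<lambda>t. sin (t * x) * ft t)"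
    by (rule Bochner_Integration.integrable_bound[OF ft_integrable])
      (auto simp: abs_mult intro!: mult_left_le_one_le)
  show "integrable lborel (\<lambda>t. iexp (t * x) * complex_of_real (ft t))"
    by (rule Bochner_Integration.integrable_bound[OF ft_integrable])
      (auto simp: norm_mult)
qed

lemma Kc_complex: "complex_of_real (Kc x) = (1 / (2 * pi)) * (\<integral>t. iexp (t * x) * complex_of_real (ft t) \<partial>lborel)"
proof -
  \<comment> \<open>The sine part is odd, as \<open>ft\<close> is even, and drops out.\<close>
  have "(\<integral>t. sin (t * x) * ft t \<partial>lborel) = (\<integral>t. sin ((- t) * x) * ft (- t) \<partial>lborel)"
    using lborel_integral_real_affine[of "-1" "\<lambda>t. sin (t * x) * ft t" 0] by simp
  also have "\<dots> = - (\<integral>t. sin (t * x) * ft t \<partial>lborel)" by (simp add: ft_uminus)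
  finally have sin0: "(\<integral>t. sin (t * x) * ft t \<partial>lborel) = 0" by simp
  have e: "iexp (t * x) * complex_of_real (ft t)
      = complex_of_real (cos (t * x) * ft t) + \<i> * complex_of_real (sin (t * x) * ft t)" for t
    by (simp add: complex_eq_iff Re_exp Im_exp)
  have "(\<integral>t. iexp (t * x) * complex_of_real (ft t) \<partial>lborel)
      = complex_of_real (\<integral>t. cos (t * x) * ft t \<partial>lborel) + \<i> * complex_of_real (\<integral>t. sin (t * x) * ft t \<partial>lborel)"
  proof -
    have c: "integrable lborel (\<lambda>t. complex_of_real (cos (t * x) * ft t))"
      and s: "integrable lborel (\<lambda>t. complex_of_real (sin (t * x) * ft t))"
      by (rule integrable_of_real[OF integrable_trig_ft(1)], rule integrable_of_real[OF integrable_trig_ft(2)])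
    show ?thesis
      unfolding e Bochner_Integration.integral_add[OF c integrable_mult_right[OF s]] integral_mult_right_zero
        integral_complex_of_real ..
  qed
  then show ?thesis by (simp add: Kc_def sin0)
qed

lemma isCont_Kc: "isCont Kc x"
  unfolding continuous_at_sequentially
proof safe
  fix X assume X: "X \<longlonglongrightarrow> x"
  show "(Kc \<circ> X) \<longlonglongrightarrow> Kc x"
    unfolding comp_def Kc_def
  proof (rule tendsto_mult_left)
    show "(\<lambda>i. \<integral>t. cos (t * X i) * ft t \<partial>lborel) \<longlonglongrightarrow> (\<integral>t. cos (t * x) * ft t \<partial>lborel)"
    proof (rule integral_dominated_convergence[where w = ft])
      show "AE t in lborel. (\<lambda>i. cos (t * X i) * ft t) \<longlonglongrightarrow> cos (t * x) * ft t"
        by (intro AE_I2 tendsto_intros X)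
      show "AE t in lborel. norm (cos (t * X i) * ft t) \<le> ft t" for i
        using ft_pos by (intro AE_I2) (auto simp: abs_mult less_imp_le intro!: mult_left_le_one_le)
    qed (use ft_integrable in measurable)
  qed
qed

lemma Kc_meas[measurable]: "Kc \<in> borel_measurable borel"
  using isCont_Kc by (intro borel_measurable_continuous_onI continuous_at_imp_continuous_on) auto

text \<open>Levy's inversion formula asks that the endpoints of the interval carry no mass.\<close>

lemma law_singleton: "measure law {a} = 0"
proof -
  have "emeasure law {a} = (\<integral>\<^sup>+x. ennreal (Kt x) * indicator {a} x \<partial>lborel)"
    unfolding law_def by (rule emeasure_density) auto
  also have "\<dots> = 0"
    using AE_lborel_singleton[of a] by (subst nn_integral_0_iff_AE) (auto elim!: eventually_mono)
  finally show ?thesis by (simp add: measure_def)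
qed

lemma integral_iexp_Ioc:
  assumes "a \<le> b" "t \<noteq> 0"
  shows "(\<integral>x. indicator {a<..b} x *\<^sub>R iexp (- (t * x)) \<partial>lborel)
    = (iexp (- (t * a)) - iexp (- (t * b))) / (\<i> * t)"
proof -
  have "(LBINT x=a..b. iexp (- (t * x))) = iexp (- (t * b)) / (- (\<i> * t)) - iexp (- (t * a)) / (- (\<i> * t))"
  proof (rule interval_integral_FTC_finite)
    show "continuous_on {min a b..max a b} (\<lambda>x. iexp (- (t * x)))" by (intro continuous_intros)
    fix x
    have "((\<lambda>z. exp (\<i> * (- (t * z))) / (- (\<i> * t))) has_field_derivative exp (\<i> * (- (t * z)))) (at z)" for z :: complex
      using assms by (auto intro!: derivative_eq_intros simp: field_simps)
    from has_vector_derivative_real_field[OF this, of "of_real x"]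
    show "((\<lambda>x. iexp (- (t * x)) / (- (\<i> * t))) has_vector_derivative iexp (- (t * x))) (at x within {min a b..max a b})"
      by (simp add: has_vector_derivative_at_within o_def)
  qed
  also have "(LBINT x=a..b. iexp (- (t * x))) = (\<integral>x. indicator {a<..b} x *\<^sub>R iexp (- (t * x)) \<partial>lborel)"
    using assms interval_integral_Ioc[of a b] by (simp add: set_lebesgue_integral_def)
  finally show ?thesis using assms by (simp add: field_simps)
qed

text \<open>Levy's inversion formula gives the measure of an interval as a limit of truncated
  integrals. Since \<open>ft\<close> is integrable and the factor \<open>F\<close> is bounded by b -
  a, dominated convergence removes the truncation, and Fubini's theorem then pulls out the integral
  over the interval.\<close>

lemma law_Ioc:
  assumes ab: "a \<le> b"
  shows "measure law {a<..b} = (\<integral>x. indicator {a<..b} x * Kc x \<partial>lborel)"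
proof -
  \<comment> \<open>Division by zero makes \<open>F 0\<close> equal to 0 instead of the limit b - a;
    a single frequency does not affect the integral.\<close>
  define F where "F t = (iexp (- (t * a)) - iexp (- (t * b))) / (\<i> * complex_of_real t)" for t :: real
  have [measurable]: "F \<in> borel_measurable borel" unfolding F_def by measurable
  have F_bound: "cmod (F t) \<le> b - a" for t
  proof (cases "t = 0")
    case True
    then show ?thesis using ab by (simp add: F_def)
  next
    case False
    then show ?thesis
      using Levy_Inversion_aux2[of "- b" "- a" t] ab by (simp add: F_def)
  qed
  have int_F: "integrable lborel (\<lambda>t. (b - a) * ft t)" using ft_integrable by simp
  have "(\<lambda>T::nat. (\<integral>t. indicator {- real T<..<real T} t *\<^sub>R (F t * char law t) \<partial>lborel))
      \<longlonglongrightarrow> (\<integral>t. F t * char law t \<partial>lborel)"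
  proof (rule integral_dominated_convergence[where w = "\<lambda>t. (b - a) * ft t"])
    show "AE t in lborel. (\<lambda>T. indicator {- real T<..<real T} t *\<^sub>R (F t * char law t)) \<longlonglongrightarrow> F t * char law t"
    proof (rule AE_I2)
      fix t :: real
      obtain N :: nat where N: "\<bar>t\<bar> < real N" using reals_Archimedean2 by blast
      have "\<forall>\<^sub>F T in sequentially. indicator {- real T<..<real T} t *\<^sub>R (F t * char law t) = F t * char law t"
        using eventually_ge_at_top[of N]
      proof eventually_elim
        case (elim T)
        then have "\<bar>t\<bar> < real T" using N by simp
        then show ?case by (simp add: abs_less_iff indicator_def)
      qed
      then show "(\<lambda>T. indicator {- real T<..<real T} t *\<^sub>R (F t * char law t)) \<longlonglongrightarrow> F t * char law t"
        by (rule tendsto_eventually)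
    qed
    show "AE t in lborel. norm (indicator {- real T<..<real T} t *\<^sub>R (F t * char law t)) \<le> (b - a) * ft t" for T
      using F_bound ft_pos ab
      by (intro AE_I2) (auto simp: char_law norm_mult indicator_def less_imp_le intro!: mult_right_mono)
  qed (use int_F in \<open>simp_all add: char_law\<close>)
  moreover have "(\<integral>t. indicator {- real T<..<real T} t *\<^sub>R (F t * char law t) \<partial>lborel)
      = (CLBINT t=- real T..real T. F t * char law t)" for T :: nat
    using interval_lebesgue_integral_def
    by (simp add: interval_lebesgue_integral_def set_lebesgue_integral_def einterval_def
        greaterThanLessThan_def greaterThan_def lessThan_def Int_def)
  ultimately have "(\<lambda>T::nat. 1 / (2 * pi) * (CLBINT t=- real T..real T. F t * char law t))
      \<longlonglongrightarrow> 1 / (2 * pi) * (\<integral>t. F t * char law t \<partial>lborel)"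
    by (intro tendsto_intros) simp
  moreover have "(\<lambda>T::nat. 1 / (2 * pi) * (CLBINT t=- real T..real T. F t * char law t))
      \<longlonglongrightarrow> measure law {a<..b}"
    using law.Levy_Inversion[OF ab law_singleton law_singleton] by (simp add: F_def)
  ultimately have "complex_of_real (measure law {a<..b}) = 1 / (2 * pi) * (\<integral>t. F t * char law t \<partial>lborel)"
    using LIMSEQ_unique by blast
  also have "(\<integral>t. F t * char law t \<partial>lborel)
      = (\<integral>t. (\<integral>x. indicator {a<..b} x *\<^sub>R iexp (- (t * x)) * ft t \<partial>lborel) \<partial>lborel)"
  proof (rule integral_cong_AE)
    show "AE t in lborel. F t * char law t = (\<integral>x. indicator {a<..b} x *\<^sub>R iexp (- (t * x)) * ft t \<partial>lborel)"
      using AE_lborel_singleton[of "0::real"]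
    proof eventually_elim
      case (elim t)
      then have "F t * char law t
          = (\<integral>x. indicator {a<..b} x *\<^sub>R iexp (- (t * x)) \<partial>lborel) * complex_of_real (ft t)"
        by (simp only: F_def integral_iexp_Ioc[OF ab] char_law not_False_eq_True)
      then show ?case by (simp only: integral_mult_left_zero)
    qed
  qed (simp_all add: char_law)
  also have "\<dots> = (\<integral>x. (\<integral>t. indicator {a<..b} x *\<^sub>R iexp (- (t * x)) * ft t \<partial>lborel) \<partial>lborel)"
  proof (rule lborel_pair.Fubini_integral)
    define f where "f p = indicator {a<..b} (fst p) *\<^sub>R (iexp (- (snd p * fst p)) * complex_of_real (ft (snd p)))"
      for p :: "real \<times> real"
    have [measurable]: "f \<in> borel_measurable (lborel \<Otimes>\<^sub>M lborel)" unfolding f_def by measurable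
    have "integrable (lborel \<Otimes>\<^sub>M lborel) f"
    proof (rule lborel_pair.Fubini_integrable)
      have "(\<integral>t. norm (f (x, t)) \<partial>lborel) = indicator {a<..b} x * (\<integral>t. ft t \<partial>lborel)" for x
        using ft_pos by (simp add: f_def norm_mult less_imp_le)
      then show "integrable lborel (\<lambda>x. \<integral>t. norm (f (x, t)) \<partial>lborel)"
        by (simp only:) (intro integrable_mult_left integrable_real_indicator, use ab in auto)
      have "integrable lborel (\<lambda>t. f (x, t))" for x
        unfolding f_def using integrable_trig_ft(3)[of "- x"] by simp
      then show "AE x in lborel. integrable lborel (\<lambda>t. f (x, t))" by simp
    qed measurable
    then show "integrable (lborel \<Otimes>\<^sub>M lborel) (\<lambda>(x, t). indicator {a<..b} x *\<^sub>R iexp (- (t * x)) * complex_of_real (ft t))"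
      by (simp add: case_prod_beta' f_def[abs_def])
  qed
  also have "(\<integral>x. (\<integral>t. indicator {a<..b} x *\<^sub>R iexp (- (t * x)) * ft t \<partial>lborel) \<partial>lborel)
      = (\<integral>x. complex_of_real (2 * pi * (indicator {a<..b} x * Kc x)) \<partial>lborel)"
  proof (rule Bochner_Integration.integral_cong[OF refl])
    fix x :: real
    have "(\<integral>t. iexp (- (t * x)) * complex_of_real (ft t) \<partial>lborel) = (\<integral>t. iexp (t * x) * complex_of_real (ft t) \<partial>lborel)"
      using lborel_integral_real_affine[of "-1" "\<lambda>t. iexp (- (t * x)) * complex_of_real (ft t)" 0]
      by (simp add: ft_uminus)
    then show "(\<integral>t. indicator {a<..b} x *\<^sub>R iexp (- (t * x)) * complex_of_real (ft t) \<partial>lborel)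
      = complex_of_real (2 * pi * (indicator {a<..b} x * Kc x))"
      by (cases "x \<in> {a<..b}") (simp_all add: Kc_complex)
  qed
  also have "\<dots> = complex_of_real (2 * pi * (\<integral>x. indicator {a<..b} x * Kc x \<partial>lborel))"
    by (subst integral_complex_of_real) simp
  finally have "complex_of_real (measure law {a<..b}) = complex_of_real (\<integral>x. indicator {a<..b} x * Kc x \<partial>lborel)"
    by simp
  then show ?thesis by (simp only: of_real_eq_iff)
qed

lemma integrable_Kc_Ioc: "integrable lborel (\<lambda>x. indicator {a<..b} x * Kc x)"
proof -
  have "continuous_on {a..b} Kc" using isCont_Kc by (intro continuous_at_imp_continuous_on) auto
  then have "set_integrable lborel {a..b} Kc" by (rule borel_integrable_atLeastAtMost')
  then have "set_integrable lborel {a<..b} Kc" by (rule set_integrable_subset) auto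
  then show ?thesis by (simp add: set_integrable_def)
qed

text \<open>By continuity a negative value would persist on an interval, whose probability under
  \<open>law\<close> would then be negative.\<close>

lemma Kc_nonneg: "0 \<le> Kc x"
proof (rule ccontr)
  assume neg: "\<not> 0 \<le> Kc x"
  then have "\<forall>\<^sub>F y in at x. Kc y < Kc x / 2"
    using isCont_Kc[of x] by (intro order_tendstoD(2)[of _ "Kc x"]) (auto simp: isCont_def)
  then obtain d where d: "d > 0" "\<And>y. y \<noteq> x \<Longrightarrow> dist y x < d \<Longrightarrow> Kc y < Kc x / 2"
    by (auto simp: eventually_at)
  define b where "b = x + d / 2"
  have le: "Kc y \<le> Kc x / 2" if "y \<in> {x<..b}" for y
    using d(2)[of y] that d(1) by (auto simp: b_def dist_real_def)
  have "0 \<le> measure law {x<..b}" by simp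
  also have "\<dots> = (\<integral>y. indicator {x<..b} y * Kc y \<partial>lborel)"
    using d(1) by (intro law_Ioc) (simp add: b_def)
  also have "\<dots> \<le> (\<integral>y. indicator {x<..b} y * (Kc x / 2) \<partial>lborel)"
  proof (rule integral_mono[OF integrable_Kc_Ioc])
    show "integrable lborel (\<lambda>y. indicator {x<..b} y * (Kc x / 2))"
      by (intro integrable_mult_left integrable_real_indicator) (use d(1) in \<open>auto simp: b_def\<close>)
  qed (use le in \<open>auto simp: indicator_def\<close>)
  also have "\<dots> = (d / 2) * (Kc x / 2)"
    using d(1) by (simp add: b_def)
  also have "\<dots> < 0" using neg d(1) by (simp add: mult_pos_neg)
  finally show False by simp
qed

text \<open>Both functions are nonnegative densities, and by \<open>law_Ioc\<close> their measures
  agree on bounded half-open intervals, hence on rays, hence everywhere; densities are unique up to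
  null sets.\<close>

lemma AE_Kt_eq_Kc: "AE x in lborel. Kt x = Kc x"
proof -
  define N where "N = density lborel (\<lambda>x. ennreal (Kc x))"
  have eq: "emeasure N {a<..b} = emeasure law {a<..b}" if "a \<le> b" for a b
  proof -
    have "emeasure N {a<..b} = (\<integral>\<^sup>+x. ennreal (indicator {a<..b} x * Kc x) \<partial>lborel)"
      unfolding N_def by (subst emeasure_density) (auto intro!: nn_integral_cong simp: indicator_def)
    also have "\<dots> = ennreal (\<integral>x. indicator {a<..b} x * Kc x \<partial>lborel)"
      using Kc_nonneg by (intro nn_integral_eq_integral integrable_Kc_Ioc) auto
    also have "\<dots> = emeasure law {a<..b}"
      by (simp add: law_Ioc[OF that, symmetric] law.emeasure_eq_measure)
    finally show ?thesis .
  qed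
  have "law = N"
  proof (rule measure_eqI_lessThan)
    fix x :: real
    have U: "{x<..} = (\<Union>n. {x<..x + real n})"
    proof safe
      fix y assume "y > x"
      then obtain n where "y - x < real n" using reals_Archimedean2 by blast
      then show "y \<in> (\<Union>n. {x<..x + real n})" using \<open>y > x\<close> by (intro UN_I[of n]) auto
    qed auto
    have inc: "incseq (\<lambda>n. {x<..x + real n})" by (rule incseq_SucI) auto
    have 1: "emeasure law {x<..} = (SUP n. emeasure law {x<..x + real n})"
      by (subst U, rule SUP_emeasure_incseq[OF _ inc, symmetric]) auto
    have 2: "emeasure N {x<..} = (SUP n. emeasure N {x<..x + real n})"
      by (subst U, rule SUP_emeasure_incseq[OF _ inc, symmetric]) (auto simp: N_def)
    have "emeasure N {x<..x + real n} = emeasure law {x<..x + real n}" for n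
      by (rule eq) simp
    then show "emeasure law {x<..} = emeasure N {x<..}" unfolding 1 2 by simp
    show "emeasure law {x<..} < \<infinity>" by (simp add: law.emeasure_eq_measure)
  qed (simp_all add: N_def law_def)
  then have "AE x in lborel. ennreal (Kt x) = ennreal (Kc x)"
    unfolding law_def N_def by (subst (asm) sigma_finite_measure.density_unique_iff[OF sigma_finite_lborel]) auto
  then show ?thesis using Kt_nonneg Kc_nonneg by simp
qed

end

section \<open>Product kernels and Fourier inversion on \<open>real ^ 'q\<close>\<close>

lemma prod_Basis_vec: "(\<Prod>b\<in>(Basis :: (real ^ 'q) set). F b) = (\<Prod>i\<in>UNIV. F (axis i 1))"
proof -
  have "(Basis :: (real ^ 'q) set) = range (\<lambda>i. axis i 1)" by (auto simp: Basis_vec_def)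
  moreover have "inj (\<lambda>i :: 'q. axis i (1 :: real))" by (simp add: inj_on_def axis_eq_axis)
  ultimately show ?thesis using prod.reindex[of "\<lambda>i :: 'q. axis i (1 :: real)" UNIV F] by (simp add: comp_def)
qed

lemma vec_nth_borel_measurable: "(\<lambda>z :: real ^ 'q. z $ i) \<in> borel_measurable borel"
  by (intro borel_measurable_continuous_onI continuous_intros)

lemma integral_prod_vec:
  fixes f :: "'q::finite \<Rightarrow> real \<Rightarrow> complex"
  assumes f: "\<And>i. integrable lborel (f i)"
  shows "integrable lborel (\<lambda>z :: real ^ 'q. \<Prod>i\<in>UNIV. f i (z $ i))"
    and "(\<integral>z. (\<Prod>i\<in>UNIV. f i (z $ i)) \<partial>(lborel :: (real ^ 'q) measure)) = (\<Prod>i\<in>UNIV. integral\<^sup>L lborel (f i))"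
proof -
  interpret product_sigma_finite "\<lambda>_ :: real ^ 'q. lborel :: real measure" ..
  \<comment> \<open>Lebesgue measure on vectors is the image of a product indexed by basis vectors,
    so the factors are reindexed from coordinates to \<open>axis i 1\<close>; injectivity of
    \<open>axis\<close> makes the choice unique.\<close>
  define F where "F b = f (THE i. b = axis i 1)" for b :: "real ^ 'q"
  have F: "F (axis i 1) = f i" for i by (simp add: F_def axis_eq_axis)
  have intF: "integrable lborel (F b)" for b unfolding F_def by (rule f)
  define T where "T = (\<lambda>f. \<Sum>b\<in>(Basis :: (real ^ 'q) set). f b *\<^sub>R b)"
  have T[measurable]: "T \<in> measurable (\<Pi>\<^sub>M b\<in>Basis. lborel) borel" unfolding T_def by measurable
  have m[measurable]: "(\<lambda>z :: real ^ 'q. \<Prod>i\<in>UNIV. f i (z $ i)) \<in> borel_measurable borel"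
  proof (rule borel_measurable_prod)
    fix i show "(\<lambda>z :: real ^ 'q. f i (z $ i)) \<in> borel_measurable borel"
    proof (rule measurable_compose[OF vec_nth_borel_measurable])
      show "f i \<in> borel_measurable borel" using borel_measurable_integrable[OF f[of i]] by simp
    qed
  qed
  have e: "(\<Prod>i\<in>UNIV. f i (T x $ i)) = (\<Prod>b\<in>Basis. F b (x b))" for x
  proof -
    have "T x $ i = x (axis i 1)" for i
    proof -
      have "T x $ i = T x \<bullet> axis i 1" by (simp add: inner_axis)
      also have "\<dots> = x (axis i 1)"
        unfolding T_def by (subst inner_sum_left) (simp add: inner_Basis if_distrib cong: if_cong)
      finally show ?thesis .
    qed
    then show ?thesis by (simp add: prod_Basis_vec F)
  qed
  have d: "(lborel :: (real ^ 'q) measure) = distr (\<Pi>\<^sub>M b\<in>Basis. lborel) borel T"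
    unfolding T_def by (rule lborel_eq)
  show "integrable lborel (\<lambda>z :: real ^ 'q. \<Prod>i\<in>UNIV. f i (z $ i))"
    unfolding d using product_integrable_prod[of Basis F] intF
    by (subst integrable_distr_eq) (simp_all add: e)
  have "(\<integral>z. (\<Prod>i\<in>UNIV. f i (z $ i)) \<partial>(lborel :: (real ^ 'q) measure))
      = (\<integral>x. (\<Prod>b\<in>Basis. F b (x b)) \<partial>(\<Pi>\<^sub>M b\<in>Basis. lborel))"
    unfolding d by (subst integral_distr) (simp_all add: e)
  also have "\<dots> = (\<Prod>b\<in>Basis. integral\<^sup>L lborel (F b))"
    by (rule product_integral_prod) (simp_all add: intF)
  finally show "(\<integral>z. (\<Prod>i\<in>UNIV. f i (z $ i)) \<partial>(lborel :: (real ^ 'q) measure)) = (\<Prod>i\<in>UNIV. integral\<^sup>L lborel (f i))"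
    by (simp add: prod_Basis_vec F)
qed

text \<open>The cylinder over a null set is null: the integral of its indicator is a product of
  one-dimensional integrals, one of which vanishes.\<close>

lemma AE_vec_nth:
  assumes "AE x in lborel. Q (x :: real)"
  shows "AE z in (lborel :: (real ^ 'q::finite) measure). Q (z $ i)"
proof -
  obtain N where N: "{x \<in> space lborel. \<not> Q x} \<subseteq> N" "emeasure lborel N = 0" "N \<in> sets lborel"
    using AE_E[OF assms] .
  then have [measurable]: "N \<in> sets borel" by simp
  define F where "F b x = (if b = axis i 1 then indicator N x else (1 :: ennreal))" for b :: "real ^ 'q" and x :: real
  have [measurable]: "F b \<in> borel_measurable borel" for b
    by (cases "b = axis i 1") (simp_all add: F_def[abs_def])
  have "(\<integral>\<^sup>+z. indicator N (z $ i) \<partial>(lborel :: (real ^ 'q) measure)) = (\<integral>\<^sup>+z. (\<Prod>b\<in>Basis. F b (z \<bullet> b)) \<partial>lborel)"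
  proof (rule nn_integral_cong)
    fix z :: "real ^ 'q"
    have "(\<Prod>b\<in>Basis. F b (z \<bullet> b)) = (\<Prod>j\<in>UNIV. if j = i then indicator N (z $ i) else 1)"
      unfolding prod_Basis_vec by (intro prod.cong refl) (auto simp: F_def inner_axis axis_eq_axis)
    then show "indicator N (z $ i) = (\<Prod>b\<in>Basis. F b (z \<bullet> b))" by simp
  qed
  also have "\<dots> = (\<Prod>b\<in>Basis. \<integral>\<^sup>+x. F b x \<partial>lborel)"
    by (rule nn_integral_lborel_prod) simp_all
  also have "\<dots> = 0"
  proof (rule prod_zero)
    show "\<exists>b\<in>Basis. (\<integral>\<^sup>+x. F b x \<partial>lborel) = 0"
      using N by (intro bexI[of _ "axis i 1"]) (simp_all add: F_def axis_in_Basis_iff)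
  qed simp
  finally have "AE z in (lborel :: (real ^ 'q) measure). indicator N (z $ i) = (0 :: ennreal)"
    by (subst (asm) nn_integral_0_iff_AE) auto
  then show ?thesis using N(1) by (auto elim!: eventually_mono simp: indicator_def)
qed

lemma lborel_scale:
  fixes F :: "'n::euclidean_space \<Rightarrow> 'b::{banach, second_countable_topology}"
  assumes F: "integrable lborel F" and h: "h > 0"
  shows "integrable lborel (\<lambda>t. F ((1 / h) *\<^sub>R t))"
    and "(\<integral>t. F ((1 / h) *\<^sub>R t) \<partial>lborel) = (h ^ DIM('n)) *\<^sub>R integral\<^sup>L lborel F"
proof -
  have d: "(lborel :: 'n measure) = density (distr lborel borel (\<lambda>x. h *\<^sub>R x)) (\<lambda>_. ennreal (h ^ DIM('n)))"
    using lborel_affine[of h "0 :: 'n"] h by (simp add: ennreal_power)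
  have [measurable]: "F \<in> borel_measurable borel" using F by simp
  have s: "integrable (distr lborel borel (\<lambda>x :: 'n. h *\<^sub>R x)) (\<lambda>t. F ((1 / h) *\<^sub>R t))"
    using F h by (subst integrable_distr_eq) simp_all
  show "integrable lborel (\<lambda>t. F ((1 / h) *\<^sub>R t))"
    using s h by (subst d, subst integrable_density) simp_all
  show "(\<integral>t. F ((1 / h) *\<^sub>R t) \<partial>lborel) = (h ^ DIM('n)) *\<^sub>R integral\<^sup>L lborel F"
    using h by (subst d, subst integral_density) (simp_all add: integral_distr)
qed

context fourier_kernel
begin

definition ftv :: "real ^ 'q \<Rightarrow> real" where "ftv t = (\<Prod>i\<in>UNIV. ft (t $ i))"

definition c0 :: "'q::finite itself \<Rightarrow> real" where "c0 _ = (1 / (2 * pi)) ^ CARD('q)"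

lemma c0_pos: "0 < c0 TYPE('q::finite)"
  by (simp add: c0_def)

lemma ftv_pos: "0 < ftv t"
  unfolding ftv_def by (intro prod_pos) (simp add: ft_pos)

lemma ftv_le_1: "ftv t \<le> 1"
  unfolding ftv_def by (intro prod_le_1) (simp add: ft_pos ft_le_1 less_imp_le)

lemma ftv_0: "ftv 0 = 1"
  by (simp add: ftv_def ft_0)

lemma isCont_ftv: "isCont ftv (t :: real ^ 'q::finite)"
proof -
  have "isCont (\<lambda>t :: real ^ 'q. ft (t $ i)) t" for i
    by (rule isCont_o2[OF _ isCont_ft]) (intro continuous_intros)
  then show ?thesis unfolding ftv_def[abs_def] isCont_def by (intro tendsto_prod) auto
qed

lemma ftv_meas[measurable]: "ftv \<in> borel_measurable borel"
  using isCont_ftv by (intro borel_measurable_continuous_onI continuous_at_imp_continuous_on) auto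

lemma ftv_integrable: "integrable lborel (ftv :: real ^ 'q::finite \<Rightarrow> real)"
proof -
  have "integrable lborel (\<lambda>t :: real ^ 'q. \<Prod>i\<in>UNIV. complex_of_real (ft (t $ i)))"
    by (rule integral_prod_vec(1)) (simp add: ft_integrable)
  then have "integrable lborel (\<lambda>t :: real ^ 'q. complex_of_real (ftv t))" by (simp add: ftv_def)
  then show ?thesis using complex_of_real_integrable_eq by blast
qed

lemma product_Kc_fourier:
  "product_kernel Kc (z :: real ^ 'q::finite) = c0 TYPE('q) * (\<integral>t. cos (t \<bullet> z) * ftv t \<partial>lborel)"
proof -
  have int: "integrable lborel (\<lambda>s. iexp (s * z $ i) * complex_of_real (ft s))" for i
    by (rule integrable_trig_ft(3))
  have e: "(\<Prod>i\<in>UNIV. iexp (t $ i * z $ i) * complex_of_real (ft (t $ i))) = cis (t \<bullet> z) * complex_of_real (ftv t)"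
    for t :: "real ^ 'q"
    by (simp add: prod.distrib ftv_def inner_vec_def cis_conv_exp exp_sum[symmetric] sum_distrib_left)
  have i: "integrable lborel (\<lambda>t :: real ^ 'q. cis (t \<bullet> z) * complex_of_real (ftv t))"
    using integral_prod_vec(1)[of "\<lambda>i s. iexp (s * z $ i) * complex_of_real (ft s)", OF int] unfolding e .
  have "complex_of_real (product_kernel Kc z)
      = (\<Prod>i\<in>UNIV. (1 / (2 * pi)) * (\<integral>s. iexp (s * z $ i) * complex_of_real (ft s) \<partial>lborel))"
    unfolding product_kernel_def of_real_prod by (intro prod.cong refl Kc_complex)
  also have "\<dots> = complex_of_real (c0 TYPE('q)) * (\<Prod>i\<in>UNIV. \<integral>s. iexp (s * z $ i) * complex_of_real (ft s) \<partial>lborel)"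
    unfolding prod.distrib by (simp add: c0_def)
  also have "(\<Prod>i\<in>UNIV. \<integral>s. iexp (s * z $ i) * complex_of_real (ft s) \<partial>lborel)
      = (\<integral>t. cis (t \<bullet> z) * complex_of_real (ftv t) \<partial>(lborel :: (real ^ 'q) measure))"
    using integral_prod_vec(2)[of "\<lambda>i s. iexp (s * z $ i) * complex_of_real (ft s)", OF int] unfolding e by (rule sym)
  finally have *: "complex_of_real (product_kernel Kc z)
    = complex_of_real (c0 TYPE('q)) * (\<integral>t. cis (t \<bullet> z) * complex_of_real (ftv t) \<partial>(lborel :: (real ^ 'q) measure))" .
  have "product_kernel Kc z = c0 TYPE('q) * Re (\<integral>t. cis (t \<bullet> z) * complex_of_real (ftv t) \<partial>(lborel :: (real ^ 'q) measure))"
    using arg_cong[OF *, of Re] by simp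
  also have "Re (\<integral>t. cis (t \<bullet> z) * complex_of_real (ftv t) \<partial>(lborel :: (real ^ 'q) measure))
      = (\<integral>t. cos (t \<bullet> z) * ftv t \<partial>(lborel :: (real ^ 'q) measure))"
    using integral_Re[OF i] by simp
  finally show ?thesis .
qed

lemma integrable_cos_ftv: "integrable lborel (\<lambda>t :: real ^ 'q::finite. cos (t \<bullet> z) * ftv t)"
  by (rule Bochner_Integration.integrable_bound[OF ftv_integrable])
    (auto simp: abs_mult ftv_pos less_imp_le intro!: mult_left_le_one_le)

lemma product_Kc_nonneg: "0 \<le> product_kernel Kc z"
  unfolding product_kernel_def by (intro prod_nonneg) (simp add: Kc_nonneg)

text \<open>This is the value of the kernel at the origin, where all cosines equal 1, and therefore
  its maximum.\<close>

definition KB :: "'q::finite itself \<Rightarrow> real" where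
  "KB _ = c0 TYPE('q) * integral\<^sup>L lborel (ftv :: real ^ 'q \<Rightarrow> real)"

lemma product_Kc_le: "product_kernel Kc (z :: real ^ 'q::finite) \<le> KB TYPE('q)"
  unfolding product_Kc_fourier KB_def
proof (intro mult_left_mono integral_mono integrable_cos_ftv ftv_integrable)
  show "cos (t \<bullet> z) * ftv t \<le> ftv t" for t using ftv_pos[of t] by simp
qed (simp add: c0_pos less_imp_le)

lemma product_Kc_meas[measurable]: "product_kernel Kc \<in> borel_measurable borel"
proof -
  have "(\<lambda>z :: real ^ 'q::finite. Kc (z $ i)) \<in> borel_measurable borel" for i
    by (rule measurable_compose[OF vec_nth_borel_measurable Kc_meas])
  then show ?thesis unfolding product_kernel_def[abs_def] by (intro borel_measurable_prod)
qed

lemma product_Kt_meas[measurable]: "product_kernel Kt \<in> borel_measurable borel"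
proof -
  have "(\<lambda>z :: real ^ 'q::finite. Kt (z $ i)) \<in> borel_measurable borel" for i
    by (rule measurable_compose[OF vec_nth_borel_measurable Kt_meas])
  then show ?thesis unfolding product_kernel_def[abs_def] by (intro borel_measurable_prod)
qed

lemma AE_product_Kt: "AE z in (lborel :: (real ^ 'q::finite) measure). product_kernel Kt z = product_kernel Kc z"
proof -
  have "AE z in (lborel :: (real ^ 'q) measure). \<forall>i\<in>UNIV. Kt (z $ i) = Kc (z $ i)"
    using AE_vec_nth[OF AE_Kt_eq_Kc] by (subst AE_finite_all) auto
  then show ?thesis by eventually_elim (simp add: product_kernel_def)
qed

lemma product_Kc_integral:
  "integrable lborel (product_kernel Kc :: real ^ 'q::finite \<Rightarrow> real)"
  "integral\<^sup>L lborel (product_kernel Kc :: real ^ 'q::finite \<Rightarrow> real) = 1"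
proof -
  have i: "integrable lborel (\<lambda>s. complex_of_real (Kt s))" "(\<integral>s. complex_of_real (Kt s) \<partial>lborel) = 1"
    using Kt_integral integral_complex_of_real[of lborel Kt] by (auto simp: has_bochner_integral_iff)
  have e: "(\<Prod>i\<in>UNIV. complex_of_real (Kt (z $ i))) = complex_of_real (product_kernel Kt z)" for z :: "real ^ 'q"
    by (simp add: product_kernel_def)
  have "integrable lborel (\<lambda>z :: real ^ 'q. complex_of_real (product_kernel Kt z))"
    using integral_prod_vec(1)[of "\<lambda>(i :: 'q) s. complex_of_real (Kt s)", OF i(1)] unfolding e .
  then have 1: "integrable lborel (product_kernel Kt :: real ^ 'q \<Rightarrow> real)"
    using complex_of_real_integrable_eq by blast
  have "(\<integral>z. complex_of_real (product_kernel Kt z) \<partial>(lborel :: (real ^ 'q) measure)) = 1"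
    using integral_prod_vec(2)[of "\<lambda>(i :: 'q) s. complex_of_real (Kt s)", OF i(1)] unfolding e i(2) by simp
  then have 2: "integral\<^sup>L lborel (product_kernel Kt :: real ^ 'q \<Rightarrow> real) = 1"
    unfolding integral_complex_of_real by simp
  show "integrable lborel (product_kernel Kc :: real ^ 'q::finite \<Rightarrow> real)"
    by (rule integrable_cong_AE_imp[OF 1 _ AE_product_Kt]) measurable
  show "integral\<^sup>L lborel (product_kernel Kc :: real ^ 'q::finite \<Rightarrow> real) = 1"
    unfolding 2[symmetric] by (rule integral_cong_AE[symmetric, OF _ _ AE_product_Kt]) measurable
qed

text \<open>Fubini's theorem moves any weighted average of the kernel into frequency space. It is
  applied with \<open>Q\<close> a single law, for row averages, and with a product law, for averages
  over two observations.\<close>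

lemma integral_product_Kc:
  fixes \<xi> :: "'y \<Rightarrow> real ^ 'q::finite"
  assumes Q: "finite_measure Q" and g: "integrable Q g" and \<xi>[measurable]: "\<xi> \<in> borel_measurable Q"
  shows "(\<integral>y. g y * product_kernel Kc (\<xi> y) \<partial>Q)
      = c0 TYPE('q) * (\<integral>t. ftv t * (\<integral>y. g y * cos (t \<bullet> \<xi> y) \<partial>Q) \<partial>lborel)"
    and "integrable lborel (\<lambda>t. ftv t * (\<integral>y. g y * cos (t \<bullet> \<xi> y) \<partial>Q))"
proof -
  interpret Q: finite_measure Q by (rule Q)
  interpret LQ: pair_sigma_finite lborel Q ..
  have [measurable]: "g \<in> borel_measurable Q" using g by simp
  define F where "F p = ftv (fst p) * (g (snd p) * cos (fst p \<bullet> \<xi> (snd p)))" for p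
  have F[measurable]: "F \<in> borel_measurable (lborel \<Otimes>\<^sub>M Q)" unfolding F_def by measurable
  have ig: "integrable Q (\<lambda>y. g y * cos (t \<bullet> \<xi> y))" for t
    by (rule Bochner_Integration.integrable_bound[OF g])
      (auto simp: abs_mult intro!: mult_right_le_one_le)
  have int: "integrable (lborel \<Otimes>\<^sub>M Q) F"
  proof (rule LQ.Fubini_integrable)
    show "AE t in lborel. integrable Q (\<lambda>y. F (t, y))" using ig by (simp add: F_def)
    show "integrable lborel (\<lambda>t. \<integral>y. norm (F (t, y)) \<partial>Q)"
    proof (rule Bochner_Integration.integrable_bound)
      show "integrable lborel (\<lambda>t :: real ^ 'q. ftv t * (\<integral>y. \<bar>g y\<bar> \<partial>Q))"
        by (intro integrable_mult_left ftv_integrable)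
      show "AE t in lborel. norm (\<integral>y. norm (F (t, y)) \<partial>Q) \<le> norm (ftv t * (\<integral>y. \<bar>g y\<bar> \<partial>Q))"
      proof (rule AE_I2)
        fix t :: "real ^ 'q"
        have "(\<integral>y. \<bar>g y * cos (t \<bullet> \<xi> y)\<bar> \<partial>Q) \<le> (\<integral>y. \<bar>g y\<bar> \<partial>Q)"
          by (intro integral_mono integrable_abs g ig) (auto simp: abs_mult intro!: mult_right_le_one_le)
        then have "ftv t * (\<integral>y. \<bar>g y * cos (t \<bullet> \<xi> y)\<bar> \<partial>Q) \<le> ftv t * (\<integral>y. \<bar>g y\<bar> \<partial>Q)"
          using ftv_pos[of t] by (intro mult_left_mono) auto
        then show "norm (\<integral>y. norm (F (t, y)) \<partial>Q) \<le> norm (ftv t * (\<integral>y. \<bar>g y\<bar> \<partial>Q))"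
          using ftv_pos[of t] by (simp add: F_def abs_mult integral_nonneg_AE)
      qed
    qed measurable
  qed measurable
  have "(\<integral>y. g y * product_kernel Kc (\<xi> y) \<partial>Q) = (\<integral>y. c0 TYPE('q) * (\<integral>t. F (t, y) \<partial>lborel) \<partial>Q)"
    unfolding product_Kc_fourier
    by (intro Bochner_Integration.integral_cong refl)
      (simp add: F_def mult_ac flip: integral_mult_right_zero)
  also have "\<dots> = c0 TYPE('q) * (\<integral>y. (\<integral>t. F (t, y) \<partial>lborel) \<partial>Q)" by simp
  also have "(\<integral>y. (\<integral>t. F (t, y) \<partial>lborel) \<partial>Q) = (\<integral>t. (\<integral>y. F (t, y) \<partial>Q) \<partial>lborel)"
    by (rule LQ.Fubini_integral) (use int in \<open>simp add: case_prod_beta'\<close>)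
  finally show "(\<integral>y. g y * product_kernel Kc (\<xi> y) \<partial>Q)
      = c0 TYPE('q) * (\<integral>t. ftv t * (\<integral>y. g y * cos (t \<bullet> \<xi> y) \<partial>Q) \<partial>lborel)"
    by (simp add: F_def)
  show "integrable lborel (\<lambda>t. ftv t * (\<integral>y. g y * cos (t \<bullet> \<xi> y) \<partial>Q))"
    using LQ.integrable_fst'[OF int] by (simp add: F_def)
qed

end

lemma lborel_reflect_scale:
  fixes F :: "'n::euclidean_space \<Rightarrow> 'b::{banach, second_countable_topology}"
  assumes F: "integrable lborel F" and h: "h > 0"
  shows "integrable lborel (\<lambda>x. F ((1 / h) *\<^sub>R (z - x)))"
    and "(\<integral>x. F ((1 / h) *\<^sub>R (z - x)) \<partial>lborel) = (h ^ DIM('n)) *\<^sub>R integral\<^sup>L lborel F"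
proof -
  have d: "(lborel :: 'n measure) = density (distr lborel borel (\<lambda>x. z - h *\<^sub>R x)) (\<lambda>_. ennreal (h ^ DIM('n)))"
    using lborel_affine[of "- h" z] h by (simp add: ennreal_power)
  have [measurable]: "F \<in> borel_measurable borel" using F by simp
  have s: "integrable (distr lborel borel (\<lambda>x. z - h *\<^sub>R x)) (\<lambda>x. F ((1 / h) *\<^sub>R (z - x)))"
    using F h by (subst integrable_distr_eq) simp_all
  show "integrable lborel (\<lambda>x. F ((1 / h) *\<^sub>R (z - x)))"
    using s h by (subst d, subst integrable_density) simp_all
  show "(\<integral>x. F ((1 / h) *\<^sub>R (z - x)) \<partial>lborel) = (h ^ DIM('n)) *\<^sub>R integral\<^sup>L lborel F"
    using h by (subst d, subst integral_density) (simp_all add: integral_distr)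
qed

context fourier_kernel
begin

text \<open>In frequency space the average is c0 times the integral of ftv(t) \<Phi>(t/h), with
  nonnegative integrand. It is enough to keep the ball of radius h \<rho> around h s0, of volume
  proportional to h^q: there \<Phi>(t/h) is at least half its value at s0, and for small h the ball
  is so close to 0 that ftv is at least 1/2.\<close>

lemma scaled_kernel_lower_bound:
  fixes \<zeta> :: "'y \<Rightarrow> real ^ 'q::finite"
  assumes Q: "finite_measure Q" and g: "integrable Q g" and \<zeta>[measurable]: "\<zeta> \<in> borel_measurable Q"
    and nonneg: "\<And>s. 0 \<le> (\<integral>y. g y * cos (s \<bullet> \<zeta> y) \<partial>Q)"
    and pos: "0 < (\<integral>y. g y * cos (s0 \<bullet> \<zeta> y) \<partial>Q)"
  obtains c h0 where "0 < c" "0 < h0"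
    "\<And>h. 0 < h \<Longrightarrow> h < h0 \<Longrightarrow> c * h ^ CARD('q) \<le> (\<integral>y. g y * product_kernel Kc ((1 / h) *\<^sub>R \<zeta> y) \<partial>Q)"
proof -
  define \<Phi> where "\<Phi> s = (\<integral>y. g y * cos (s \<bullet> \<zeta> y) \<partial>Q)" for s
  have [measurable]: "g \<in> borel_measurable Q" using g by simp
  have cont: "isCont \<Phi> s0"
    unfolding continuous_at_sequentially
  proof safe
    fix X assume X: "X \<longlonglongrightarrow> s0"
    show "(\<Phi> \<circ> X) \<longlonglongrightarrow> \<Phi> s0"
      unfolding comp_def \<Phi>_def
    proof (rule integral_dominated_convergence[where w = "\<lambda>y. \<bar>g y\<bar>"])
      show "AE y in Q. (\<lambda>i. g y * cos (X i \<bullet> \<zeta> y)) \<longlonglongrightarrow> g y * cos (s0 \<bullet> \<zeta> y)"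
        by (intro AE_I2 tendsto_intros X)
      show "AE y in Q. norm (g y * cos (X i \<bullet> \<zeta> y)) \<le> \<bar>g y\<bar>" for i
        by (intro AE_I2) (auto simp: abs_mult intro!: mult_right_le_one_le)
      show "integrable Q (\<lambda>y. \<bar>g y\<bar>)" using g by simp
    qed measurable
  qed
  have \<Phi>0: "\<Phi> s0 > 0" using pos by (simp add: \<Phi>_def)
  have "\<forall>\<^sub>F s in at s0. \<Phi> s0 / 2 < \<Phi> s"
    using cont \<Phi>0 by (intro order_tendstoD(1)[of _ "\<Phi> s0"]) (auto simp: isCont_def)
  then obtain \<rho> where \<rho>: "\<rho> > 0" "\<And>s. s \<noteq> s0 \<Longrightarrow> dist s s0 < \<rho> \<Longrightarrow> \<Phi> s0 / 2 < \<Phi> s"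
    by (auto simp: eventually_at)
  have \<Phi>_ge: "\<Phi> s0 / 2 \<le> \<Phi> s" if "dist s s0 < \<rho>" for s
    using \<rho>(2)[of s] that \<Phi>0 by (cases "s = s0") auto
  have "\<forall>\<^sub>F t in at (0 :: real ^ 'q). 1 / 2 < ftv t"
    using isCont_ftv[of "0 :: real ^ 'q"] by (intro order_tendstoD(1)[of _ 1]) (auto simp: isCont_def ftv_0)
  then obtain \<eta> where \<eta>: "\<eta> > 0" "\<And>t :: real ^ 'q. t \<noteq> 0 \<Longrightarrow> dist t 0 < \<eta> \<Longrightarrow> 1 / 2 < ftv t"
    by (auto simp: eventually_at)
  have ftv_ge: "1 / 2 \<le> ftv t" if "norm t < \<eta>" for t :: "real ^ 'q"
    using \<eta>(2)[of t] that by (cases "t = 0") (auto simp: ftv_0)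
  define V where "V = unit_ball_vol (real CARD('q)) * \<rho> ^ CARD('q)"
  have V: "V > 0" using \<rho>(1) by (simp add: V_def)
  define c where "c = c0 TYPE('q) * (\<Phi> s0 / 4 * V)"
  \<comment> \<open>Points of the ball have norm below h (|s0| + \<rho>), which must not exceed the
    radius \<eta> on which \<open>ftv\<close> is at least 1/2.\<close>
  define h0 where "h0 = \<eta> / (norm s0 + \<rho>)"
  have np: "norm s0 + \<rho> > 0" using \<rho>(1) by (simp add: add_nonneg_pos)
  show ?thesis
  proof (rule that[of c h0])
    show "0 < c" unfolding c_def using c0_pos \<Phi>0 V by (intro mult_pos_pos divide_pos_pos) auto
    show "0 < h0" unfolding h0_def using \<eta>(1) np by simp
    fix h :: real assume h: "0 < h" "h < h0"
    then have h\<eta>: "h * (norm s0 + \<rho>) < \<eta>" using np by (simp add: h0_def field_simps)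
    define \<xi> where "\<xi> y = (1 / h) *\<^sub>R \<zeta> y" for y
    have [measurable]: "\<xi> \<in> borel_measurable Q" unfolding \<xi>_def by measurable
    have e: "(\<integral>y. g y * cos (t \<bullet> \<xi> y) \<partial>Q) = \<Phi> ((1 / h) *\<^sub>R t)" for t by (simp add: \<Phi>_def \<xi>_def)
    define A where "A = ball (h *\<^sub>R s0) (h * \<rho>)"
    have A_fin: "emeasure lborel A < \<infinity>" using emeasure_bounded_finite[of A] by (simp add: A_def)
    have "(\<Phi> s0 / 4) * measure lborel A = (\<integral>t. indicator A t * (\<Phi> s0 / 4) \<partial>lborel)" by simp
    also have "\<dots> \<le> (\<integral>t. ftv t * \<Phi> ((1 / h) *\<^sub>R t) \<partial>lborel)"
    proof (rule integral_mono)
      show "integrable lborel (\<lambda>t. indicator A t * (\<Phi> s0 / 4))"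
        using A_fin by (intro integrable_mult_left integrable_real_indicator) (auto simp: A_def)
      show "integrable lborel (\<lambda>t. ftv t * \<Phi> ((1 / h) *\<^sub>R t))"
        using integral_product_Kc(2)[OF Q g, of \<xi>] unfolding e by simp
      fix t :: "real ^ 'q"
      show "indicator A t * (\<Phi> s0 / 4) \<le> ftv t * \<Phi> ((1 / h) *\<^sub>R t)"
      proof (cases "t \<in> A")
        case True
        then have d: "norm (t - h *\<^sub>R s0) < h * \<rho>" by (simp add: A_def dist_norm norm_minus_commute)
        have "norm t \<le> norm (t - h *\<^sub>R s0) + norm (h *\<^sub>R s0)"
          using norm_triangle_sub[of t "h *\<^sub>R s0"] by simp
        also have "\<dots> < h * (norm s0 + \<rho>)" using d h by (simp add: algebra_simps)
        finally have 1: "1 / 2 \<le> ftv t" using h\<eta> by (intro ftv_ge) simp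
        have "norm ((1 / h) *\<^sub>R (t - h *\<^sub>R s0)) = norm (t - h *\<^sub>R s0) / h"
          unfolding norm_scaleR using h by simp
        also have "\<dots> < \<rho>" using d h by (simp add: pos_divide_less_eq mult.commute)
        finally have "norm ((1 / h) *\<^sub>R (t - h *\<^sub>R s0)) < \<rho>" .
        then have "dist ((1 / h) *\<^sub>R t) s0 < \<rho>" using h by (simp add: dist_norm scaleR_diff_right)
        then have "\<Phi> s0 / 2 \<le> \<Phi> ((1 / h) *\<^sub>R t)" by (rule \<Phi>_ge)
        then have "1 / 2 * (\<Phi> s0 / 2) \<le> ftv t * \<Phi> ((1 / h) *\<^sub>R t)"
          using 1 \<Phi>0 by (intro mult_mono) auto
        then show ?thesis using True by simp
      next
        case False
        moreover have "0 \<le> \<Phi> ((1 / h) *\<^sub>R t)" unfolding \<Phi>_def by (rule nonneg)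
        ultimately show ?thesis using ftv_pos[of t] by simp
      qed
    qed
    also have "measure lborel A = V * h ^ CARD('q)"
      using content_ball[of "h * \<rho>" "h *\<^sub>R s0"] h(1) \<rho>(1)
      by (simp add: A_def V_def power_mult_distrib)
    finally have "c0 TYPE('q) * (\<Phi> s0 / 4 * (V * h ^ CARD('q)))
        \<le> c0 TYPE('q) * (\<integral>t. ftv t * \<Phi> ((1 / h) *\<^sub>R t) \<partial>lborel)"
      using c0_pos by (intro mult_left_mono) (auto intro: less_imp_le)
    also have "\<dots> = (\<integral>y. g y * product_kernel Kc (\<xi> y) \<partial>Q)"
      using integral_product_Kc(1)[OF Q g, of \<xi>] by (simp add: e)
    finally show "c * h ^ CARD('q) \<le> (\<integral>y. g y * product_kernel Kc ((1 / h) *\<^sub>R \<zeta> y) \<partial>Q)"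
      by (simp add: c_def \<xi>_def mult.assoc)
  qed
qed

section \<open>Averages of the kernel over rows and over pairs\<close>

lemma kernel_bounds_bounded_density:
  fixes Z :: "'y \<Rightarrow> real ^ 'q::finite"
  assumes dist: "distributed R lborel Z (\<lambda>z. ennreal (f z))"
    and f: "\<And>z. 0 \<le> f z" "\<And>z. f z \<le> Bf" and h: "0 < h"
  shows "(\<integral>y. product_kernel Kc ((1 / h) *\<^sub>R (z - Z y)) \<partial>R) \<le> Bf * h ^ CARD('q)"
proof -
  have [measurable]: "f \<in> borel_measurable borel"
    using distributed_real_measurable[OF _ dist] f by simp
  have Bf: "0 \<le> Bf" using f(1)[of 0] f(2)[of 0] by linarith
  note k = product_Kc_integral
  have i: "integrable lborel (\<lambda>x. product_kernel Kc ((1 / h) *\<^sub>R (z - x)))"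
    by (rule lborel_reflect_scale(1)[OF k(1) h])
  have "(\<integral>y. product_kernel Kc ((1 / h) *\<^sub>R (z - Z y)) \<partial>R)
      = (\<integral>x. f x * product_kernel Kc ((1 / h) *\<^sub>R (z - x)) \<partial>lborel)"
    using f by (subst distributed_integral[OF dist]) auto
  also have "\<dots> \<le> (\<integral>x. Bf * product_kernel Kc ((1 / h) *\<^sub>R (z - x)) \<partial>lborel)"
    using i f by (intro integral_mono_AE' AE_I2 mult_right_mono mult_nonneg_nonneg) (auto simp: product_Kc_nonneg Bf)
  also have "\<dots> = Bf * h ^ CARD('q)"
    using lborel_reflect_scale(2)[OF k(1) h, of z] by (simp add: k(2))
  finally show ?thesis .
qed

text \<open>The squared modulus of the characteristic function of \<open>Z\<close>, in real
  terms.\<close>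

definition char_sq :: "'y measure \<Rightarrow> ('y \<Rightarrow> real ^ 'q) \<Rightarrow> real ^ 'q \<Rightarrow> real" where
  "char_sq R Z t = (\<integral>y. cos (t \<bullet> Z y) \<partial>R)\<^sup>2 + (\<integral>y. sin (t \<bullet> Z y) \<partial>R)\<^sup>2"

context
  fixes R :: "'y measure" and Z :: "'y \<Rightarrow> real ^ 'q::finite"
  assumes R: "prob_space R" and Z[measurable]: "Z \<in> borel_measurable R"
begin

interpretation R: prob_space R by (rule R)

lemma integrable_trig_Z:
  "integrable R (\<lambda>y. cos (t \<bullet> Z y))" "integrable R (\<lambda>y. sin (t \<bullet> Z y))"
  by (rule R.integrable_const_bound[of _ 1]; simp)+

lemma char_sq_meas[measurable]: "char_sq R Z \<in> borel_measurable borel"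
proof -
  have "(\<lambda>t. \<integral>y. cos (t \<bullet> Z y) \<partial>R) \<in> borel_measurable borel"
    "(\<lambda>t. \<integral>y. sin (t \<bullet> Z y) \<partial>R) \<in> borel_measurable borel"
    by (rule R.borel_measurable_lebesgue_integral; simp add: case_prod_beta')+
  then show ?thesis unfolding char_sq_def[abs_def] by measurable
qed

text \<open>A shift by \<open>z\<close> only rotates the pair of cosine and sine averages, so the
  bound is uniform in \<open>z\<close>.\<close>

lemma cos_shift_le: "\<bar>\<integral>y. cos (t \<bullet> (z - Z y)) \<partial>R\<bar> \<le> sqrt (char_sq R Z t)"
proof -
  define a b where "a = (\<integral>y. cos (t \<bullet> Z y) \<partial>R)" and "b = (\<integral>y. sin (t \<bullet> Z y) \<partial>R)"
  have "(\<integral>y. cos (t \<bullet> (z - Z y)) \<partial>R) = cos (t \<bullet> z) * a + sin (t \<bullet> z) * b"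
    unfolding a_def b_def inner_diff_right cos_diff using integrable_trig_Z by simp
  moreover have "(cos (t \<bullet> z) * a + sin (t \<bullet> z) * b)\<^sup>2 \<le> a\<^sup>2 + b\<^sup>2"
  proof -
    define c s where "c = cos (t \<bullet> z)" and "s = sin (t \<bullet> z)"
    have "c\<^sup>2 + s\<^sup>2 = 1" by (simp add: c_def s_def)
    then have "a\<^sup>2 + b\<^sup>2 = (c\<^sup>2 + s\<^sup>2) * (a\<^sup>2 + b\<^sup>2)" by simp
    also have "\<dots> = (c * a + s * b)\<^sup>2 + (c * b - s * a)\<^sup>2" by (simp add: power2_eq_square algebra_simps)
    finally show ?thesis unfolding c_def s_def by simp
  qed
  ultimately show ?thesis
    unfolding char_sq_def a_def[symmetric] b_def[symmetric] by (simp add: real_le_rsqrt abs_le_square_iff flip: real_sqrt_abs)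
qed

context
  assumes L2: "integrable lborel (char_sq R Z)"
begin

text \<open>The row average is at most c0 times the integral of ftv(t) w(t/h), where w is the
  modulus of the characteristic function and w^2 is assumed integrable. The bound w <= l + w^2 / l
  gives one part of order l and one of order h^q / l; l = h^(q/2) balances them.\<close>

lemma kernel_row_fourier:
  assumes h: "0 < h"
  shows "(\<integral>y. product_kernel Kc ((1 / h) *\<^sub>R (z - Z y)) \<partial>R)
    \<le> (KB TYPE('q) + c0 TYPE('q) * integral\<^sup>L lborel (char_sq R Z)) * sqrt (h ^ CARD('q))"
proof -
  define l where "l = sqrt (h ^ CARD('q))"
  have l: "l > 0" "l\<^sup>2 = h ^ CARD('q)" using h by (auto simp: l_def)
  define \<xi> where "\<xi> y = (1 / h) *\<^sub>R (z - Z y)" for y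
  have [measurable]: "\<xi> \<in> borel_measurable R" unfolding \<xi>_def by measurable
  have fin: "finite_measure R" by unfold_locales
  have one: "integrable R (\<lambda>_. 1 :: real)" by simp
  have s: "integrable lborel (\<lambda>t. char_sq R Z ((1 / h) *\<^sub>R t))"
    by (rule lborel_scale(1)[OF L2 h])
  have "(\<integral>y. product_kernel Kc (\<xi> y) \<partial>R) = c0 TYPE('q) * (\<integral>t. ftv t * (\<integral>y. cos (t \<bullet> \<xi> y) \<partial>R) \<partial>lborel)"
    using integral_product_Kc(1)[OF fin one, of \<xi>] by simp
  also have "\<dots> \<le> c0 TYPE('q) * (\<integral>t. l * ftv t + char_sq R Z ((1 / h) *\<^sub>R t) / l \<partial>lborel)"
  proof (intro mult_left_mono integral_mono)
    show "integrable lborel (\<lambda>t. ftv t * (\<integral>y. cos (t \<bullet> \<xi> y) \<partial>R))"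
      using integral_product_Kc(2)[OF fin one, of \<xi>] by simp
    show "integrable lborel (\<lambda>t. l * ftv t + char_sq R Z ((1 / h) *\<^sub>R t) / l)"
      using s by (intro Bochner_Integration.integrable_add integrable_mult_right ftv_integrable integrable_divide)
    fix t :: "real ^ 'q"
    define w where "w = sqrt (char_sq R Z ((1 / h) *\<^sub>R t))"
    have w: "w \<ge> 0" "w\<^sup>2 = char_sq R Z ((1 / h) *\<^sub>R t)" by (simp_all add: w_def char_sq_def)
    have "(\<integral>y. cos (t \<bullet> \<xi> y) \<partial>R) \<le> w"
      using cos_shift_le[of "(1 / h) *\<^sub>R t" z] unfolding w_def \<xi>_def by simp
    then have "ftv t * (\<integral>y. cos (t \<bullet> \<xi> y) \<partial>R) \<le> ftv t * w"
      using ftv_pos[of t] by (intro mult_left_mono) auto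
    also have "\<dots> \<le> l * ftv t + w\<^sup>2 / l"
    proof -
      have "0 \<le> (l - w)\<^sup>2" by simp
      moreover have "0 \<le> l * w" using l w(1) by simp
      moreover have "(l - w)\<^sup>2 = l\<^sup>2 + w\<^sup>2 - 2 * (l * w)" by (simp add: power2_diff)
      ultimately have "l * w \<le> l\<^sup>2 + w\<^sup>2" by linarith
      then have "w \<le> l + w\<^sup>2 / l" using l by (simp add: field_simps power2_eq_square)
      then have "ftv t * w \<le> ftv t * (l + w\<^sup>2 / l)" using ftv_pos[of t] by (intro mult_left_mono) auto
      also have "\<dots> \<le> ftv t * l + 1 * (w\<^sup>2 / l)"
        unfolding distrib_left using ftv_le_1[of t] l by (intro add_left_mono mult_right_mono) auto
      finally show ?thesis by (simp add: mult.commute)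
    qed
    finally show "ftv t * (\<integral>y. cos (t \<bullet> \<xi> y) \<partial>R) \<le> l * ftv t + char_sq R Z ((1 / h) *\<^sub>R t) / l"
      by (simp add: w)
  qed (simp add: c0_pos less_imp_le)
  also have "(\<integral>t. l * ftv t + char_sq R Z ((1 / h) *\<^sub>R t) / l \<partial>lborel)
      = l * integral\<^sup>L lborel (ftv :: real ^ 'q \<Rightarrow> real) + (\<integral>t. char_sq R Z ((1 / h) *\<^sub>R t) \<partial>lborel) / l"
    using s ftv_integrable by (subst Bochner_Integration.integral_add) auto
  also have "(\<integral>t. char_sq R Z ((1 / h) *\<^sub>R t) \<partial>lborel) = l\<^sup>2 * integral\<^sup>L lborel (char_sq R Z)"
    using lborel_scale(2)[OF L2 h] by (simp add: l(2))
  also have "c0 TYPE('q) * (l * integral\<^sup>L lborel (ftv :: real ^ 'q \<Rightarrow> real) + l\<^sup>2 * integral\<^sup>L lborel (char_sq R Z) / l)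
      = (KB TYPE('q) + c0 TYPE('q) * integral\<^sup>L lborel (char_sq R Z)) * l"
    using l(1) by (simp add: KB_def power2_eq_square algebra_simps)
  finally show ?thesis by (simp add: \<xi>_def l_def)
qed

text \<open>Averaging over both points produces the squared modulus itself, so rescaling the
  frequency yields the full power h^q, without the square root of the row bound.\<close>

lemma kernel_pair_fourier:
  assumes h: "0 < h"
  shows "(\<integral>p. product_kernel Kc ((1 / h) *\<^sub>R (Z (fst p) - Z (snd p))) \<partial>(R \<Otimes>\<^sub>M R))
    \<le> c0 TYPE('q) * integral\<^sup>L lborel (char_sq R Z) * h ^ CARD('q)"
proof -
  interpret RR: pair_prob_space R R ..
  define \<xi> where "\<xi> p = (1 / h) *\<^sub>R (Z (fst p) - Z (snd p))" for p
  have [measurable]: "\<xi> \<in> borel_measurable (R \<Otimes>\<^sub>M R)" unfolding \<xi>_def by measurable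
  have fin: "finite_measure (R \<Otimes>\<^sub>M R)" by unfold_locales
  have one: "integrable (R \<Otimes>\<^sub>M R) (\<lambda>_. 1 :: real)" by simp
  have prod: "(\<integral>p. a (fst p) * b (snd p) \<partial>(R \<Otimes>\<^sub>M R)) = integral\<^sup>L R a * integral\<^sup>L R b"
    "integrable (R \<Otimes>\<^sub>M R) (\<lambda>p. a (fst p) * b (snd p))"
    if [measurable]: "a \<in> borel_measurable R" "b \<in> borel_measurable R"
      and bound: "\<And>x. \<bar>a x\<bar> \<le> 1" "\<And>x. \<bar>b x\<bar> \<le> 1" for a b :: "'y \<Rightarrow> real"
  proof -
    show i: "integrable (R \<Otimes>\<^sub>M R) (\<lambda>p. a (fst p) * b (snd p))"
      by (rule RR.integrable_const_bound[of _ 1])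
        (use bound in \<open>auto simp: abs_mult intro!: mult_le_one\<close>)
    show "(\<integral>p. a (fst p) * b (snd p) \<partial>(R \<Otimes>\<^sub>M R)) = integral\<^sup>L R a * integral\<^sup>L R b"
      using RR.integral_fst'[OF i] by simp
  qed
  have e: "(\<integral>p. cos (t \<bullet> \<xi> p) \<partial>(R \<Otimes>\<^sub>M R)) = char_sq R Z ((1 / h) *\<^sub>R t)" for t
  proof -
    define s where "s = (1 / h) *\<^sub>R t"
    have "(\<integral>p. cos (t \<bullet> \<xi> p) \<partial>(R \<Otimes>\<^sub>M R)) = (\<integral>p. cos (s \<bullet> Z (fst p)) * cos (s \<bullet> Z (snd p))
        + sin (s \<bullet> Z (fst p)) * sin (s \<bullet> Z (snd p)) \<partial>(R \<Otimes>\<^sub>M R))"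
      by (intro Bochner_Integration.integral_cong refl)
        (simp add: \<xi>_def s_def inner_diff_right cos_diff diff_divide_distrib)
    also have "\<dots> = (\<integral>p. cos (s \<bullet> Z (fst p)) * cos (s \<bullet> Z (snd p)) \<partial>(R \<Otimes>\<^sub>M R))
        + (\<integral>p. sin (s \<bullet> Z (fst p)) * sin (s \<bullet> Z (snd p)) \<partial>(R \<Otimes>\<^sub>M R))"
      by (intro Bochner_Integration.integral_add prod(2)) auto
    also have "\<dots> = char_sq R Z s"
      using prod(1)[of "\<lambda>y. cos (s \<bullet> Z y)" "\<lambda>y. cos (s \<bullet> Z y)"]
        prod(1)[of "\<lambda>y. sin (s \<bullet> Z y)" "\<lambda>y. sin (s \<bullet> Z y)"]
      by (simp add: char_sq_def power2_eq_square)
    finally show ?thesis by (simp add: s_def)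
  qed
  have s: "integrable lborel (\<lambda>t. char_sq R Z ((1 / h) *\<^sub>R t))"
    by (rule lborel_scale(1)[OF L2 h])
  have "(\<integral>p. product_kernel Kc (\<xi> p) \<partial>(R \<Otimes>\<^sub>M R)) = c0 TYPE('q) * (\<integral>t. ftv t * char_sq R Z ((1 / h) *\<^sub>R t) \<partial>lborel)"
    using integral_product_Kc(1)[OF fin one, of \<xi>] by (simp add: e)
  also have "\<dots> \<le> c0 TYPE('q) * (\<integral>t. char_sq R Z ((1 / h) *\<^sub>R t) \<partial>lborel)"
    by (intro mult_left_mono integral_mono_AE' s AE_I2 mult_left_le_one_le mult_nonneg_nonneg ftv_le_1
        less_imp_le[OF ftv_pos] less_imp_le[OF c0_pos])
      (auto simp: char_sq_def)
  also have "(\<integral>t. char_sq R Z ((1 / h) *\<^sub>R t) \<partial>lborel) = h ^ CARD('q) * integral\<^sup>L lborel (char_sq R Z)"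
    using lborel_scale(2)[OF L2 h] by simp
  finally show ?thesis by (simp add: \<xi>_def mult_ac)
qed

end

text \<open>The sign in \<open>fourier\<close> only flips the sine average, which is
  squared.\<close>

lemma char_sq_fourier:
  assumes dist: "distributed R lborel Z (\<lambda>z. ennreal (f z))" and f: "\<And>z. 0 \<le> f z"
  shows "char_sq R Z t = (norm (fourier f t))\<^sup>2"
proof -
  have [measurable]: "f \<in> borel_measurable borel"
    using distributed_real_measurable[OF _ dist] f by simp
  have c: "(\<integral>y. cos (t \<bullet> Z y) \<partial>R) = (\<integral>x. f x * cos (t \<bullet> x) \<partial>lborel)"
    and s: "(\<integral>y. sin (t \<bullet> Z y) \<partial>R) = (\<integral>x. f x * sin (t \<bullet> x) \<partial>lborel)"
    using f by (simp_all add: distributed_integral[OF dist])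
  have f_int: "integrable lborel f"
  proof (rule integrableI_nonneg)
    have "(\<integral>\<^sup>+x. ennreal (f x) * 1 \<partial>lborel) = (\<integral>\<^sup>+y. 1 \<partial>R)" by (rule distributed_nn_integral[OF dist]) simp
    then show "(\<integral>\<^sup>+x. ennreal (f x) \<partial>lborel) < \<infinity>" by (simp add: R.emeasure_space_1)
  qed (use f in auto)
  have [measurable]: "(\<lambda>x. cis (- (t \<bullet> x))) \<in> borel_measurable borel"
    by (intro borel_measurable_continuous_onI continuous_intros)
  have F: "integrable lborel (\<lambda>x. cis (- (t \<bullet> x)) * complex_of_real (f x))"
    by (rule Bochner_Integration.integrable_bound[OF f_int]) (auto simp: norm_mult)
  have "Re (fourier f t) = (\<integral>y. cos (t \<bullet> Z y) \<partial>R)"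
    unfolding fourier_def c using integral_Re[OF F] by (simp add: mult.commute)
  moreover have "Im (fourier f t) = - (\<integral>y. sin (t \<bullet> Z y) \<partial>R)"
    unfolding fourier_def s using integral_Im[OF F] by (simp add: mult.commute)
  ultimately show ?thesis by (simp add: char_sq_def cmod_power2)
qed

text \<open>With a, b the two averages, a cos + b sin <= (1 + a^2 + b^2) / 2 pointwise; averaging
  gives a^2 + b^2 <= (1 + a^2 + b^2) / 2.\<close>

lemma char_sq_le_1: "char_sq R Z t \<le> 1"
proof -
  define a b where "a = (\<integral>y. cos (t \<bullet> Z y) \<partial>R)" and "b = (\<integral>y. sin (t \<bullet> Z y) \<partial>R)"
  have "a\<^sup>2 + b\<^sup>2 = (\<integral>y. a * cos (t \<bullet> Z y) + b * sin (t \<bullet> Z y) \<partial>R)"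
    using integrable_trig_Z[of t] by (simp add: a_def b_def power2_eq_square)
  also have "\<dots> \<le> (\<integral>y. (1 + (a\<^sup>2 + b\<^sup>2)) / 2 \<partial>R)"
  proof (rule integral_mono)
    show "integrable R (\<lambda>y. a * cos (t \<bullet> Z y) + b * sin (t \<bullet> Z y))" using integrable_trig_Z[of t] by simp
    show "a * cos (t \<bullet> Z y) + b * sin (t \<bullet> Z y) \<le> (1 + (a\<^sup>2 + b\<^sup>2)) / 2" for y
    proof -
      define u v where "u = cos (t \<bullet> Z y)" and "v = sin (t \<bullet> Z y)"
      have "u\<^sup>2 + v\<^sup>2 = 1" by (simp add: u_def v_def)
      moreover have "0 \<le> (a - u)\<^sup>2 + (b - v)\<^sup>2" by simp
      ultimately have "a * u + b * v \<le> (1 + (a\<^sup>2 + b\<^sup>2)) / 2" by (simp add: power2_diff)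
      then show ?thesis by (simp add: u_def v_def)
    qed
  qed simp
  also have "\<dots> = (1 + (a\<^sup>2 + b\<^sup>2)) / 2" by (simp add: R.prob_space)
  finally show ?thesis unfolding char_sq_def a_def b_def by simp
qed

text \<open>For a bounded density the row average is already of order h^q, which h <= 1 weakens to
  h^(q/2), and the pair average is a mean of row averages. In the other case |F[f]| <= 1 gives
  |F[f]|^2 <= |F[f]|^(2 - b), so the characteristic function is square integrable.\<close>

lemma kernel_bounds:
  assumes dist: "distributed R lborel Z (\<lambda>z. ennreal (f z))" and f: "\<And>z. 0 \<le> f z"
    and alt: "(\<exists>B. \<forall>z. f z \<le> B) \<or>
      (\<exists>b\<in>{0<..1}. integrable lborel (\<lambda>t. norm (fourier f t) powr (2 - b)))"
  obtains C where "0 < C"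
    "\<And>h z. 0 < h \<Longrightarrow> h \<le> 1 \<Longrightarrow>
      (\<integral>y. product_kernel Kc ((1 / h) *\<^sub>R (z - Z y)) \<partial>R) \<le> C * sqrt (h ^ CARD('q))"
    "\<And>h. 0 < h \<Longrightarrow> h \<le> 1 \<Longrightarrow>
      (\<integral>p. product_kernel Kc ((1 / h) *\<^sub>R (Z (fst p) - Z (snd p))) \<partial>(R \<Otimes>\<^sub>M R)) \<le> C * h ^ CARD('q)"
  using alt
proof (elim disjE exE bexE)
  fix B assume B: "\<forall>z. f z \<le> B"
  have B0: "0 \<le> B" using f[of 0] B by (meson order_trans)
  interpret RR: pair_prob_space R R ..
  have row: "(\<integral>y. product_kernel Kc ((1 / h) *\<^sub>R (z - Z y)) \<partial>R) \<le> B * h ^ CARD('q)" if "0 < h" for h z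
    using kernel_bounds_bounded_density[OF dist f _ that] B by simp
  show ?thesis
  \<comment> \<open>The bound \<open>B\<close> may be 0, while the constant has to be
    positive.\<close>
  proof (rule that[of "B + 1"])
    fix h :: real and z assume h: "0 < h" "h \<le> 1"
    have hq: "0 < h ^ CARD('q)" "h ^ CARD('q) \<le> 1" using h by (auto intro: power_le_one)
    have "(h ^ CARD('q))\<^sup>2 \<le> h ^ CARD('q)" using hq by (simp add: power2_eq_square mult_left_le)
    then have "h ^ CARD('q) \<le> sqrt (h ^ CARD('q))" by (rule real_le_rsqrt)
    then have "B * h ^ CARD('q) \<le> (B + 1) * sqrt (h ^ CARD('q))" using B0 hq by (intro mult_mono) auto
    then show "(\<integral>y. product_kernel Kc ((1 / h) *\<^sub>R (z - Z y)) \<partial>R) \<le> (B + 1) * sqrt (h ^ CARD('q))"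
      using row[OF h(1), of z] by linarith
  next
    fix h :: real assume h: "0 < h" "h \<le> 1"
    have int: "integrable (R \<Otimes>\<^sub>M R) (\<lambda>p. product_kernel Kc ((1 / h) *\<^sub>R (Z (fst p) - Z (snd p))))"
      by (rule RR.integrable_const_bound[of _ "KB TYPE('q)"])
        (simp_all add: product_Kc_nonneg product_Kc_le)
    have "(\<integral>p. product_kernel Kc ((1 / h) *\<^sub>R (Z (fst p) - Z (snd p))) \<partial>(R \<Otimes>\<^sub>M R))
        = (\<integral>x. (\<integral>y. product_kernel Kc ((1 / h) *\<^sub>R (Z x - Z y)) \<partial>R) \<partial>R)"
      using RR.integral_fst'[OF int] by simp
    also have "\<dots> \<le> (\<integral>x. B * h ^ CARD('q) \<partial>R)"
      using RR.integrable_fst'[OF int] row[OF h(1)] by (intro integral_mono) auto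
    also have "\<dots> \<le> (B + 1) * h ^ CARD('q)" using h by (simp add: R.prob_space)
    finally show "(\<integral>p. product_kernel Kc ((1 / h) *\<^sub>R (Z (fst p) - Z (snd p))) \<partial>(R \<Otimes>\<^sub>M R)) \<le> (B + 1) * h ^ CARD('q)" .
  qed (use B0 in simp)
next
  fix b :: real assume b: "b \<in> {0<..1}" and int: "integrable lborel (\<lambda>t. norm (fourier f t) powr (2 - b))"
  have L2: "integrable lborel (char_sq R Z)"
  proof (rule Bochner_Integration.integrable_bound[OF int])
    show "AE t in lborel. norm (char_sq R Z t) \<le> norm (norm (fourier f t) powr (2 - b))"
    proof (rule AE_I2)
      fix t :: "real ^ 'q"
      have "(norm (fourier f t))\<^sup>2 \<le> 1" using char_sq_le_1[of t] by (simp add: char_sq_fourier[OF dist f])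
      then have le1: "norm (fourier f t) \<le> 1" by (simp add: power2_le_imp_le abs_square_le_1)
      have "(norm (fourier f t))\<^sup>2 \<le> norm (fourier f t) powr (2 - b)"
      proof (cases "fourier f t = 0")
        case False
        then have "(norm (fourier f t))\<^sup>2 = norm (fourier f t) powr 2" by (simp add: powr_numeral)
        also have "\<dots> \<le> norm (fourier f t) powr (2 - b)"
          using False le1 b by (intro powr_mono') auto
        finally show ?thesis .
      qed simp
      then show "norm (char_sq R Z t) \<le> norm (norm (fourier f t) powr (2 - b))"
        by (simp add: char_sq_fourier[OF dist f])
    qed
  qed measurable
  have L0: "0 \<le> integral\<^sup>L lborel (char_sq R Z)"
    by (intro Bochner_Integration.integral_nonneg) (simp add: char_sq_def)
  have KB0: "0 \<le> KB TYPE('q)"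
    using product_Kc_nonneg[of "0 :: real ^ 'q"] product_Kc_le[of "0 :: real ^ 'q"] by linarith
  have c: "0 \<le> c0 TYPE('q) * integral\<^sup>L lborel (char_sq R Z)" by (rule mult_nonneg_nonneg[OF less_imp_le[OF c0_pos] L0])
  define C where "C = KB TYPE('q) + c0 TYPE('q) * integral\<^sup>L lborel (char_sq R Z) + 1"
  show ?thesis
  proof (rule that[of C])
    show "0 < C" using KB0 c by (simp add: C_def)
    fix h :: real and z assume h: "0 < h" "h \<le> 1"
    have "(KB TYPE('q) + c0 TYPE('q) * integral\<^sup>L lborel (char_sq R Z)) * sqrt (h ^ CARD('q)) \<le> C * sqrt (h ^ CARD('q))"
      using h by (intro mult_right_mono) (auto simp: C_def)
    then show "(\<integral>y. product_kernel Kc ((1 / h) *\<^sub>R (z - Z y)) \<partial>R) \<le> C * sqrt (h ^ CARD('q))"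
      using kernel_row_fourier[OF L2 h(1), of z] by linarith
  next
    fix h :: real assume h: "0 < h" "h \<le> 1"
    have "c0 TYPE('q) * integral\<^sup>L lborel (char_sq R Z) * h ^ CARD('q) \<le> C * h ^ CARD('q)"
      using h KB0 by (intro mult_right_mono) (auto simp: C_def)
    then show "(\<integral>p. product_kernel Kc ((1 / h) *\<^sub>R (Z (fst p) - Z (snd p))) \<partial>(R \<Otimes>\<^sub>M R)) \<le> C * h ^ CARD('q)"
      using kernel_pair_fourier[OF L2 h(1)] by linarith
  qed
qed

end

end

section \<open>Uniqueness of Laplace and Fourier transforms\<close>

text \<open>Once the first k coefficients vanish, division by x^k leaves a series with sum 0 at
  every x other than 0; its limit at 0 is \<open>a k\<close>.\<close>

lemma power_series_zero:
  fixes a :: "nat \<Rightarrow> real"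
  assumes "\<And>x. (\<lambda>n. a n * x ^ n) sums 0"
  shows "a k = 0"
proof -
  have shift: "(\<lambda>n. a (n + k) * x ^ n) sums 0" if "x \<noteq> 0" for x
    using that
  proof (induction k arbitrary: x)
    case 0
    then show ?case using assms[of x] by simp
  next
    case (Suc k)
    have lim: "((\<lambda>x :: real. 0) \<longlongrightarrow> a (0 + k)) (at 0)"
      by (rule powser_limit_0_strong[where s = 1 and a = "\<lambda>n. a (n + k)"]) (use Suc.IH in auto)
    have "a (0 + k) = 0" by (rule tendsto_unique[OF _ lim tendsto_const]) simp
    then have "a k = 0" by simp
    then have "(\<lambda>n. a (Suc n + k) * x ^ Suc n) sums 0"
      using Suc.IH[OF Suc.prems] by (subst sums_Suc_iff) simp
    from sums_mult[OF this, of "1 / x"] show ?case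
      using Suc.prems by (simp add: mult_ac)
  qed
  have lim: "((\<lambda>x :: real. 0) \<longlongrightarrow> a (0 + k)) (at 0)"
    by (rule powser_limit_0_strong[where s = 1 and a = "\<lambda>n. a (n + k)"]) (use shift in auto)
  have "a (0 + k) = 0" by (rule tendsto_unique[OF _ lim tendsto_const]) simp
  then show ?thesis by simp
qed

text \<open>A two-sided Laplace transform vanishing on the real line vanishes on the imaginary axis, since
  it is given everywhere by the same power series.\<close>

lemma laplace_zero_imp_fourier_zero:
  fixes g Y :: "'x \<Rightarrow> real"
  assumes [measurable]: "g \<in> borel_measurable R" "Y \<in> borel_measurable R"
    and int: "\<And>\<tau>. integrable R (\<lambda>x. g x * exp (\<tau> * Y x))"
    and zero: "\<And>\<tau>. (\<integral>x. g x * exp (\<tau> * Y x) \<partial>R) = 0"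
  shows "(\<integral>x. complex_of_real (g x) * cis (Y x) \<partial>R) = 0"
proof -
  \<comment> \<open>The exponential moments of |Y| come from those of Y with both signs of
    \<open>c\<close>; they dominate the exponential series for every complex z.\<close>
  have abs_int: "integrable R (\<lambda>x. \<bar>g x\<bar> * exp (c * \<bar>Y x\<bar>))" for c
  proof (rule Bochner_Integration.integrable_bound)
    show "integrable R (\<lambda>x. \<bar>g x * exp (c * Y x)\<bar> + \<bar>g x * exp ((- c) * Y x)\<bar>)"
      by (intro Bochner_Integration.integrable_add integrable_abs int)
    show "AE x in R. norm (\<bar>g x\<bar> * exp (c * \<bar>Y x\<bar>)) \<le> norm (\<bar>g x * exp (c * Y x)\<bar> + \<bar>g x * exp ((- c) * Y x)\<bar>)"
    proof (rule AE_I2)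
      fix x
      have "exp (c * \<bar>Y x\<bar>) \<le> exp (c * Y x) + exp ((- c) * Y x)"
        by (cases "Y x \<ge> 0") (auto simp: abs_if)
      from mult_left_mono[OF this, of "\<bar>g x\<bar>"]
      show "norm (\<bar>g x\<bar> * exp (c * \<bar>Y x\<bar>)) \<le> norm (\<bar>g x * exp (c * Y x)\<bar> + \<bar>g x * exp ((- c) * Y x)\<bar>)"
        by (simp add: abs_mult distrib_left)
    qed
  qed measurable
  have poly_bound: "(\<Sum>n<N. (c * \<bar>y\<bar>) ^ n / fact n) \<le> exp (c * \<bar>y\<bar>)" if "c \<ge> 0" for c y :: real and N
  proof -
    have "(\<Sum>n<N. (c * \<bar>y\<bar>) ^ n / fact n) \<le> (\<Sum>n. (c * \<bar>y\<bar>) ^ n / fact n)"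
      using that summable_exp[of "c * \<bar>y\<bar>"]
      by (intro sum_le_suminf) (auto simp: divide_inverse mult.commute)
    also have "\<dots> = exp (c * \<bar>y\<bar>)" by (simp add: exp_def divide_inverse scaleR_conv_of_real mult.commute)
    finally show ?thesis .
  qed
  define f where "f z n x = complex_of_real (g x) * ((z * complex_of_real (Y x)) ^ n / fact n)" for z n x
  have f_meas[measurable]: "f z n \<in> borel_measurable R" for z n unfolding f_def by measurable
  have norm_f: "norm (f z n x) = \<bar>g x\<bar> * ((norm z * \<bar>Y x\<bar>) ^ n / fact n)" for z n x
    by (simp add: f_def norm_mult norm_power norm_divide)
  have sum_norm: "(\<Sum>n<N. norm (f z n x)) \<le> \<bar>g x\<bar> * exp (norm z * \<bar>Y x\<bar>)" for z x N
    unfolding norm_f sum_distrib_left[symmetric] by (intro mult_left_mono poly_bound) auto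
  have int_f: "integrable R (f z n)" for z n
  proof (rule Bochner_Integration.integrable_bound[OF abs_int[of "norm z"]])
    have "norm (f z n x) \<le> \<bar>g x\<bar> * exp (norm z * \<bar>Y x\<bar>)" for x
    proof -
      have "norm (f z n x) \<le> (\<Sum>m<Suc n. norm (f z m x))" by (simp add: sum_nonneg)
      then show ?thesis using sum_norm[of z x "Suc n"] by linarith
    qed
    then show "AE x in R. norm (f z n x) \<le> norm (\<bar>g x\<bar> * exp (norm z * \<bar>Y x\<bar>))" by simp
  qed measurable
  have "summable (\<lambda>n. \<integral>x. norm (f z n x) \<partial>R)" for z
  proof (rule bounded_imp_summable)
    show "(\<Sum>n\<le>N. \<integral>x. norm (f z n x) \<partial>R) \<le> (\<integral>x. \<bar>g x\<bar> * exp (norm z * \<bar>Y x\<bar>) \<partial>R)" for N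
    proof -
      have "(\<Sum>n\<le>N. \<integral>x. norm (f z n x) \<partial>R) = (\<integral>x. (\<Sum>n\<le>N. norm (f z n x)) \<partial>R)"
        using int_f by (intro Bochner_Integration.integral_sum[symmetric]) auto
      also have "\<dots> \<le> (\<integral>x. \<bar>g x\<bar> * exp (norm z * \<bar>Y x\<bar>) \<partial>R)"
        using int_f sum_norm[of z _ "Suc N"]
        by (intro integral_mono abs_int Bochner_Integration.integrable_sum) (auto simp: lessThan_Suc_atMost)
      finally show ?thesis .
    qed
  qed (simp add: integral_nonneg_AE)
  moreover have sums_f: "(\<lambda>n. f z n x) sums (complex_of_real (g x) * exp (z * complex_of_real (Y x)))" for z x
    unfolding f_def
    using sums_mult[OF exp_converges[of "z * complex_of_real (Y x)"], of "complex_of_real (g x)"]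
    by (simp add: scaleR_conv_of_real divide_inverse mult_ac)
  moreover have "summable (\<lambda>n. norm (f z n x))" for z x
    using summable_mult[OF summable_exp[of "norm z * \<bar>Y x\<bar>"], of "\<bar>g x\<bar>"]
    by (simp add: norm_f divide_inverse mult_ac)
  ultimately have series: "(\<lambda>n. \<integral>x. f z n x \<partial>R) sums (\<integral>x. complex_of_real (g x) * exp (z * complex_of_real (Y x)) \<partial>R)" for z
    using sums_integral[of R "f z", OF int_f] by (simp add: sums_unique[OF sums_f, symmetric])
  \<comment> \<open>The coefficients are real and do not depend on z: a vanishing sum for all real z
    forces them to be 0, and z = i then gives the claim.\<close>
  define A where "A n = (\<integral>x. g x * Y x ^ n \<partial>R) / fact n" for n
  have f_A: "(\<integral>x. f z n x \<partial>R) = complex_of_real (A n) * z ^ n" for z n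
  proof -
    have "(\<integral>x. f z n x \<partial>R) = (\<integral>x. complex_of_real (g x * Y x ^ n) * (z ^ n / fact n) \<partial>R)"
      by (intro Bochner_Integration.integral_cong refl) (simp add: f_def power_mult_distrib)
    also have "\<dots> = complex_of_real (\<integral>x. g x * Y x ^ n \<partial>R) * (z ^ n / fact n)"
      by (simp only: integral_mult_left_zero integral_complex_of_real)
    finally show ?thesis by (simp add: A_def)
  qed
  have "(\<lambda>n. A n * x ^ n) sums 0" for x
  proof -
    have "(\<integral>\<omega>. complex_of_real (g \<omega>) * exp (complex_of_real x * complex_of_real (Y \<omega>)) \<partial>R)
        = (\<integral>\<omega>. complex_of_real (g \<omega> * exp (x * Y \<omega>)) \<partial>R)"
      by (intro Bochner_Integration.integral_cong refl) (simp add: exp_of_real flip: of_real_mult)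
    also have "\<dots> = 0" by (simp only: integral_complex_of_real zero of_real_0)
    finally have "(\<lambda>n. complex_of_real (A n * x ^ n)) sums complex_of_real 0"
      using series[of "complex_of_real x"] by (simp add: f_A)
    then show ?thesis by (simp only: sums_of_real_iff)
  qed
  then have "A n = 0" for n by (rule power_series_zero)
  then have "(\<lambda>n. 0 :: complex) sums (\<integral>x. complex_of_real (g x) * exp (\<i> * complex_of_real (Y x)) \<partial>R)"
    using series[of \<i>] by (simp add: f_A)
  then show ?thesis using sums_unique2[OF sums_zero] by (simp add: cis_conv_exp)
qed

text \<open>The positive and negative parts of the signed measure g dR have the same mass (frequency
  0) and images under \<open>Y\<close> with the same transform; after normalisation Levy's
  uniqueness theorem identifies the images.\<close>

lemma fourier_zero_imp_integral_zero_real: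
  fixes g Y :: "'x \<Rightarrow> real"
  assumes g: "integrable R g" and Y[measurable]: "Y \<in> borel_measurable R"
    and zero: "\<And>s. (\<integral>x. complex_of_real (g x) * cis (s * Y x) \<partial>R) = 0"
    and A[measurable]: "A \<in> sets borel"
  shows "(\<integral>x. g x * indicator A (Y x) \<partial>R) = 0"
proof -
  have g_meas[measurable]: "g \<in> borel_measurable R" using g by simp
  \<comment> \<open>For e = 1 and e = -1 these are the positive and the negative part of
    \<open>g\<close>.\<close>
  define p where "p e x = max (e * g x) 0" for e x :: "_"
  have p_meas[measurable]: "p e \<in> borel_measurable R" for e unfolding p_def by measurable
  have p_int: "integrable R (p e)" for e unfolding p_def using g by auto
  have p_nonneg: "0 \<le> p e x" for e x by (simp add: p_def)
  have g_split: "g x = p 1 x - p (- 1) x" for x by (simp add: p_def max_def)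
  have split: "(\<integral>x. g x *\<^sub>R f x \<partial>R) = (\<integral>x. p 1 x *\<^sub>R f x \<partial>R) - (\<integral>x. p (- 1) x *\<^sub>R f x \<partial>R)"
    if [measurable]: "f \<in> borel_measurable R" and f: "\<And>x. norm (f x) \<le> 1"
    for f :: "_ \<Rightarrow> 'c::{banach, second_countable_topology}"
  proof -
    have i: "integrable R (\<lambda>x. p e x *\<^sub>R f x)" for e
    proof (rule Bochner_Integration.integrable_bound[OF p_int[of e]])
      show "AE x in R. norm (p e x *\<^sub>R f x) \<le> norm (p e x)"
        using f p_nonneg by (intro AE_I2) (auto intro!: mult_right_le_one_le)
    qed measurable
    show ?thesis
      unfolding g_split scaleR_diff_left by (rule Bochner_Integration.integral_diff[OF i i])
  qed
  define m where "m = integral\<^sup>L R (p 1)"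
  have zero0: "(\<integral>x. complex_of_real (g x) \<partial>R) = 0" using zero[of 0] by simp
  then have "integral\<^sup>L R g = 0" by (simp only: integral_complex_of_real of_real_eq_0_iff)
  then have m_eq: "integral\<^sup>L R (p e) = m" if "e = 1 \<or> e = - 1" for e
    using split[of "\<lambda>_. 1 :: real"] that by (auto simp: m_def)
  have m0: "0 \<le> m" unfolding m_def using p_nonneg by (intro Bochner_Integration.integral_nonneg)
  show ?thesis
  proof (cases "m = 0")
    \<comment> \<open>Without mass there is nothing to normalise, but then \<open>g\<close> vanishes
      almost everywhere.\<close>
    case True
    have "AE x in R. p e x = 0" if "e = 1 \<or> e = - 1" for e
      using integral_nonneg_eq_0_iff_AE[OF p_int, of e] p_nonneg m_eq[OF that] True by auto
    from this[of 1] this[of "- 1"] have "AE x in R. g x = 0"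
      by (auto simp: g_split elim: AE_mp)
    then have "AE x in R. g x * indicator A (Y x) = 0" by eventually_elim simp
    then show ?thesis by (rule integral_eq_zero_AE)
  next
    case False
    then have m: "m > 0" using m0 by simp
    define \<mu> where "\<mu> e = distr (density R (\<lambda>x. ennreal (p e x / m))) borel Y" for e
    have int_\<mu>: "(\<integral>y. f y \<partial>\<mu> e) = (\<integral>x. p e x *\<^sub>R f (Y x) \<partial>R) /\<^sub>R m"
      if [measurable]: "f \<in> borel_measurable borel" for e and f :: "real \<Rightarrow> 'c::{banach, second_countable_topology}"
    proof -
      have "(\<integral>y. f y \<partial>\<mu> e) = (\<integral>x. f (Y x) \<partial>(density R (\<lambda>x. ennreal (p e x / m))))"
        unfolding \<mu>_def by (rule integral_distr) measurable
      also have "\<dots> = (\<integral>x. (p e x / m) *\<^sub>R f (Y x) \<partial>R)"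
        using p_nonneg m by (intro integral_density) auto
      also have "\<dots> = (\<integral>x. (1 / m) *\<^sub>R (p e x *\<^sub>R f (Y x)) \<partial>R)" by (simp add: divide_inverse mult.commute)
      also have "\<dots> = (1 / m) *\<^sub>R (\<integral>x. p e x *\<^sub>R f (Y x) \<partial>R)" by (rule integral_scaleR_right)
      finally show ?thesis by (simp add: divide_inverse)
    qed
    have dist: "real_distribution (\<mu> e)" if "e = 1 \<or> e = - 1" for e
    proof -
      interpret prob_space "\<mu> e"
      proof (rule prob_spaceI)
        have "emeasure (\<mu> e) (space (\<mu> e)) = (\<integral>\<^sup>+x. ennreal (p e x / m) \<partial>R)"
          by (simp add: \<mu>_def emeasure_distr emeasure_density)
        also have "\<dots> = ennreal (\<integral>x. p e x / m \<partial>R)"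
          using p_int[of e] p_nonneg m by (intro nn_integral_eq_integral) auto
        also have "(\<integral>x. p e x / m \<partial>R) = 1" using m_eq[OF that] m by simp
        finally show "emeasure (\<mu> e) (space (\<mu> e)) = 1" by simp
      qed
      show ?thesis by unfold_locales (simp_all add: \<mu>_def)
    qed
    have "char (\<mu> 1) = char (\<mu> (- 1))"
    proof
      fix s
      have "(\<integral>x. p 1 x *\<^sub>R iexp (s * Y x) \<partial>R) - (\<integral>x. p (- 1) x *\<^sub>R iexp (s * Y x) \<partial>R)
          = (\<integral>x. g x *\<^sub>R iexp (s * Y x) \<partial>R)"
        by (rule split[symmetric]) auto
      also have "\<dots> = 0" using zero[of s] by (simp add: scaleR_conv_of_real cis_conv_exp)
      finally show "char (\<mu> 1) s = char (\<mu> (- 1)) s"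
        unfolding char_def by (subst (1 2) int_\<mu>) auto
    qed
    then have eq: "\<mu> 1 = \<mu> (- 1)" by (intro Levy_uniqueness dist) auto
    have "(\<integral>x. p 1 x *\<^sub>R (indicator A (Y x) :: real) \<partial>R) = (\<integral>x. p (- 1) x *\<^sub>R (indicator A (Y x) :: real) \<partial>R)"
      using int_\<mu>[of "indicator A :: real \<Rightarrow> real" 1] int_\<mu>[of "indicator A :: real \<Rightarrow> real" "- 1"] m
      by (simp add: eq)
    then show ?thesis using split[of "\<lambda>x. indicator A (Y x) :: real"] by (simp add: indicator_def)
  qed
qed

text \<open>Conjugation turns the hypothesis at -s into the same statement for the conjugate of
  \<open>g\<close> at s, so the real and the imaginary part each satisfy the real version.\<close>

lemma fourier_zero_imp_integral_zero:
  fixes g :: "'x \<Rightarrow> complex" and Y :: "'x \<Rightarrow> real"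
  assumes g: "integrable R g" and Y[measurable]: "Y \<in> borel_measurable R"
    and zero: "\<And>s. (\<integral>x. g x * cis (s * Y x) \<partial>R) = 0"
    and A[measurable]: "A \<in> sets borel"
  shows "(\<integral>x. g x * indicator A (Y x) \<partial>R) = 0"
proof -
  have g_meas[measurable]: "g \<in> borel_measurable R" using g by simp
  have [measurable]: "(\<lambda>x. cnj (g x)) \<in> borel_measurable R"
    by (rule measurable_compose[OF g_meas]) (intro borel_measurable_continuous_onI continuous_intros)
  have i: "integrable R (\<lambda>x. g x * cis (s * Y x))" for s
    by (rule Bochner_Integration.integrable_bound[OF g])
      (auto simp: norm_mult cis_conv_exp)
  have ic: "integrable R (\<lambda>x. cnj (g x) * cis (s * Y x))" for s
    by (rule Bochner_Integration.integrable_bound[OF g])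
      (auto simp: norm_mult cis_conv_exp)
  have zc: "(\<integral>x. cnj (g x) * cis (s * Y x) \<partial>R) = 0" for s
  proof -
    have "(\<integral>x. cnj (g x) * cis (s * Y x) \<partial>R) = (\<integral>x. cnj (g x * cis ((- s) * Y x)) \<partial>R)"
      by (intro Bochner_Integration.integral_cong refl) (simp add: cis_cnj)
    also have "\<dots> = cnj (\<integral>x. g x * cis ((- s) * Y x) \<partial>R)" by (rule Bochner_Integration.integral_cnj)
    finally show ?thesis by (simp only: zero complex_cnj_zero)
  qed
  have re: "(\<integral>x. complex_of_real (Re (g x)) * cis (s * Y x) \<partial>R) = 0" for s
  proof -
    have "(\<integral>x. complex_of_real (Re (g x)) * cis (s * Y x) \<partial>R)
        = (\<integral>x. (g x * cis (s * Y x) + cnj (g x) * cis (s * Y x)) / 2 \<partial>R)"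
      by (intro Bochner_Integration.integral_cong refl)
        (simp add: complex_add_cnj flip: distrib_right)
    also have "\<dots> = ((\<integral>x. g x * cis (s * Y x) \<partial>R) + (\<integral>x. cnj (g x) * cis (s * Y x) \<partial>R)) / 2"
      using i ic by simp
    finally show ?thesis by (simp only: zero zc) simp
  qed
  have im: "(\<integral>x. complex_of_real (Im (g x)) * cis (s * Y x) \<partial>R) = 0" for s
  proof -
    have "(\<integral>x. complex_of_real (Im (g x)) * cis (s * Y x) \<partial>R)
        = (\<integral>x. (g x * cis (s * Y x) - cnj (g x) * cis (s * Y x)) / (2 * \<i>) \<partial>R)"
    proof (rule Bochner_Integration.integral_cong[OF refl])
      fix x
      have "complex_of_real (Im (g x)) = (g x - cnj (g x)) / (2 * \<i>)" by (simp add: complex_eq_iff)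
      then show "complex_of_real (Im (g x)) * cis (s * Y x)
          = (g x * cis (s * Y x) - cnj (g x) * cis (s * Y x)) / (2 * \<i>)"
        by (simp only: left_diff_distrib times_divide_eq_left)
    qed
    also have "\<dots> = ((\<integral>x. g x * cis (s * Y x) \<partial>R) - (\<integral>x. cnj (g x) * cis (s * Y x) \<partial>R)) / (2 * \<i>)"
      using i ic by simp
    finally show ?thesis by (simp only: zero zc) simp
  qed
  have r: "(\<integral>x. Re (g x) * indicator A (Y x) \<partial>R) = 0"
    using g by (intro fourier_zero_imp_integral_zero_real re) auto
  have m: "(\<integral>x. Im (g x) * indicator A (Y x) \<partial>R) = 0"
    using g by (intro fourier_zero_imp_integral_zero_real im) auto
  have int: "integrable R (\<lambda>x. g x * indicator A (Y x))"
    by (rule Bochner_Integration.integrable_bound[OF g])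
      (auto simp: norm_mult indicator_def)
  have "Re (\<integral>x. g x * indicator A (Y x) \<partial>R) = 0"
  proof -
    have "Re (\<integral>x. g x * indicator A (Y x) \<partial>R) = (\<integral>x. Re (g x * indicator A (Y x)) \<partial>R)"
      by (rule integral_Re[OF int, symmetric])
    also have "\<dots> = (\<integral>x. Re (g x) * indicator A (Y x) \<partial>R)"
      by (intro Bochner_Integration.integral_cong refl) (simp add: indicator_def)
    finally show ?thesis by (simp add: r)
  qed
  moreover have "Im (\<integral>x. g x * indicator A (Y x) \<partial>R) = 0"
  proof -
    have "Im (\<integral>x. g x * indicator A (Y x) \<partial>R) = (\<integral>x. Im (g x * indicator A (Y x)) \<partial>R)"
      by (rule integral_Im[OF int, symmetric])
    also have "\<dots> = (\<integral>x. Im (g x) * indicator A (Y x) \<partial>R)"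
      by (intro Bochner_Integration.integral_cong refl) (simp add: indicator_def)
    finally show ?thesis by (simp add: m)
  qed
  ultimately show ?thesis by (simp add: complex_eq_iff)
qed

text \<open>Frequencies are exchanged for indicators one coordinate at a time, the remaining
  coordinates staying in the exponential.\<close>

lemma cylinder_integral_zero:
  fixes G :: "'x \<Rightarrow> real" and y :: "'i \<Rightarrow> 'x \<Rightarrow> real"
  assumes G: "integrable R G" and y: "\<And>i. i \<in> I \<Longrightarrow> y i \<in> borel_measurable R"
    and zero: "\<And>J t. finite J \<Longrightarrow> J \<subseteq> I \<Longrightarrow> (\<integral>x. complex_of_real (G x) * cis (\<Sum>j\<in>J. t j * y j x) \<partial>R) = 0"
    and J1: "finite J1" "J1 \<subseteq> I" and A: "\<And>j. j \<in> J1 \<Longrightarrow> A j \<in> sets borel"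
  shows "(\<integral>x. G x * (\<Prod>j\<in>J1. indicator (A j) (y j x)) \<partial>R) = 0"
proof -
  have G_meas[measurable]: "G \<in> borel_measurable R" using G by simp
  \<comment> \<open>The induction needs this mixed form: for a new index j, the hypothesis with j
    moved into the exponential at an arbitrary frequency s is what
    \<open>fourier_zero_imp_integral_zero\<close> asks for.\<close>
  have "(\<integral>x. complex_of_real (G x * (\<Prod>j\<in>J1. indicator (A j) (y j x))) * cis (\<Sum>j\<in>J2. t j * y j x) \<partial>R) = 0"
    if "finite J2" "J2 \<subseteq> I" "J1 \<inter> J2 = {}" for J2 t
    using J1 A that
  proof (induction J1 arbitrary: J2 t rule: finite_induct)
    case empty
    then show ?case using zero by simp
  next
    case (insert j J1)
    define g where "g x = complex_of_real (G x * (\<Prod>j\<in>J1. indicator (A j) (y j x))) * cis (\<Sum>j\<in>J2. t j * y j x)" for x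
    have [measurable]: "(\<lambda>x. \<Prod>j\<in>J1. indicator (A j) (y j x) :: real) \<in> borel_measurable R"
    proof (rule borel_measurable_prod)
      fix i assume i: "i \<in> J1"
      then have [measurable]: "A i \<in> sets borel" "y i \<in> borel_measurable R" using insert.prems y by auto
      show "(\<lambda>x. indicator (A i) (y i x) :: real) \<in> borel_measurable R" by measurable
    qed
    have [measurable]: "(\<lambda>x. cis (\<Sum>j\<in>J2. t j * y j x)) \<in> borel_measurable R"
    proof -
      have "(\<lambda>x. \<Sum>j\<in>J2. t j * y j x) \<in> borel_measurable R"
        using insert.prems y by (intro borel_measurable_sum borel_measurable_times) auto
      then show ?thesis unfolding cis_conv_exp by measurable
    qed
    have [measurable]: "y j \<in> borel_measurable R" using insert.prems y by auto
    have g_int: "integrable R g"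
    proof (rule Bochner_Integration.integrable_bound[OF G])
      have "\<bar>\<Prod>j\<in>J1. indicator (A j) (y j x) :: real\<bar> \<le> 1" for x
        by (simp add: abs_prod) (intro prod_le_1, auto simp: indicator_def)
      then show "AE x in R. norm (g x) \<le> norm (G x)"
        unfolding g_def norm_mult norm_of_real norm_cis abs_mult real_norm_def
        by (intro AE_I2) (simp add: mult_left_le)
      show "g \<in> borel_measurable R" unfolding g_def by measurable
    qed
    have "(\<integral>x. g x * cis (s * y j x) \<partial>R) = 0" for s
    proof -
      have "(\<integral>x. complex_of_real (G x * (\<Prod>j\<in>J1. indicator (A j) (y j x)))
          * cis (\<Sum>i\<in>insert j J2. (t(j := s)) i * y i x) \<partial>R) = 0"
        using insert.hyps insert.prems by (intro insert.IH) auto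
      moreover have "(\<Sum>i\<in>insert j J2. (t(j := s)) i * y i x) = (\<Sum>j\<in>J2. t j * y j x) + s * y j x" for x
      proof -
        have j: "j \<notin> J2" using insert.prems by auto
        then have "(\<Sum>i\<in>J2. (t(j := s)) i * y i x) = (\<Sum>j\<in>J2. t j * y j x)"
          by (intro sum.cong refl) auto
        then show ?thesis using j insert.prems by (simp add: add.commute)
      qed
      ultimately show ?thesis by (simp add: g_def cis_mult[symmetric] mult.assoc)
    qed
    then have "(\<integral>x. g x * indicator (A j) (y j x) \<partial>R) = 0"
      using insert.prems by (intro fourier_zero_imp_integral_zero g_int) auto
    moreover have "g x * indicator (A j) (y j x)
        = complex_of_real (G x * (\<Prod>j\<in>insert j J1. indicator (A j) (y j x))) * cis (\<Sum>j\<in>J2. t j * y j x)" for x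
      using insert.hyps by (simp add: g_def indicator_def)
    ultimately show ?case by simp
  qed
  from this[of "{}"] have "(\<integral>x. complex_of_real (G x * (\<Prod>j\<in>J1. indicator (A j) (y j x))) \<partial>R) = 0"
    by simp
  then show ?thesis by (simp only: integral_complex_of_real of_real_eq_0_iff)
qed

text \<open>The \<open>y i\<close> generate the sigma-algebra of \<open>R\<close>: each point is recovered measurably from them.\<close>

lemma fourier_zero_imp_AE_zero:
  fixes G :: "'x \<Rightarrow> real" and y :: "'i \<Rightarrow> 'x \<Rightarrow> real"
  assumes R: "sigma_finite_measure R"
    and G: "integrable R G" and y: "\<And>i. i \<in> I \<Longrightarrow> y i \<in> borel_measurable R"
    and zero: "\<And>J t. finite J \<Longrightarrow> J \<subseteq> I \<Longrightarrow> (\<integral>x. complex_of_real (G x) * cis (\<Sum>j\<in>J. t j * y j x) \<partial>R) = 0"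
    and F[measurable]: "F \<in> measurable (\<Pi>\<^sub>M i\<in>I. borel) R"
    and recover: "\<And>x. x \<in> space R \<Longrightarrow> F (\<lambda>i\<in>I. y i x) = x"
  shows "AE x in R. G x = 0"
proof -
  interpret sigma_finite_measure R by (rule R)
  have G_meas[measurable]: "G \<in> borel_measurable R" using G by simp
  \<comment> \<open>Since \<open>ennreal\<close> sends negative reals to 0, \<open>\<nu> 1\<close>
    and \<open>\<nu> (- 1)\<close> have the positive and the negative part of \<open>G\<close> as
    densities.\<close>
  define \<nu> where "\<nu> e = density R (\<lambda>x. ennreal (e * G x))" for e
  define \<Psi> where "\<Psi> x = (\<lambda>i\<in>I. y i x)" for x
  have \<Psi>[measurable]: "\<Psi> \<in> measurable R (\<Pi>\<^sub>M i\<in>I. borel)"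
    unfolding \<Psi>_def by (intro measurable_restrict y)
  have sets_\<nu>: "sets (\<nu> e) = sets R" "space (\<nu> e) = space R" for e by (simp_all add: \<nu>_def)
  have fin: "emeasure (\<nu> e) (space R) < \<infinity>" for e
  proof -
    have "emeasure (\<nu> e) (space R) \<le> (\<integral>\<^sup>+x. ennreal (norm (e * G x)) \<partial>R)"
      unfolding \<nu>_def by (simp add: emeasure_density) (auto intro!: nn_integral_mono ennreal_leI simp: indicator_def)
    also have "\<dots> < \<infinity>" using integrable_mult_right[OF G, of e] unfolding integrable_iff_bounded by blast
    finally show ?thesis .
  qed
  have split: "emeasure (\<nu> 1) B = emeasure (\<nu> (- 1)) B"
    if [measurable]: "B \<in> sets R" and B: "(\<integral>x. G x * indicator B x \<partial>R) = 0" for B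
  proof -
    have i: "integrable R (\<lambda>x. G x * indicator B x)"
      by (rule Bochner_Integration.integrable_bound[OF G]) (auto simp: indicator_def)
    have e: "emeasure (\<nu> e) B = ennreal (\<integral>x. max 0 (e * (G x * indicator B x)) \<partial>R)" for e
    proof -
      have "emeasure (\<nu> e) B = (\<integral>\<^sup>+x. ennreal (max 0 (e * (G x * indicator B x))) \<partial>R)"
        unfolding \<nu>_def by (subst emeasure_density)
          (auto intro!: nn_integral_cong simp: indicator_def max_def ennreal_neg)
      also have "\<dots> = ennreal (\<integral>x. max 0 (e * (G x * indicator B x)) \<partial>R)"
        using i by (intro nn_integral_eq_integral) auto
      finally show ?thesis .
    qed
    have "(\<integral>x. max 0 (1 * (G x * indicator B x)) \<partial>R) - (\<integral>x. max 0 (- 1 * (G x * indicator B x)) \<partial>R)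
        = (\<integral>x. max 0 (1 * (G x * indicator B x)) - max 0 (- 1 * (G x * indicator B x)) \<partial>R)"
      using i by (intro Bochner_Integration.integral_diff[symmetric]) auto
    also have "\<dots> = (\<integral>x. G x * indicator B x \<partial>R)"
      by (intro Bochner_Integration.integral_cong refl) (auto simp: max_def)
    finally show ?thesis unfolding e B by simp
  qed
  have \<Psi>\<nu>: "\<Psi> \<in> measurable (\<nu> e) (\<Pi>\<^sub>M i\<in>I. borel)" for e
    using \<Psi> by (simp add: measurable_def sets_\<nu>)
  \<comment> \<open>Finite measures on the product are determined by cylinders with Borel sides,
    over which the integrals of \<open>G\<close> vanish by
    \<open>cylinder_integral_zero\<close>.\<close>
  have "distr (\<nu> 1) (\<Pi>\<^sub>M i\<in>I. borel) \<Psi> = distr (\<nu> (- 1)) (\<Pi>\<^sub>M i\<in>I. borel) \<Psi>"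
  proof (rule measure_eqI_PiM_infinite)
    fix A :: "'i \<Rightarrow> real set" and J assume J: "finite J" "J \<subseteq> I" and A: "\<And>i. i \<in> J \<Longrightarrow> A i \<in> sets borel"
    define B where "B = \<Psi> -` prod_emb I (\<lambda>_. borel) J (Pi\<^sub>E J A) \<inter> space R"
    have c: "prod_emb I (\<lambda>_. borel) J (Pi\<^sub>E J A) \<in> sets (\<Pi>\<^sub>M i\<in>I. borel)"
      using J A by (intro sets_PiM_I) auto
    then have B: "B \<in> sets R" unfolding B_def by (rule measurable_sets[OF \<Psi>])
    have "indicator B x = (\<Prod>j\<in>J. indicator (A j) (y j x) :: real)" if "x \<in> space R" for x
    proof -
      have "x \<in> B \<longleftrightarrow> (\<forall>j\<in>J. y j x \<in> A j)"
        using that J by (auto simp: B_def prod_emb_def \<Psi>_def space_PiM PiE_iff extensional_def subset_iff restrict_def)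
      then show ?thesis using J(1) by (auto simp: indicator_def prod_zero_iff)
    qed
    then have "(\<integral>x. G x * indicator B x \<partial>R) = (\<integral>x. G x * (\<Prod>j\<in>J. indicator (A j) (y j x)) \<partial>R)"
      by (intro Bochner_Integration.integral_cong refl) auto
    also have "\<dots> = 0"
      by (rule cylinder_integral_zero[OF G y zero J A])
    finally have "emeasure (\<nu> 1) B = emeasure (\<nu> (- 1)) B" by (rule split[OF B])
    then show "emeasure (distr (\<nu> 1) (\<Pi>\<^sub>M i\<in>I. borel) \<Psi>) (prod_emb I (\<lambda>_. borel) J (Pi\<^sub>E J A))
        = emeasure (distr (\<nu> (- 1)) (\<Pi>\<^sub>M i\<in>I. borel) \<Psi>) (prod_emb I (\<lambda>_. borel) J (Pi\<^sub>E J A))"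
      using c by (simp add: emeasure_distr[OF \<Psi>\<nu>] B_def sets_\<nu>)
  next
    show "finite_measure (distr (\<nu> 1) (\<Pi>\<^sub>M i\<in>I. borel) \<Psi>)"
    proof (rule finite_measure.finite_measure_distr[OF _ \<Psi>\<nu>])
      show "finite_measure (\<nu> 1)" using fin[of 1] by (intro finite_measureI) (simp add: sets_\<nu>)
    qed
  qed simp_all
  then have *: "distr (distr (\<nu> 1) (\<Pi>\<^sub>M i\<in>I. borel) \<Psi>) R F = distr (distr (\<nu> (- 1)) (\<Pi>\<^sub>M i\<in>I. borel) \<Psi>) R F" by simp
  \<comment> \<open>Recovery of points from coordinates transports the equality of the images back
    to the original measures.\<close>
  have pull_back: "distr (distr (\<nu> e) (\<Pi>\<^sub>M i\<in>I. borel) \<Psi>) R F = \<nu> e" for e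
  proof -
    have "distr (distr (\<nu> e) (\<Pi>\<^sub>M i\<in>I. borel) \<Psi>) R F = distr (\<nu> e) R (F \<circ> \<Psi>)"
      by (rule distr_distr[OF F \<Psi>\<nu>])
    also have "\<dots> = distr (\<nu> e) (\<nu> e) (\<lambda>x. x)"
      using recover by (intro distr_cong) (auto simp: sets_\<nu> \<Psi>_def)
    finally show ?thesis by (simp add: distr_id)
  qed
  have "\<nu> 1 = \<nu> (- 1)" using * unfolding pull_back .
  then have "AE x in R. ennreal (1 * G x) = ennreal (- 1 * G x)"
    unfolding \<nu>_def by (subst (asm) density_unique_iff) auto
  then show ?thesis
  proof eventually_elim
    case (elim x)
    then show ?case
      by (cases "G x \<ge> 0") (auto simp: ennreal_neg ennreal_eq_0_iff)
  qed
qed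

section \<open>Nondegeneracy of the quadratic form\<close>

text \<open>Partial sums are orthogonal projections, so one that covers the finitely many indices of
  an approximating \<open>u\<close> in the span is at least as close to \<open>w\<close> as
  \<open>u\<close>.\<close>

lemma orthonormal_expansion:
  fixes \<phi> :: "nat \<Rightarrow> 'b::real_inner"
  assumes basis: "orthonormal_basis J \<phi>"
  shows "(\<lambda>n. \<Sum>k\<in>J \<inter> {..<n}. (w \<bullet> \<phi> k) *\<^sub>R \<phi> k) \<longlonglongrightarrow> w"
proof (rule LIMSEQ_I)
  fix e :: real assume e: "0 < e"
  have on: "\<phi> j \<bullet> \<phi> k = (if j = k then 1 else 0)" if "j \<in> J" "k \<in> J" for j k
    using basis that by (auto simp: orthonormal_basis_def)
  have "w \<in> closure (span (\<phi> ` J))" using basis by (simp add: orthonormal_basis_def)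
  then obtain u where u: "u \<in> span (\<phi> ` J)" "dist u w < e" using e by (auto simp: closure_approachable)
  from u(1) have "\<exists>K c. finite K \<and> K \<subseteq> J \<and> u = (\<Sum>k\<in>K. c k *\<^sub>R \<phi> k)"
  proof (induction rule: span_induct_alt)
    case base
    show ?case by (rule exI[of _ "{}"]) simp
  next
    case (step r x y)
    then obtain K c k where K: "finite K" "K \<subseteq> J" "y = (\<Sum>k\<in>K. c k *\<^sub>R \<phi> k)" "k \<in> J" "x = \<phi> k" by auto
    define c' where "c' j = (if j \<in> K then c j else 0) + (if j = k then r else 0)" for j
    have "(\<Sum>j\<in>insert k K. c' j *\<^sub>R \<phi> j)
        = (\<Sum>j\<in>insert k K. (if j \<in> K then c j else 0) *\<^sub>R \<phi> j) + (\<Sum>j\<in>insert k K. (if j = k then r else 0) *\<^sub>R \<phi> j)"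
      by (simp add: c'_def scaleR_add_left sum.distrib del: sum.insert)
    also have "(\<Sum>j\<in>insert k K. (if j \<in> K then c j else 0) *\<^sub>R \<phi> j) = (\<Sum>j\<in>K. c j *\<^sub>R \<phi> j)"
      using K(1) by (intro sum.mono_neutral_cong_right) auto
    also have "(\<Sum>j\<in>insert k K. (if j = k then r else 0) *\<^sub>R \<phi> j) = (\<Sum>j\<in>{k}. r *\<^sub>R \<phi> j)"
      using K(1) by (intro sum.mono_neutral_cong_right) auto
    finally have "r *\<^sub>R x + y = (\<Sum>j\<in>insert k K. c' j *\<^sub>R \<phi> j)" using K by (simp add: add.commute)
    then show ?case using K by (intro exI[of _ "insert k K"] exI[of _ c']) auto
  qed
  then obtain K c where K: "finite K" "K \<subseteq> J" "u = (\<Sum>k\<in>K. c k *\<^sub>R \<phi> k)" by blast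
  obtain m where m: "K \<subseteq> {..<m}" using finite_nat_bounded[OF K(1)] by blast
  show "\<exists>no. \<forall>n\<ge>no. norm ((\<Sum>k\<in>J \<inter> {..<n}. (w \<bullet> \<phi> k) *\<^sub>R \<phi> k) - w) < e"
  proof (intro exI[of _ m] allI impI)
    fix n assume n: "n \<ge> m"
    define L where "L = J \<inter> {..<n}"
    define s where "s = (\<Sum>k\<in>L. (w \<bullet> \<phi> k) *\<^sub>R \<phi> k)"
    have KL: "K \<subseteq> L" using K m n by (auto simp: L_def)
    have fin: "finite L" by (simp add: L_def)
    have orth: "(w - s) \<bullet> \<phi> j = 0" if "j \<in> L" for j
    proof -
      have "s \<bullet> \<phi> j = (\<Sum>k\<in>L. if k = j then w \<bullet> \<phi> k else 0)"
        unfolding s_def inner_sum_left using that on by (intro sum.cong) (auto simp: L_def)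
      then show ?thesis using that fin by (simp add: inner_diff_left)
    qed
    have su: "(w - s) \<bullet> (s - u) = 0"
    proof -
      have "(w - s) \<bullet> s = 0" unfolding s_def[of] inner_sum_right
        by (subst s_def[symmetric], intro sum.neutral) (use orth in auto)
      moreover have "(w - s) \<bullet> u = 0" unfolding K(3) inner_sum_right
        using KL by (intro sum.neutral) (use orth in auto)
      ultimately show ?thesis by (simp add: inner_diff_right)
    qed
    have "(norm (w - u))\<^sup>2 = (norm ((w - s) + (s - u)))\<^sup>2" by simp
    also have "\<dots> = (norm (w - s))\<^sup>2 + (norm (s - u))\<^sup>2"
      unfolding power2_norm_eq_inner inner_add using su by (simp add: inner_commute)
    finally have "(norm (w - s))\<^sup>2 \<le> (norm (w - u))\<^sup>2" by simp
    then have "norm (w - s) \<le> norm (w - u)" by (rule power2_le_imp_le) simp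
    then show "norm ((\<Sum>k\<in>J \<inter> {..<n}. (w \<bullet> \<phi> k) *\<^sub>R \<phi> k) - w) < e"
      using u(2) by (simp add: s_def L_def dist_norm norm_minus_commute)
  qed
qed

context iid_sample
begin

text \<open>The Cauchy-Schwarz argument for semidefinite forms: with the point \<open>y\<close>
  weighted by t c, \<open>psd_quadratic\<close> gives 0 <= 2 t L + t^2 q for all t, which forces L =
  0.\<close>

lemma psd_form_zero:
  fixes k :: "'x \<Rightarrow> 'x \<Rightarrow> real" and F :: "'x \<Rightarrow> 'u::{real_inner, banach, second_countable_topology}"
  assumes psd: "psd TYPE('u) k"
    and meas: "(\<lambda>p. k (fst p) (snd p)) \<in> borel_measurable (P \<Otimes>\<^sub>M P)" "F \<in> borel_measurable P"
    and bound: "\<And>x y. \<bar>k x y\<bar> \<le> B" and sym: "\<And>x y. k x y = k y x"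
    and F2: "integrable P (\<lambda>x. (norm (F x))\<^sup>2)" and y: "y \<in> space P"
    and zero: "(\<integral>p. (F (fst p) \<bullet> F (snd p)) * k (fst p) (snd p) \<partial>(P \<Otimes>\<^sub>M P)) \<le> 0"
  shows "(\<integral>x. (F x \<bullet> c) * k x y \<partial>P) = 0"
proof (rule ccontr)
  define L where "L = (\<integral>x. (F x \<bullet> c) * k x y \<partial>P)"
  define q where "q = (c \<bullet> c) * k y y"
  \<comment> \<open>A positive bound for \<open>q\<close>, which may itself be 0; t = -L/r then
    makes the quadratic at most -L^2/r.\<close>
  define r where "r = \<bar>q\<bar> + 1"
  have r: "r > 0" "q \<le> r" by (simp_all add: r_def)
  define t where "t = - L / r"
  assume "(\<integral>x. (F x \<bullet> c) * k x y \<partial>P) \<noteq> 0"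
  then have L: "L\<^sup>2 > 0" by (simp add: L_def)
  have "0 \<le> 2 * (\<integral>x. (F x \<bullet> (t *\<^sub>R c)) * k x y \<partial>P) + ((t *\<^sub>R c) \<bullet> (t *\<^sub>R c)) * k y y"
    using psd_quadratic[OF psd meas bound sym F2 y, of "t *\<^sub>R c"] zero by linarith
  also have "\<dots> = 2 * t * L + t\<^sup>2 * q"
    by (simp add: L_def q_def power2_eq_square mult.assoc)
  also have "t\<^sup>2 * q \<le> t\<^sup>2 * r" using r by (intro mult_left_mono) auto
  also have "2 * t * L + t\<^sup>2 * r = - (L\<^sup>2 / r)"
    using r by (simp add: t_def field_simps power2_eq_square)
  also have "\<dots> < 0" using L r by simp
  finally show False by simp
qed

end

lemma borel_fst: "fst \<in> borel_measurable (borel :: ('a::topological_space \<times> 'b::topological_space) measure)"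
  and borel_snd: "snd \<in> borel_measurable (borel :: ('a::topological_space \<times> 'b::topological_space) measure)"
  by (intro borel_measurable_continuous_onI continuous_intros)+

text \<open>The null sets are collected over a countable dense set. A nonzero vector cannot be
  orthogonal to all of it, because some member lies closer to the vector than its norm.\<close>

lemma AE_zero_if_inner_zero:
  fixes F :: "'x \<Rightarrow> 'u::{real_inner, second_countable_topology}"
  assumes "\<And>c. AE x in R. F x \<bullet> c = 0"
  shows "AE x in R. F x = 0"
proof -
  obtain B :: "'u set" where B: "countable B" "\<And>X. open X \<Longrightarrow> X \<noteq> {} \<Longrightarrow> \<exists>d\<in>B. d \<in> X"
    using countable_dense_exists by blast
  have "AE x in R. \<forall>c\<in>B. F x \<bullet> c = 0" using assms B(1) by (simp add: AE_ball_countable)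
  then show ?thesis
  proof eventually_elim
    case (elim x)
    show ?case
    proof (rule ccontr)
      assume nz: "F x \<noteq> 0"
      then obtain d where d: "d \<in> B" "d \<in> ball (F x) (norm (F x))" using B(2)[of "ball (F x) (norm (F x))"] by auto
      have "(norm (F x))\<^sup>2 = F x \<bullet> (F x - d)"
        using elim d(1) by (simp add: power2_norm_eq_inner inner_diff_right)
      also have "\<dots> \<le> norm (F x) * norm (F x - d)" by (rule norm_cauchy_schwarz)
      also have "\<dots> < norm (F x) * norm (F x)"
        using d(2) nz by (intro mult_strict_left_mono) (auto simp: dist_norm)
      finally show False by (simp add: power2_eq_square)
    qed
  qed
qed

text \<open>The frequency profile of the quadratic form of the alternative: \<open>S\<close> reads
  the regressors off an observation, the Gaussian weight is kept, and the kernel in Z is replaced by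
  a cosine.\<close>

definition spectral_form ::
  "nat set \<Rightarrow> (nat \<Rightarrow> 'w::real_inner) \<Rightarrow> (nat \<Rightarrow> real) \<Rightarrow> 'x measure \<Rightarrow>
   ('x \<Rightarrow> (real ^ 'q::finite) \<times> 'w) \<Rightarrow> ((real ^ 'q) \<times> 'w \<Rightarrow> 'u::real_inner) \<Rightarrow> real ^ 'q \<Rightarrow> real" where
  "spectral_form J \<phi> a P S D s =
    (\<integral>p. ((D (S (fst p)) \<bullet> D (S (snd p))) * exp (- sq_norm_A J \<phi> a (snd (S (fst p)) - snd (S (snd p))) / 2))
      * cos (s \<bullet> (fst (S (fst p)) - fst (S (snd p)))) \<partial>(P \<Otimes>\<^sub>M P))"

context
  fixes J :: "nat set" and \<phi> :: "nat \<Rightarrow> 'w::{real_inner, banach, second_countable_topology}" and a :: "nat \<Rightarrow> real"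
  assumes basis: "orthonormal_basis J \<phi>" and a_pos: "\<And>k. k \<in> J \<Longrightarrow> 0 < a k" and a_sum: "a summable_on J"
begin

abbreviation (input) "normA \<equiv> sq_norm_A J \<phi> a"
abbreviation (input) "innA \<equiv> inner_A J \<phi> a"

lemma innA_commute: "innA v w = innA w v"
  by (rule inner_A_commute[OF basis a_pos a_sum])

lemma normA_diff: "normA (v - w) = normA v + normA w - 2 * innA v w"
  by (rule sq_norm_A_diff[OF basis a_pos a_sum])

lemma innA_linear: "innA (r *\<^sub>R u + v) w = r * innA u w + innA v w"
proof -
  have "innA (r *\<^sub>R u + v) w = innA (r *\<^sub>R u) w + innA v w" by (rule inner_A_add_left[OF basis a_pos a_sum])
  also have "innA (r *\<^sub>R u) w = r * innA u w" by (rule inner_A_scale_left[OF basis a_pos a_sum])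
  finally show ?thesis .
qed

lemma innA_basis: "k \<in> J \<Longrightarrow> innA w (\<phi> k) = a k * (w \<bullet> \<phi> k)"
proof -
  assume k: "k \<in> J"
  have "innA w (\<phi> k) = (\<Sum>\<^sub>\<infinity>j\<in>{k}. a j * ((w \<bullet> \<phi> j) * (\<phi> k \<bullet> \<phi> j)))"
    unfolding inner_A_def using k basis
    by (intro infsum_cong_neutral) (auto simp: orthonormal_basis_def)
  then show ?thesis using k basis by (simp add: orthonormal_basis_def)
qed

text \<open>Dividing by \<open>a k\<close> undoes the weights, so every finite linear combination of
  coordinates is a pairing with some vector.\<close>

lemma innA_sum:
  assumes "finite K" "K \<subseteq> J"
  shows "innA w (\<Sum>k\<in>K. (b k / a k) *\<^sub>R \<phi> k) = (\<Sum>k\<in>K. b k * (w \<bullet> \<phi> k))"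
  using assms
proof (induction K rule: finite_induct)
  case empty
  show ?case by (simp add: inner_A_def)
next
  case (insert k K)
  have "innA w (\<Sum>k\<in>insert k K. (b k / a k) *\<^sub>R \<phi> k)
      = innA ((b k / a k) *\<^sub>R \<phi> k + (\<Sum>k\<in>K. (b k / a k) *\<^sub>R \<phi> k)) w"
    using insert.hyps by (simp add: innA_commute[of w])
  also have "\<dots> = (b k / a k) * innA w (\<phi> k) + innA w (\<Sum>k\<in>K. (b k / a k) *\<^sub>R \<phi> k)"
    unfolding innA_linear by (simp add: innA_commute[of _ w])
  finally show ?case
    using insert a_pos[of k] innA_basis[of k w] by simp
qed

text \<open>Completing the square: the Laplace factor amounts to recentring the Gaussian at \<tau>
  v.\<close>

lemma exp_gauss_shift:
  "exp (- normA w / 2) * exp (\<tau> * innA w v) = exp (\<tau>\<^sup>2 * normA v / 2) * exp (- normA (w - \<tau> *\<^sub>R v) / 2)"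
proof -
  have 1: "normA (\<tau> *\<^sub>R v) = \<tau>\<^sup>2 * normA v"
    by (simp add: sq_norm_A_def infsum_cmult_right'[symmetric] power_mult_distrib mult_ac)
  have 2: "innA w (\<tau> *\<^sub>R v) = \<tau> * innA w v"
    unfolding innA_commute[of w] by (rule inner_A_scale_left[OF basis a_pos a_sum])
  show ?thesis
    unfolding normA_diff 1 2 exp_add[symmetric] by (simp add: field_simps)
qed

lemma normA_meas[measurable]: "normA \<in> borel_measurable borel"
  by (rule borel_measurable_sq_norm_A[OF basis a_pos a_sum])

lemma normA_nonneg: "0 \<le> normA w"
  by (rule sq_norm_A_nonneg[OF basis a_pos a_sum])

lemma innA_meas[measurable]: "(\<lambda>w. innA w v) \<in> borel_measurable borel"
proof -
  have "innA w v = (normA w + normA v - normA (w - v)) / 2" for w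
    using normA_diff[of w v] by simp
  then have "(\<lambda>w. innA w v) = (\<lambda>w. (normA w + normA v - normA (w - v)) / 2)" by blast
  also have "\<dots> \<in> borel_measurable borel" by measurable
  finally show ?thesis .
qed

text \<open>Coordinates in \<open>real ^ 'q\<close> and along the orthonormal basis determine the
  point, so \<open>fourier_zero_imp_AE_zero\<close> applies; by \<open>innA_sum\<close> the
  frequencies (s, v) cover all finite trigonometric exponents in these coordinates.\<close>

lemma fourier_zero_imp_AE_zero_Hilbert:
  fixes G :: "(real ^ 'q::finite) \<times> 'w \<Rightarrow> real"
  assumes R: "prob_space R" and sets_R: "sets R = sets borel"
    and G: "integrable R G"
    and zero: "\<And>s v. (\<integral>x. complex_of_real (G x) * cis (s \<bullet> fst x + innA (snd x) v) \<partial>R) = 0"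
  shows "AE x in R. G x = 0"
proof -
  interpret prob_space R by (rule R)
  define I :: "('q + nat) set" where "I = UNIV <+> J"
  define y where "y j x = (case j of Inl i \<Rightarrow> fst x $ i | Inr k \<Rightarrow> snd x \<bullet> \<phi> k)"
    for j :: "'q + nat" and x :: "(real ^ 'q) \<times> 'w"
  have meas_eq: "f \<in> measurable R N' \<longleftrightarrow> f \<in> measurable borel N'" for f and N' :: "'n measure"
    by (rule measurable_cong_sets[OF sets_R refl, THEN arg_cong])
  \<comment> \<open>The inverse of the coordinate map; its Hilbert component is the limit of the
    basis expansion and therefore measurable.\<close>
  define E where "E f = ((\<Sum>i\<in>UNIV. f (Inl i) *\<^sub>R axis i (1 :: real)) :: real ^ 'q,
      lim (\<lambda>n. \<Sum>k\<in>J \<inter> {..<n}. f (Inr k) *\<^sub>R \<phi> k))" for f :: "'q + nat \<Rightarrow> real"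
  show ?thesis
  proof (rule fourier_zero_imp_AE_zero[where I = I and y = y and F = E])
    show "sigma_finite_measure R" by unfold_locales
    show "y i \<in> borel_measurable R" for i
      unfolding meas_eq y_def[abs_def]
      by (cases i) (auto intro!: borel_measurable_continuous_onI continuous_intros)
    show "(\<integral>x. complex_of_real (G x) * cis (\<Sum>j\<in>L. t j * y j x) \<partial>R) = 0" if L: "finite L" "L \<subseteq> I" for L t
    proof -
      define s where "s = (\<chi> i. if Inl i \<in> L then t (Inl i) else 0)"
      define K where "K = {k. Inr k \<in> L}"
      define v where "v = (\<Sum>k\<in>K. (t (Inr k) / a k) *\<^sub>R \<phi> k)"
      have K: "finite K" "K \<subseteq> J"
        using L finite_vimageI[of L Inr] by (auto simp: K_def I_def vimage_def)
      have LU: "L = Inl ` {i. Inl i \<in> L} \<union> Inr ` K"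
        using L by (auto simp: K_def image_iff) (metis sumE)
      have "(\<Sum>j\<in>L. t j * y j x) = s \<bullet> fst x + innA (snd x) v" for x
      proof -
        have "(\<Sum>j\<in>L. t j * y j x) = (\<Sum>j\<in>Inl ` {i. Inl i \<in> L}. t j * y j x) + (\<Sum>j\<in>Inr ` K. t j * y j x)"
          using K by (subst LU, intro sum.union_disjoint) auto
        also have "(\<Sum>j\<in>Inr ` K. t j * y j x) = innA (snd x) v"
          unfolding v_def innA_sum[OF K] by (simp add: sum.reindex y_def)
        also have "(\<Sum>j\<in>Inl ` {i. Inl i \<in> L}. t j * y j x) = (\<Sum>i\<in>{i. Inl i \<in> L}. t (Inl i) * (fst x $ i))"
          by (simp add: sum.reindex y_def)
        also have "\<dots> = (\<Sum>i\<in>UNIV. (if Inl i \<in> L then t (Inl i) else 0) * (fst x $ i))"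
          by (intro sum.mono_neutral_cong_left) auto
        also have "\<dots> = s \<bullet> fst x" by (simp add: s_def inner_vec_def)
        finally show ?thesis .
      qed
      then show ?thesis using zero by simp
    qed
    show "E \<in> measurable (\<Pi>\<^sub>M i\<in>I. borel) R"
    proof -
      have [measurable]: "(\<lambda>f. f (Inl i)) \<in> borel_measurable (\<Pi>\<^sub>M i\<in>I. borel)" for i :: 'q
        by (rule measurable_component_singleton) (auto simp: I_def)
      have [measurable]: "(\<lambda>f. f (Inr k)) \<in> borel_measurable (\<Pi>\<^sub>M i\<in>I. borel)" if "k \<in> J" for k
        using that by (intro measurable_component_singleton) (auto simp: I_def)
      have 1: "(\<lambda>f. \<Sum>i\<in>UNIV. f (Inl i) *\<^sub>R axis i (1 :: real) :: real ^ 'q) \<in> borel_measurable (\<Pi>\<^sub>M i\<in>I. borel)"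
        by measurable
      have "(\<lambda>f. \<Sum>k\<in>J \<inter> {..<n}. f (Inr k) *\<^sub>R \<phi> k) \<in> borel_measurable (\<Pi>\<^sub>M i\<in>I. borel)" for n
        by (rule borel_measurable_sum) auto
      then have 2: "(\<lambda>f. lim (\<lambda>n. \<Sum>k\<in>J \<inter> {..<n}. f (Inr k) *\<^sub>R \<phi> k)) \<in> borel_measurable (\<Pi>\<^sub>M i\<in>I. borel)"
        by (rule borel_measurable_lim_metric)
      have "E \<in> borel_measurable (\<Pi>\<^sub>M i\<in>I. borel)"
        unfolding E_def[abs_def] by (rule borel_measurable_Pair[OF 1 2])
      then show ?thesis by (simp add: measurable_cong_sets[OF refl sets_R])
    qed
    fix x assume "x \<in> space R"
    have "(\<lambda>i\<in>I. y i x) (Inl i) = fst x $ i" for i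
      by (auto simp: I_def y_def)
    then have "(\<Sum>i\<in>UNIV. (\<lambda>i\<in>I. y i x) (Inl i) *\<^sub>R axis i (1 :: real)) = fst x"
      using basis_expansion[of "fst x"] by (simp add: scalar_mult_eq_scaleR)
    moreover have "(\<Sum>k\<in>J \<inter> {..<n}. (\<lambda>i\<in>I. y i x) (Inr k) *\<^sub>R \<phi> k) = (\<Sum>k\<in>J \<inter> {..<n}. (snd x \<bullet> \<phi> k) *\<^sub>R \<phi> k)" for n
      by (intro sum.cong refl) (auto simp: I_def y_def)
    ultimately show "E (\<lambda>i\<in>I. y i x) = x"
      using limI[OF orthonormal_expansion[OF basis, of "snd x"]] by (simp add: E_def)
  qed (rule G)
qed

context
  fixes M :: "'a measure" and X :: "nat \<Rightarrow> 'a \<Rightarrow> 'x" and P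
    and S :: "'x \<Rightarrow> (real ^ 'q::finite) \<times> 'w" and D :: "(real ^ 'q) \<times> 'w \<Rightarrow> 'u::{real_inner, banach, second_countable_topology}"
  assumes iid: "iid_sample M X P"
    and S[measurable]: "S \<in> borel_measurable P" and S_surj: "\<And>s. \<exists>y\<in>space P. S y = s"
    and D[measurable]: "D \<in> borel_measurable borel"
    and D2: "integrable P (\<lambda>x. (norm (D (S x)))\<^sup>2)"
begin

interpretation iid_sample M X P by (rule iid)

lemma gauss_le_1: "exp (- normA w / 2) \<le> 1"
  using normA_nonneg[of w] by simp

lemma spectral_kernel:
  fixes s
  defines "\<kappa> \<equiv> \<lambda>x y. exp (- normA (snd (S x) - snd (S y)) / 2) * cos (s \<bullet> (fst (S x) - fst (S y)))"
  shows "psd TYPE('u) \<kappa>" "(\<lambda>p. \<kappa> (fst p) (snd p)) \<in> borel_measurable (P \<Otimes>\<^sub>M P)"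
    "\<bar>\<kappa> x y\<bar> \<le> 1" "\<kappa> x y = \<kappa> y x"
proof -
  have "psd TYPE('u) (\<lambda>x y. (exp (- normA (snd (S x) - snd (S y)) / 2) * 1) * cos (s \<bullet> fst (S x) - s \<bullet> fst (S y)))"
    by (intro psd_cos psd_gauss[OF basis a_pos a_sum] psd_one)
  then show "psd TYPE('u) \<kappa>" by (simp add: \<kappa>_def inner_diff_right)
  have [measurable]: "(\<lambda>x. fst (S x)) \<in> borel_measurable P" "(\<lambda>x. snd (S x)) \<in> borel_measurable P"
    using measurable_compose[OF S borel_fst] measurable_compose[OF S borel_snd] by auto
  show "(\<lambda>p. \<kappa> (fst p) (snd p)) \<in> borel_measurable (P \<Otimes>\<^sub>M P)" unfolding \<kappa>_def by measurable
  show "\<bar>\<kappa> x y\<bar> \<le> 1"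
    unfolding \<kappa>_def abs_mult using gauss_le_1 by (intro mult_le_one) auto
  have "normA (snd (S x) - snd (S y)) = normA (snd (S y) - snd (S x))"
    unfolding normA_diff by (simp add: innA_commute)
  moreover have "cos (s \<bullet> (fst (S x) - fst (S y))) = cos (s \<bullet> (fst (S y) - fst (S x)))"
    using cos_minus[of "s \<bullet> (fst (S x) - fst (S y))"] by (simp add: inner_diff_right)
  ultimately show "\<kappa> x y = \<kappa> y x" by (simp add: \<kappa>_def)
qed

lemma spectral_form_nonneg: "0 \<le> spectral_form J \<phi> a P S D s"
proof -
  obtain y where y: "y \<in> space P" using S_surj by blast
  show ?thesis
    using psd_quadratic[OF spectral_kernel(1,2) _ spectral_kernel(3,4) D2 y, of s 0]
    by (simp add: spectral_form_def mult.assoc)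
qed

lemma spectral_form_zero_imp_AE_zero:
  assumes zero: "\<And>s. spectral_form J \<phi> a P S D s \<le> 0"
  shows "AE x in P. D (S x) = 0"
proof (rule AE_zero_if_inner_zero)
  fix c :: 'u
  have [measurable]: "(\<lambda>x. fst (S x)) \<in> borel_measurable P" "(\<lambda>x. snd (S x)) \<in> borel_measurable P"
    using measurable_compose[OF S borel_fst] measurable_compose[OF S borel_snd] by auto
  have DS[measurable]: "(\<lambda>x. D (S x)) \<in> borel_measurable P" by measurable
  have Dc: "integrable P (\<lambda>x. D (S x) \<bullet> c)"
  proof -
    have "integrable P (\<lambda>x. norm (D (S x)))"
      by (rule P.square_integrable_imp_integrable) (use D2 in auto)
    then have "integrable P (\<lambda>x. D (S x))" by (simp add: integrable_norm_iff)
    then show ?thesis by simp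
  qed
  have key: "(\<integral>x. (D (S x) \<bullet> c) * (exp (- normA (snd (S x) - w') / 2) * cos (s \<bullet> (fst (S x) - z'))) \<partial>P) = 0" for s z' w'
  proof -
    \<comment> \<open>Surjectivity of \<open>S\<close> lets the deterministic point of
      \<open>psd_form_zero\<close> have arbitrary regressor values.\<close>
    obtain y where y: "y \<in> space P" "S y = (z', w')" using S_surj by blast
    show ?thesis
      using psd_form_zero[OF spectral_kernel(1,2) DS spectral_kernel(3,4) D2 y(1), of s c] zero[of s] y(2)
      by (simp add: spectral_form_def mult.assoc)
  qed
  have keyS: "(\<integral>x. (D (S x) \<bullet> c) * (exp (- normA (snd (S x) - w') / 2) * sin (s \<bullet> fst (S x))) \<partial>P) = 0" for s w'
  proof (cases "s = 0")
    case True
    then show ?thesis by simp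
  next
    case False
    \<comment> \<open>The point z' is chosen with s . z' = pi/2, which shifts the cosine to a
      sine.\<close>
    have "cos (s \<bullet> (z - (pi / (2 * (s \<bullet> s))) *\<^sub>R s)) = sin (s \<bullet> z)" for z
      using False by (simp add: inner_diff_right cos_diff)
    then show ?thesis using key[of w' s "(pi / (2 * (s \<bullet> s))) *\<^sub>R s"] by simp
  qed
  have keyC: "(\<integral>x. (D (S x) \<bullet> c) * (exp (- normA (snd (S x) - w') / 2) * cos (s \<bullet> fst (S x))) \<partial>P) = 0" for s w'
    using key[of w' s 0] by simp
  have int: "integrable P (\<lambda>x. (D (S x) \<bullet> c) * (exp (- normA (snd (S x) - w') / 2) * f (s \<bullet> fst (S x))))"
    if f: "\<And>u. \<bar>f u\<bar> \<le> 1" and [measurable]: "f \<in> borel_measurable borel" for f :: "real \<Rightarrow> real" and w' s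
  proof (rule Bochner_Integration.integrable_bound[OF Dc])
    have "\<bar>exp (- normA (snd (S x) - w') / 2) * f (s \<bullet> fst (S x))\<bar> \<le> 1" for x
      unfolding abs_mult using gauss_le_1 f by (intro mult_le_one) auto
    then show "AE x in P. norm ((D (S x) \<bullet> c) * (exp (- normA (snd (S x) - w') / 2) * f (s \<bullet> fst (S x)))) \<le> norm (D (S x) \<bullet> c)"
      by (intro AE_I2) (metis abs_ge_zero abs_mult mult_left_le real_norm_def)
  qed measurable
  define g where "g f s x = (D (S x) \<bullet> c) * exp (- normA (snd (S x)) / 2) * f (s \<bullet> fst (S x))"
    for f :: "real \<Rightarrow> real" and s x
  \<comment> \<open>Taking w' = \<tau> v for all real \<tau> says, by
    \<open>exp_gauss_shift\<close>, that the Laplace transform of <W, v>_A weighted by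
    \<open>g f s\<close> vanishes; passing to the imaginary axis gives the Fourier factor in the
    Hilbert variable.\<close>
  have lap: "(\<integral>x. complex_of_real (g f s x) * cis (innA (snd (S x)) v) \<partial>P) = 0"
    if f: "\<And>u. \<bar>f u\<bar> \<le> 1" and [measurable]: "f \<in> borel_measurable borel"
      and z: "\<And>s w'. (\<integral>x. (D (S x) \<bullet> c) * (exp (- normA (snd (S x) - w') / 2) * f (s \<bullet> fst (S x))) \<partial>P) = 0"
    for f s v
  proof (rule laplace_zero_imp_fourier_zero)
    show "g f s \<in> borel_measurable P" unfolding g_def by measurable
    show "(\<lambda>x. innA (snd (S x)) v) \<in> borel_measurable P" by measurable
    fix \<tau> :: real
    have e: "g f s x * exp (\<tau> * innA (snd (S x)) v) = exp (\<tau>\<^sup>2 * normA v / 2) *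
        ((D (S x) \<bullet> c) * (exp (- normA (snd (S x) - \<tau> *\<^sub>R v) / 2) * f (s \<bullet> fst (S x))))" for x
    proof -
      have "g f s x * exp (\<tau> * innA (snd (S x)) v)
          = (exp (- normA (snd (S x)) / 2) * exp (\<tau> * innA (snd (S x)) v)) * ((D (S x) \<bullet> c) * f (s \<bullet> fst (S x)))"
        by (simp add: g_def mult_ac)
      then show ?thesis unfolding exp_gauss_shift by (simp add: mult_ac)
    qed
    show "integrable P (\<lambda>x. g f s x * exp (\<tau> * innA (snd (S x)) v))"
      unfolding e by (intro integrable_mult_right int f) measurable
    show "(\<integral>x. g f s x * exp (\<tau> * innA (snd (S x)) v) \<partial>P) = 0"
      unfolding e by (simp only: integral_mult_right_zero z mult_zero_right)
  qed
  \<comment> \<open>The Gaussian factor is positive, so \<open>G\<close> vanishes exactly where <D,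
    c> does.\<close>
  define G where "G x = (D x \<bullet> c) * exp (- normA (snd x) / 2)" for x
  have [measurable]: "G \<in> borel_measurable borel"
    unfolding G_def by (intro borel_measurable_times borel_measurable_inner) (auto intro!: measurable_compose[OF borel_snd])
  have GS: "integrable P (\<lambda>x. G (S x))"
    using int[of "\<lambda>_. 1" 0 0] by (simp add: G_def)
  define R where "R = distr P borel S"
  have "AE x in R. G x = 0"
  proof (rule fourier_zero_imp_AE_zero_Hilbert)
    show "prob_space R" unfolding R_def by (rule P.prob_space_distr) measurable
    show "sets R = sets borel" by (simp add: R_def)
    show "integrable R G" unfolding R_def using GS by (subst integrable_distr_eq) auto
    fix s v
    have c: "(\<integral>x. complex_of_real (g cos s x) * cis (innA (snd (S x)) v) \<partial>P) = 0"
      by (rule lap) (use keyC in auto)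
    have s: "(\<integral>x. complex_of_real (g sin s x) * cis (innA (snd (S x)) v) \<partial>P) = 0"
      by (rule lap) (use keyS in auto)
    have i: "integrable P (\<lambda>x. complex_of_real (g f s x) * cis (innA (snd (S x)) v))"
      if "f = cos \<or> f = sin" for f
    proof (rule Bochner_Integration.integrable_bound[OF GS])
      have [measurable]: "f \<in> borel_measurable borel" and f: "\<bar>f u\<bar> \<le> 1" for u using that by auto
      have [measurable]: "g f s \<in> borel_measurable P" unfolding g_def by measurable
      have [measurable]: "(\<lambda>x. cis (innA (snd (S x)) v)) \<in> borel_measurable P" unfolding cis_conv_exp by measurable
      show "(\<lambda>x. complex_of_real (g f s x) * cis (innA (snd (S x)) v)) \<in> borel_measurable P" by measurable
      show "AE x in P. norm (complex_of_real (g f s x) * cis (innA (snd (S x)) v)) \<le> norm (G (S x))"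
        using f by (intro AE_I2) (auto simp: g_def G_def norm_mult abs_mult intro!: mult_left_le)
    qed
    have [measurable]: "(\<lambda>x. cis (s \<bullet> fst x + innA (snd x) v)) \<in> borel_measurable borel"
    proof -
      have "(\<lambda>x. s \<bullet> fst x + innA (snd x) v) \<in> borel_measurable borel"
        by (intro borel_measurable_add borel_measurable_inner measurable_compose[OF borel_snd innA_meas] borel_fst) auto
      then show ?thesis unfolding cis_conv_exp by measurable
    qed
    have "(\<integral>x. complex_of_real (G x) * cis (s \<bullet> fst x + innA (snd x) v) \<partial>R)
        = (\<integral>x. complex_of_real (G (S x)) * cis (s \<bullet> fst (S x) + innA (snd (S x)) v) \<partial>P)"
      unfolding R_def by (rule integral_distr) measurable
    also have "\<dots> = (\<integral>x. complex_of_real (g cos s x) * cis (innA (snd (S x)) v)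
        + \<i> * (complex_of_real (g sin s x) * cis (innA (snd (S x)) v)) \<partial>P)"
    proof (rule Bochner_Integration.integral_cong[OF refl])
      fix x
      have "cis (s \<bullet> fst (S x)) = complex_of_real (cos (s \<bullet> fst (S x))) + \<i> * complex_of_real (sin (s \<bullet> fst (S x)))"
        by (simp add: complex_eq_iff)
      then show "complex_of_real (G (S x)) * cis (s \<bullet> fst (S x) + innA (snd (S x)) v)
        = complex_of_real (g cos s x) * cis (innA (snd (S x)) v)
        + \<i> * (complex_of_real (g sin s x) * cis (innA (snd (S x)) v))"
        by (simp add: cis_mult[symmetric] G_def g_def algebra_simps)
    qed
    also have "\<dots> = 0" using i c s by simp
    finally show "(\<integral>x. complex_of_real (G x) * cis (s \<bullet> fst x + innA (snd x) v) \<partial>R) = 0" .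
  qed
  then have "AE x in P. G (S x) = 0" unfolding R_def by (rule AE_distrD[rotated]) measurable
  then show "AE x in P. D (S x) \<bullet> c = 0" by eventually_elim (simp add: G_def)
qed

end

end

section \<open>Consistency of the test\<close>

text \<open>\<open>is_cond_exp\<close> tests on sets only. Vector-valued simple functions dominated
  by 2 |H| extend the orthogonality to \<open>H\<close>, which may be unbounded as long as |U| |H|
  is integrable.\<close>

lemma is_cond_exp_zero_orthogonal:
  fixes U H :: "'a \<Rightarrow> 'u::{real_inner, banach, second_countable_topology}"
  assumes sub: "subalgebra M F" and ce: "is_cond_exp M F U (\<lambda>_. 0)"
    and H: "H \<in> borel_measurable F" and int: "integrable M (\<lambda>x. norm (U x) * norm (H x))"
  shows "(\<integral>x. U x \<bullet> H x \<partial>M) = 0"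
proof -
  have U: "integrable M U" and zero: "\<And>A. A \<in> sets F \<Longrightarrow> set_lebesgue_integral M A U = 0"
    using ce by (auto simp: is_cond_exp_def set_lebesgue_integral_def)
  have [measurable]: "U \<in> borel_measurable M" using U by simp
  have [measurable]: "H \<in> borel_measurable M" by (rule measurable_from_subalg[OF sub H])
  have space_F: "space F = space M" using sub by (simp add: subalgebra_def)
  obtain s where s: "\<And>i. simple_function F (s i)"
    "\<And>x. x \<in> space F \<Longrightarrow> (\<lambda>i. s i x) \<longlonglongrightarrow> H x"
    "\<And>i x. x \<in> space F \<Longrightarrow> dist (s i x) 0 \<le> 2 * dist (H x) 0"
    using borel_measurable_implies_sequence_metric[OF H, of 0] by blast
  have s_zero: "(\<integral>x. U x \<bullet> s i x \<partial>M) = 0" for i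
  proof -
    have fin: "finite (s i ` space F)" using s(1)[of i] by (simp add: simple_function_def)
    define A where "A c = s i -` {c} \<inter> space F" for c
    have A: "A c \<in> sets F" if "c \<in> s i ` space F" for c
      using s(1)[of i] that by (auto simp: A_def simple_function_def)
    then have A_M: "A c \<in> sets M" if "c \<in> s i ` space F" for c
      using that sub by (auto simp: subalgebra_def)
    have "(\<integral>x. U x \<bullet> s i x \<partial>M) = (\<integral>x. (\<Sum>c\<in>s i ` space F. (indicator (A c) x *\<^sub>R U x) \<bullet> c) \<partial>M)"
    proof (rule Bochner_Integration.integral_cong[OF refl])
      fix x assume x: "x \<in> space M"
      have "(\<Sum>c\<in>s i ` space F. (indicator (A c) x *\<^sub>R U x) \<bullet> c) = (\<Sum>c\<in>s i ` space F. if c = s i x then U x \<bullet> c else 0)"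
        using x by (intro sum.cong refl) (auto simp: A_def indicator_def space_F)
      then show "U x \<bullet> s i x = (\<Sum>c\<in>s i ` space F. (indicator (A c) x *\<^sub>R U x) \<bullet> c)"
        using fin x by (simp add: space_F)
    qed
    also have "\<dots> = (\<Sum>c\<in>s i ` space F. \<integral>x. (indicator (A c) x *\<^sub>R U x) \<bullet> c \<partial>M)"
      using A_M U by (intro Bochner_Integration.integral_sum integrable_inner_left integrable_mult_indicator) auto
    also have "\<dots> = (\<Sum>c\<in>s i ` space F. set_lebesgue_integral M (A c) U \<bullet> c)"
      using A_M U unfolding set_lebesgue_integral_def
      by (intro sum.cong refl integral_inner_left integrable_mult_indicator) auto
    also have "\<dots> = 0" using zero[OF A] by simp
    finally show ?thesis .
  qed
  have "(\<lambda>i. \<integral>x. U x \<bullet> s i x \<partial>M) \<longlonglongrightarrow> (\<integral>x. U x \<bullet> H x \<partial>M)"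
  proof (rule integral_dominated_convergence[where w = "\<lambda>x. 2 * (norm (U x) * norm (H x))"])
    show "(\<lambda>x. U x \<bullet> s i x) \<in> borel_measurable M" for i
    proof -
      have [measurable]: "s i \<in> borel_measurable M"
        by (rule measurable_from_subalg[OF sub borel_measurable_simple_function[OF s(1)]])
      show ?thesis by measurable
    qed
    show "AE x in M. (\<lambda>i. U x \<bullet> s i x) \<longlonglongrightarrow> U x \<bullet> H x"
      using s(2) by (intro AE_I2 tendsto_intros) (simp_all add: space_F)
    show "AE x in M. norm (U x \<bullet> s i x) \<le> 2 * (norm (U x) * norm (H x))" for i
    proof (rule AE_I2)
      fix x assume "x \<in> space M"
      then have "norm (s i x) \<le> 2 * norm (H x)" using s(3)[of x i] by (simp add: space_F)
      then have "norm (U x) * norm (s i x) \<le> norm (U x) * (2 * norm (H x))" by (intro mult_left_mono) auto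
      then show "norm (U x \<bullet> s i x) \<le> 2 * (norm (U x) * norm (H x))"
        using Cauchy_Schwarz_ineq2[of "U x" "s i x"] by simp
    qed
  qed (use int in simp_all)
  then show ?thesis unfolding s_zero using LIMSEQ_unique[OF tendsto_const] by metis
qed

text \<open>As \<nu> > 2, t^2 is at most 1 plus the \<nu>-th power of t for t >= 0; the conditional
  expectation of the latter is at most 1 + C.\<close>

lemma conditional_second_moment:
  fixes V :: "'a \<Rightarrow> 'u::{real_normed_vector, second_countable_topology}" and G :: "'a \<Rightarrow> ennreal"
  assumes M: "prob_space M" and sub: "subalgebra M F" and V[measurable]: "V \<in> borel_measurable M"
    and \<nu>: "2 < \<nu>" and C: "0 \<le> C"
    and ce: "AE x in M. nn_cond_exp M F (\<lambda>x. ennreal (norm (V x) powr \<nu>)) x \<le> ennreal C"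
    and G: "G \<in> borel_measurable F"
  shows "(\<integral>\<^sup>+x. ennreal ((norm (V x))\<^sup>2) * G x \<partial>M) \<le> (\<integral>\<^sup>+x. ennreal (1 + C) * G x \<partial>M)"
proof -
  interpret prob_space M by (rule M)
  interpret finite_measure_subalgebra M F by unfold_locales (rule sub)
  have [measurable]: "G \<in> borel_measurable M" by (rule measurable_from_subalg[OF sub G])
  have pow: "t\<^sup>2 \<le> 1 + t powr \<nu>" if "t \<ge> 0" for t :: real
  proof (cases "t \<le> 1")
    case True
    then have "t\<^sup>2 \<le> 1" using that by (simp add: power_le_one)
    moreover have "0 \<le> t powr \<nu>" by simp
    ultimately show ?thesis by linarith
  next
    case False
    then have "t\<^sup>2 = t powr 2" by (simp add: powr_numeral)
    also have "\<dots> \<le> t powr \<nu>" using False \<nu> by (intro powr_mono) auto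
    finally show ?thesis by simp
  qed
  have "(\<integral>\<^sup>+x. ennreal ((norm (V x))\<^sup>2) * G x \<partial>M) \<le> (\<integral>\<^sup>+x. G x + G x * ennreal (norm (V x) powr \<nu>) \<partial>M)"
  proof (rule nn_integral_mono)
    fix x
    have "ennreal ((norm (V x))\<^sup>2) \<le> 1 + ennreal (norm (V x) powr \<nu>)"
      using ennreal_leI[OF pow[of "norm (V x)"]] by (simp add: ennreal_plus)
    from mult_right_mono[OF this, of "G x"]
    show "ennreal ((norm (V x))\<^sup>2) * G x \<le> G x + G x * ennreal (norm (V x) powr \<nu>)"
      by (simp add: distrib_left mult.commute)
  qed
  also have "\<dots> = (\<integral>\<^sup>+x. G x \<partial>M) + (\<integral>\<^sup>+x. G x * ennreal (norm (V x) powr \<nu>) \<partial>M)"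
    by (rule nn_integral_add) measurable
  also have "(\<integral>\<^sup>+x. G x * ennreal (norm (V x) powr \<nu>) \<partial>M)
      = (\<integral>\<^sup>+x. G x * nn_cond_exp M F (\<lambda>x. ennreal (norm (V x) powr \<nu>)) x \<partial>M)"
    by (rule nn_cond_exp_intg[symmetric, OF G]) measurable
  also have "\<dots> \<le> (\<integral>\<^sup>+x. G x * ennreal C \<partial>M)"
    using ce by (intro nn_integral_mono_AE) (auto elim!: eventually_mono intro: mult_left_mono)
  also have "(\<integral>\<^sup>+x. G x \<partial>M) + (\<integral>\<^sup>+x. G x * ennreal C \<partial>M) = (\<integral>\<^sup>+x. G x + G x * ennreal C \<partial>M)"
    by (rule nn_integral_add[symmetric]) measurable
  also have "\<dots> = (\<integral>\<^sup>+x. ennreal (1 + C) * G x \<partial>M)"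
    using C by (intro nn_integral_cong) (simp add: ennreal_plus distrib_left mult.commute)
  finally show ?thesis by (simp add: add_left_mono)
qed

section \<open>Transfer to the sample: positivity, versions of the kernel and tail bounds\<close>

context fourier_kernel
begin

text \<open>By inversion the kernel is a mixture of cosines with weights c0 ftv(t) > 0, so
  positivity follows from \<open>psd_cos\<close> and \<open>psd_integral\<close>; the square root
  \<open>w\<close> serves to write the weight as a scaling.\<close>

lemma psd_product_Kc:
  fixes \<xi> :: "'s \<Rightarrow> real ^ 'q::finite"
  assumes "psd TYPE('u::real_inner) l"
  shows "psd TYPE('u) (\<lambda>x y. product_kernel Kc (\<xi> x - \<xi> y) * l x y)"
proof -
  define w where "w t = sqrt (c0 TYPE('q) * ftv t)" for t :: "real ^ 'q"
  have w: "w t * w t = c0 TYPE('q) * ftv t" for t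
    using c0_pos[where 'q = 'q] ftv_pos[of t] by (simp add: w_def)
  have e: "product_kernel Kc (\<xi> x - \<xi> y) * l x y
      = (\<integral>t. w t * w t * (l x y * cos (t \<bullet> \<xi> x - t \<bullet> \<xi> y)) \<partial>lborel)" for x y
  proof -
    have "(\<integral>t. w t * w t * (l x y * cos (t \<bullet> \<xi> x - t \<bullet> \<xi> y)) \<partial>lborel)
        = (\<integral>t. (c0 TYPE('q) * l x y) * (cos (t \<bullet> (\<xi> x - \<xi> y)) * ftv t) \<partial>lborel)"
      by (intro Bochner_Integration.integral_cong refl) (simp add: w inner_diff_right)
    then show ?thesis by (simp add: product_Kc_fourier)
  qed
  show ?thesis
    unfolding e
  proof (rule psd_integral)
    show "psd TYPE('u) (\<lambda>x y. w t * w t * (l x y * cos (t \<bullet> \<xi> x - t \<bullet> \<xi> y)))" for t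
      by (rule psd_scale[of _ "\<lambda>_. w t"]) (intro psd_cos assms)
    show "integrable lborel (\<lambda>t. w t * w t * (l x y * cos (t \<bullet> \<xi> x - t \<bullet> \<xi> y)))" for x y
    proof -
      have "integrable lborel (\<lambda>t. (c0 TYPE('q) * l x y) * (cos (t \<bullet> (\<xi> x - \<xi> y)) * ftv t))"
        by (intro integrable_mult_right integrable_cos_ftv)
      then show ?thesis by (simp add: w inner_diff_right mult_ac)
    qed
  qed
qed

lemma product_Kc_minus: "product_kernel Kc (- z) = product_kernel Kc z"
  by (simp add: product_Kc_fourier)

text \<open>For fixed z the exceptional set, pulled back under x -> (z - x)/h, stays Lebesgue null
  and has probability zero as \<open>Z\<close> has a density; Fubini's theorem covers the random
  z.\<close>

lemma AE_kernel_eq: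
  fixes Z :: "'y \<Rightarrow> real ^ 'q::finite"
  assumes R: "prob_space R" and dist: "distributed R lborel Z f" and h: "0 < h"
  shows "AE p in R \<Otimes>\<^sub>M R. product_kernel Kt ((1 / h) *\<^sub>R (Z (fst p) - Z (snd p)))
      = product_kernel Kc ((1 / h) *\<^sub>R (Z (fst p) - Z (snd p)))"
proof -
  interpret prob_space R by (rule R)
  interpret RR: pair_prob_space R R ..
  have Z[measurable]: "Z \<in> borel_measurable R" using distributed_measurable[OF dist] by simp
  have [measurable]: "f \<in> borel_measurable borel" using distributed_borel_measurable[OF dist] by simp
  have sec: "AE y in R. product_kernel Kt ((1 / h) *\<^sub>R (z - Z y)) = product_kernel Kc ((1 / h) *\<^sub>R (z - Z y))" for z
  proof -
    have d: "(lborel :: (real ^ 'q) measure)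
        = density (distr lborel borel (\<lambda>x. z - h *\<^sub>R x)) (\<lambda>_. ennreal (h ^ DIM(real ^ 'q)))"
      using lborel_affine[of "- h" z] h by (simp add: ennreal_power)
    have "AE x in distr lborel borel (\<lambda>x. z - h *\<^sub>R x).
        product_kernel Kt ((1 / h) *\<^sub>R (z - x)) = product_kernel Kc ((1 / h) *\<^sub>R (z - x))"
      using AE_product_Kt h by (subst AE_distr_iff) simp_all
    then have "AE x in (lborel :: (real ^ 'q) measure).
        product_kernel Kt ((1 / h) *\<^sub>R (z - x)) = product_kernel Kc ((1 / h) *\<^sub>R (z - x))"
      by (subst d, subst AE_density) (auto elim: eventually_mono)
    then have "AE x in density lborel f. product_kernel Kt ((1 / h) *\<^sub>R (z - x)) = product_kernel Kc ((1 / h) *\<^sub>R (z - x))"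
      by (subst AE_density) (auto elim: eventually_mono)
    then have "AE x in distr R lborel Z. product_kernel Kt ((1 / h) *\<^sub>R (z - x)) = product_kernel Kc ((1 / h) *\<^sub>R (z - x))"
      unfolding distributed_distr_eq_density[OF dist] .
    then show ?thesis by (rule AE_distrD[rotated]) simp
  qed
  show ?thesis
  proof (rule RR.AE_pair_measure)
    show "{p \<in> space (R \<Otimes>\<^sub>M R). product_kernel Kt ((1 / h) *\<^sub>R (Z (fst p) - Z (snd p)))
      = product_kernel Kc ((1 / h) *\<^sub>R (Z (fst p) - Z (snd p)))} \<in> sets (R \<Otimes>\<^sub>M R)" by measurable
  qed (use sec in simp)
qed

end

text \<open>The bound \<open>\<kappa>0\<close> for the mean of the kernel over two observations is
  kept apart from \<open>\<Lambda>\<close> because it is of smaller order in the bandwidth.\<close>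

lemma (in regression_kernel) selfnormalized_tail:
  fixes z :: real
  defines "m2 \<equiv> \<integral>x. (norm (D x))\<^sup>2 \<partial>P" and "m4 \<equiv> \<integral>x. norm (D x) ^ 4 \<partial>P"
  assumes n: "n \<ge> 2" and r: "r \<noteq> 0" and Q: "0 < form D D"
    and pair: "(\<integral>p. \<kappa> (fst p) (snd p) \<partial>(P \<Otimes>\<^sub>M P)) \<le> \<kappa>0"
  shows "prob {\<omega> \<in> space M. (\<Sum>i\<in>{1..n}. \<Sum>j\<in>{1..n} - {i}. g (X i \<omega>, X j \<omega>))
        \<le> \<bar>z\<bar> * sqrt (2 * (\<Sum>i\<in>{1..n}. \<Sum>j\<in>{1..n} - {i}. (g (X i \<omega>, X j \<omega>))\<^sup>2))}
    \<le> (64 * (2 * r\<^sup>2 * v * \<Lambda> * form D D + 2 * r ^ 4 * \<Lambda>\<^sup>2 * m4) / real n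
      + 32 * (1 + z\<^sup>2) * (B * (4 * v\<^sup>2 * \<kappa>0 + 8 * v * r\<^sup>2 * \<Lambda> * m2 + 4 * r ^ 4 * B * m2\<^sup>2)) / (real n)\<^sup>2) / (r\<^sup>2 * form D D)\<^sup>2"
proof -
  have \<theta>: "0 < integral\<^sup>L (P \<Otimes>\<^sub>M P) g" using r Q by (simp add: integral_g)
  have "prob {\<omega> \<in> space M. (\<Sum>i\<in>{1..n}. \<Sum>j\<in>{1..n} - {i}. g (X i \<omega>, X j \<omega>))
        \<le> \<bar>z\<bar> * sqrt (2 * (\<Sum>i\<in>{1..n}. \<Sum>j\<in>{1..n} - {i}. (g (X i \<omega>, X j \<omega>))\<^sup>2))}
    \<le> (64 * (\<integral>x. (\<integral>y. g (x, y) \<partial>P)\<^sup>2 \<partial>P) / real n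
          + 32 * (1 + z\<^sup>2) * (\<integral>p. (g p)\<^sup>2 \<partial>(P \<Otimes>\<^sub>M P)) / (real n)\<^sup>2) / (integral\<^sup>L (P \<Otimes>\<^sub>M P) g)\<^sup>2"
    by (rule ustatistic_selfnormalized(3)[OF g_meas g_sym g_sq(1) n \<theta>])
  also have "\<dots> \<le> (64 * (2 * r\<^sup>2 * v * \<Lambda> * form D D + 2 * r ^ 4 * \<Lambda>\<^sup>2 * m4) / real n
      + 32 * (1 + z\<^sup>2) * (B * (4 * v\<^sup>2 * \<kappa>0 + 8 * v * r\<^sup>2 * \<Lambda> * m2 + 4 * r ^ 4 * B * m2\<^sup>2)) / (real n)\<^sup>2)
      / (integral\<^sup>L (P \<Otimes>\<^sub>M P) g)\<^sup>2"
  proof (intro divide_right_mono add_mono mult_left_mono)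
    show "(\<integral>x. (\<integral>y. g (x, y) \<partial>P)\<^sup>2 \<partial>P) \<le> 2 * r\<^sup>2 * v * \<Lambda> * form D D + 2 * r ^ 4 * \<Lambda>\<^sup>2 * m4"
      unfolding m4_def by (rule g_section_sq)
    have "B * (4 * v\<^sup>2 * (\<integral>p. \<kappa> (fst p) (snd p) \<partial>(P \<Otimes>\<^sub>M P)) + 8 * v * r\<^sup>2 * \<Lambda> * m2 + 4 * r ^ 4 * B * m2\<^sup>2)
        \<le> B * (4 * v\<^sup>2 * \<kappa>0 + 8 * v * r\<^sup>2 * \<Lambda> * m2 + 4 * r ^ 4 * B * m2\<^sup>2)"
      using pair B_nonneg by (intro mult_left_mono add_right_mono) auto
    then show "(\<integral>p. (g p)\<^sup>2 \<partial>(P \<Otimes>\<^sub>M P)) \<le> B * (4 * v\<^sup>2 * \<kappa>0 + 8 * v * r\<^sup>2 * \<Lambda> * m2 + 4 * r ^ 4 * B * m2\<^sup>2)"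
      using g_sq(2) unfolding m2_def by linarith
  qed auto
  finally show ?thesis by (simp add: integral_g)
qed

text \<open>Here \<open>s\<^sup>2\<close> stands for \<open>h\<^sup>q\<close>, so that \<open>n \<cdot> r\<^sup>2 \<cdot> s\<close> and \<open>n \<cdot> s\<^sup>2\<close> are the two
  quantities assumed to diverge.\<close>

lemma tail_bound_rate:
  fixes n r s C c Q v m2 m4 B z :: real
  assumes pos: "0 < n" "r \<noteq> 0" "0 < s" "0 < c" "0 \<le> C" "0 \<le> v" "0 \<le> m2" "0 \<le> m4" "0 \<le> B"
    and Q: "c * s\<^sup>2 \<le> Q"
  shows "(64 * (2 * r\<^sup>2 * v * (C * s) * Q + 2 * r ^ 4 * (C * s)\<^sup>2 * m4) / n
      + 32 * (1 + z\<^sup>2) * (B * (4 * v\<^sup>2 * (C * s\<^sup>2) + 8 * v * r\<^sup>2 * (C * s) * m2 + 4 * r ^ 4 * B * m2\<^sup>2)) / n\<^sup>2) / (r\<^sup>2 * Q)\<^sup>2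
    \<le> (128 * v * C / c) * (1 / (r\<^sup>2 * n * s)) + (128 * C\<^sup>2 * m4 / c\<^sup>2) * (1 / (n * s\<^sup>2))
      + 32 * (1 + z\<^sup>2) * B / c\<^sup>2 * (4 * v\<^sup>2 * C * (1 / (r\<^sup>2 * n * s))\<^sup>2
        + 8 * v * C * m2 * (1 / (r\<^sup>2 * n * s)) * (1 / (n * s\<^sup>2)) + 4 * B * m2\<^sup>2 * (1 / (n * s\<^sup>2))\<^sup>2)"
proof -
  have Q0: "0 < Q" using Q pos by (meson less_le_trans mult_pos_pos zero_less_power)
  have r2: "0 < r\<^sup>2" using pos by simp
  define w where "w = r\<^sup>2"
  have w: "0 < w" "r ^ 4 = w\<^sup>2" using r2 by (simp_all add: w_def flip: power_mult)
  define q where "q = c * s\<^sup>2"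
  have q: "0 < q" "q \<le> Q" using Q pos by (simp_all add: q_def)
  have q2: "q\<^sup>2 \<le> Q\<^sup>2" using q by (intro power_mono) auto
  have "(64 * (2 * w * v * (C * s) * Q + 2 * w\<^sup>2 * (C * s)\<^sup>2 * m4) / n
      + 32 * (1 + z\<^sup>2) * (B * (4 * v\<^sup>2 * (C * s\<^sup>2) + 8 * v * w * (C * s) * m2 + 4 * w\<^sup>2 * B * m2\<^sup>2)) / n\<^sup>2) / (w * Q)\<^sup>2
    = 128 * v * C * s / (n * w * Q)
      + (128 * C\<^sup>2 * s\<^sup>2 * m4 / n
      + 32 * (1 + z\<^sup>2) * B * (4 * v\<^sup>2 * C * s\<^sup>2 + 8 * v * w * C * s * m2 + 4 * w\<^sup>2 * B * m2\<^sup>2) / (n\<^sup>2 * w\<^sup>2)) / Q\<^sup>2"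
    using pos(1) w(1) Q0 by (simp add: field_simps power2_eq_square)
  \<comment> \<open>In the first term one power of Q has cancelled, so the lower bound q = c s^2
    enters there only once; this leaves 1/(r^2 n s).\<close>
  also have "\<dots> \<le> 128 * v * C * s / (n * w * q)
      + (128 * C\<^sup>2 * s\<^sup>2 * m4 / n
      + 32 * (1 + z\<^sup>2) * B * (4 * v\<^sup>2 * C * s\<^sup>2 + 8 * v * w * C * s * m2 + 4 * w\<^sup>2 * B * m2\<^sup>2) / (n\<^sup>2 * w\<^sup>2)) / q\<^sup>2"
  proof (intro add_mono divide_left_mono mult_left_mono)
    show "0 \<le> 128 * C\<^sup>2 * s\<^sup>2 * m4 / n
      + 32 * (1 + z\<^sup>2) * B * (4 * v\<^sup>2 * C * s\<^sup>2 + 8 * v * w * C * s * m2 + 4 * w\<^sup>2 * B * m2\<^sup>2) / (n\<^sup>2 * w\<^sup>2)"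
      using pos w by (intro add_nonneg_nonneg divide_nonneg_nonneg mult_nonneg_nonneg) auto
  qed (use pos w q q2 Q0 in auto)
  also have "\<dots> = (128 * v * C / c) * (1 / (w * n * s)) + (128 * C\<^sup>2 * m4 / c\<^sup>2) * (1 / (n * s\<^sup>2))
      + 32 * (1 + z\<^sup>2) * B / c\<^sup>2 * (4 * v\<^sup>2 * C * (1 / (w * n * s))\<^sup>2
        + 8 * v * C * m2 * (1 / (w * n * s)) * (1 / (n * s\<^sup>2)) + 4 * B * m2\<^sup>2 * (1 / (n * s\<^sup>2))\<^sup>2)"
    using pos w(1) by (simp add: q_def field_simps power2_eq_square)
  finally show ?thesis unfolding w(2) w_def .
qed

text \<open>The common factor of \<open>I_stat\<close> and \<open>v_stat\<close> cancels. The strict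
  inequality in \<open>big\<close> excludes V = 0, which would make all \<open>G i j\<close> and
  hence their sum 0, so under these assumptions the default value \<open>c\<close> is not
  taken.\<close>

lemma T_stat_ge:
  fixes U :: "nat \<Rightarrow> 'u::real_inner" and Z :: "nat \<Rightarrow> real ^ 'q" and W :: "nat \<Rightarrow> 'w::real_vector"
    and G :: "nat \<Rightarrow> nat \<Rightarrow> real"
  assumes n: "n \<ge> 2" and h: "h > 0"
    and G: "\<And>i j. i \<in> {1..n} \<Longrightarrow> j \<in> {1..n} - {i} \<Longrightarrow>
      ((w (Z i) *\<^sub>R U i) \<bullet> (w (Z j) *\<^sub>R U j)) * K ((1 / h) *\<^sub>R (Z i - Z j)) * exp (- N (W i - W j) / 2) = G i j"
    and big: "\<bar>z\<bar> * sqrt (2 * (\<Sum>i\<in>{1..n}. \<Sum>j\<in>{1..n} - {i}. (G i j)\<^sup>2)) < (\<Sum>i\<in>{1..n}. \<Sum>j\<in>{1..n} - {i}. G i j)"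
  shows "z \<le> T_stat c K w N n h U Z W"
proof -
  define S where "S = (\<Sum>i\<in>{1..n}. \<Sum>j\<in>{1..n} - {i}. G i j)"
  define V where "V = (\<Sum>i\<in>{1..n}. \<Sum>j\<in>{1..n} - {i}. (G i j)\<^sup>2)"
  define d where "d = real n * (real n - 1) * h ^ CARD('q)"
  have d: "d > 0" using n h by (simp add: d_def)
  have I: "I_stat K w N n h U Z W = S / d"
  proof -
    have "(\<Sum>i\<in>{1..n}. \<Sum>j\<in>{1..n} - {i}. ((w (Z i) *\<^sub>R U i) \<bullet> (w (Z j) *\<^sub>R U j)) *
        K ((1 / h) *\<^sub>R (Z i - Z j)) * exp (- N (W i - W j) / 2)) = S"
      unfolding S_def by (intro sum.cong refl G)
    then show ?thesis unfolding I_stat_def d_def by simp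
  qed
  have v: "v_stat K w N n h U Z W = sqrt (2 * V) / d"
  proof -
    have "(\<Sum>i\<in>{1..n}. \<Sum>j\<in>{1..n} - {i}. ((w (Z i) *\<^sub>R U i) \<bullet> (w (Z j) *\<^sub>R U j))\<^sup>2 *
        (K ((1 / h) *\<^sub>R (Z i - Z j)))\<^sup>2 * (exp (- N (W i - W j) / 2))\<^sup>2) = V"
      unfolding V_def power_mult_distrib[symmetric] by (intro sum.cong refl arg_cong[of _ _ power2] G)
    then have "v_sq_stat K w N n h U Z W = 2 * V / d\<^sup>2"
      unfolding v_sq_stat_def d_def by (simp add: power_mult_distrib power_mult[symmetric] mult.commute[of 2])
    then show ?thesis using d by (simp add: v_stat_def real_sqrt_divide)
  qed
  have V0: "V \<ge> 0" unfolding V_def by (intro sum_nonneg) auto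
  have big': "\<bar>z\<bar> * sqrt (2 * V) < S" using big by (simp add: S_def V_def)
  have S0: "0 < S" using big' V0 by (meson abs_ge_zero le_less_trans mult_nonneg_nonneg real_sqrt_ge_zero mult_nonneg_nonneg zero_le_numeral)
  have "V \<noteq> 0"
  proof
    assume "V = 0"
    then have "\<forall>i\<in>{1..n}. (\<Sum>j\<in>{1..n} - {i}. (G i j)\<^sup>2) = 0"
      unfolding V_def by (subst (asm) sum_nonneg_eq_0_iff) (auto intro: sum_nonneg)
    then have "\<forall>i\<in>{1..n}. \<forall>j\<in>{1..n} - {i}. G i j = 0"
      by (subst (asm) sum_nonneg_eq_0_iff) auto
    then have "S = 0" unfolding S_def by (intro sum.neutral ballI) auto
    then show False using S0 by simp
  qed
  then have V: "sqrt (2 * V) > 0" using V0 by simp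
  then have "T_stat c K w N n h U Z W = S / sqrt (2 * V)"
    using d by (simp add: T_stat_def I v)
  moreover have "\<bar>z\<bar> \<le> S / sqrt (2 * V)" using big' V by (simp add: pos_le_divide_eq less_imp_le)
  ultimately show ?thesis by linarith
qed

theorem theorem2:
  fixes M :: "'a measure"
    and U0 :: "'a \<Rightarrow> 'u::{real_inner, banach, second_countable_topology}"
    and Z :: "'a \<Rightarrow> real ^ 'q"
    and W :: "'a \<Rightarrow> 'w::{real_inner, banach, second_countable_topology}"
    and U0s :: "nat \<Rightarrow> 'a \<Rightarrow> 'u"
    and Zs :: "nat \<Rightarrow> 'a \<Rightarrow> real ^ 'q"
    and Ws :: "nat \<Rightarrow> 'a \<Rightarrow> 'w"
    and \<omega> :: "real ^ 'q \<Rightarrow> real"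
    and f_Z :: "real ^ 'q \<Rightarrow> real"
    and J :: "nat set" and \<phi> :: "nat \<Rightarrow> 'w" and a :: "nat \<Rightarrow> real"
    and \<sigma> C \<nu> :: real
    and Kt :: "real \<Rightarrow> real"
    and h r :: "nat \<Rightarrow> real"
    and \<delta> :: "(real ^ 'q) \<times> 'w \<Rightarrow> 'u"
    and c :: real
  assumes prob: "prob_space M"
    and basis: "orthonormal_basis J \<phi>"
    and meas: "U0 \<in> borel_measurable M" "Z \<in> borel_measurable M" "W \<in> borel_measurable M"
    and indep: "prob_space.indep_vars M (\<lambda>_. borel) (\<lambda>i x. (U0s i x, Zs i x, Ws i x)) {1..}"
    and ident: "\<And>i. i \<ge> 1 \<Longrightarrow>
      distr M borel (\<lambda>x. (U0s i x, Zs i x, Ws i x)) = distr M borel (\<lambda>x. (U0 x, Z x, W x))"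
    and centered_W: "integral\<^sup>L M W = 0"
    and cond_mean: "is_cond_exp M (generated_by M (\<lambda>x. (Z x, W x))) U0 (\<lambda>_. 0)"
    and weight: "\<omega> \<in> borel_measurable borel" "\<And>z. 0 < \<omega> z"
    and D_a: "integrable M (\<lambda>x. norm (\<omega> (Z x) *\<^sub>R U0 x) ^ 4)"
    and D_b_density: "\<And>z. 0 \<le> f_Z z" "distributed M lborel Z (\<lambda>z. ennreal (f_Z z))"
    and D_b_i: "(\<exists>B. \<forall>z. f_Z z \<le> B) \<or>
      (\<exists>b\<in>{0<..1}. integrable lborel (\<lambda>t. norm (fourier f_Z t) powr (2 - b)))"
    and D_b_ii: "integrable M (\<lambda>x. (norm (W x))\<^sup>2)"
    and D_b_iii: "\<And>k. k \<in> J \<Longrightarrow> 0 < a k" "a summable_on J"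
    and D_c: "0 < \<sigma>\<^sup>2" "0 < C" "2 < \<nu>"
    and D_c_i: "AE x in M. ennreal (\<sigma>\<^sup>2) \<le>
      nn_cond_exp M (generated_by M (\<lambda>x. ((Zs 1 x, Ws 1 x), (Zs 2 x, Ws 2 x))))
        (\<lambda>x. ennreal (((\<omega> (Zs 1 x) *\<^sub>R U0s 1 x) \<bullet> (\<omega> (Zs 2 x) *\<^sub>R U0s 2 x))\<^sup>2)) x"
    and D_c_ii: "AE x in M.
      nn_cond_exp M (generated_by M (\<lambda>x. (Z x, W x)))
        (\<lambda>x. ennreal (norm (\<omega> (Z x) *\<^sub>R U0 x) powr \<nu>)) x \<le> ennreal C"
    and K_a_density: "Kt \<in> borel_measurable borel" "\<And>x. 0 \<le> Kt x" "has_bochner_integral lborel Kt 1"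
    and K_a_symmetric: "\<And>x. Kt (- x) = Kt x"
    and K_a_variation: "bounded_variation Kt"
    and K_a_fourier: "\<And>t. fourier Kt t \<in> \<real> \<and> 0 < Re (fourier Kt t)"
      "integrable lborel (fourier Kt)"
    and K_b: "\<And>n. n \<ge> 1 \<Longrightarrow> 0 < h n" "h \<longlonglongrightarrow> 0"
      "filterlim (\<lambda>n. real n * h n ^ CARD('q) / ln (real n)) at_top sequentially"
    and delta: "\<delta> \<in> borel_measurable borel"
      "has_bochner_integral M (\<lambda>x. \<delta> (Z x, W x)) 0"
      "integrable M (\<lambda>x. norm (\<omega> (Z x) *\<^sub>R \<delta> (Z x, W x)) ^ 4)"
      "0 < (LINT x|M. norm (\<omega> (Z x) *\<^sub>R \<delta> (Z x, W x)) ^ 4)"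
    and rate: "filterlim (\<lambda>n. (r n)\<^sup>2 * real n * h n powr (real CARD('q) / 2)) at_top sequentially"
  shows "\<forall>\<alpha>\<in>{0<..<1}.
    (\<lambda>n. measure M {x \<in> space M.
        quantile (density lborel std_normal_density) (1 - \<alpha>)
        \<le> T_stat c (product_kernel Kt) \<omega> (sq_norm_A J \<phi> a) n (h n)
            (\<lambda>i. U0s i x + r n *\<^sub>R \<delta> (Zs i x, Ws i x)) (\<lambda>i. Zs i x) (\<lambda>i. Ws i x)})
    \<longlonglongrightarrow> 1"
proof (intro ballI)
  interpret prob_space M by (rule prob)
  interpret fk: fourier_kernel Kt
    by unfold_locales (use K_a_density K_a_fourier in auto)
  fix \<alpha> :: real assume "\<alpha> \<in> {0<..<1}"
  define z where "z = quantile (density lborel std_normal_density) (1 - \<alpha>)"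
  define N where "N = sq_norm_A J \<phi> a"
  define k where "k = (product_kernel fk.Kc :: real ^ 'q \<Rightarrow> real)"
  define X where "X i x = (U0s i x, Zs i x, Ws i x)" for i x
  define X0 where "X0 x = (U0 x, Z x, W x)" for x
  define P where "P = distr M borel X0"
  define V where "V = (\<lambda>x :: 'u \<times> (real ^ 'q) \<times> 'w. \<omega> (fst (snd x)) *\<^sub>R fst x)"
  define \<Delta> where "\<Delta> = (\<lambda>s :: (real ^ 'q) \<times> 'w. \<omega> (fst s) *\<^sub>R \<delta> s)"
  define D where "D = (\<lambda>x :: 'u \<times> (real ^ 'q) \<times> 'w. \<Delta> (snd x))"
  \<comment> \<open>Events depending on (Z, W) only, as a sigma-algebra on the value space;
    \<open>F\<close> is its counterpart on the probability space, where the conditional assumptions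
    are stated.\<close>
  define C' where "C' = vimage_algebra (UNIV :: ('u \<times> (real ^ 'q) \<times> 'w) set) snd (borel :: ((real ^ 'q) \<times> 'w) measure)"
  define F where "F = generated_by M (\<lambda>x. (Z x, W x))"
  define \<kappa> where "\<kappa> b x y = k ((1 / b) *\<^sub>R (fst (snd x) - fst (snd y))) * exp (- N (snd (snd x) - snd (snd y)) / 2)"
    for b :: real and x y :: "'u \<times> (real ^ 'q) \<times> 'w"
  have [measurable]: "U0 \<in> borel_measurable M" "Z \<in> borel_measurable M" "W \<in> borel_measurable M"
    using meas by auto
  have X0[measurable]: "X0 \<in> borel_measurable M"
    unfolding X0_def[abs_def] by (intro borel_measurable_Pair) measurable
  have sets_P: "sets P = sets borel" and space_P: "space P = UNIV" by (simp_all add: P_def)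
  have meas_P: "f \<in> measurable P L \<longleftrightarrow> f \<in> measurable borel L" for f and L :: "'l measure"
    by (rule measurable_cong_sets[OF sets_P refl, THEN arg_cong])
  have iid: "iid_sample M X P"
  proof
    show "indep_vars (\<lambda>_. P) X {1..}"
      using indep unfolding indep_vars_def2 by (simp add: X_def[abs_def] sets_P measurable_cong_sets[OF refl sets_P])
    show "distr M P (X i) = P" if "i \<ge> 1" for i
    proof -
      have "distr M P (X i) = distr M borel (X i)" by (rule distr_cong) (simp_all add: sets_P)
      also have "\<dots> = P" using ident[OF that] by (simp add: P_def X_def[abs_def] X0_def[abs_def])
      finally show ?thesis .
    qed
  qed
  interpret iid: iid_sample M X P by (rule iid)
  have f1[measurable]: "fst \<in> borel_measurable P" and f2[measurable]: "snd \<in> borel_measurable P"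
    unfolding meas_P by (rule borel_fst borel_snd)+
  have f3[measurable]: "(\<lambda>x. fst (snd x)) \<in> borel_measurable P" and f4[measurable]: "(\<lambda>x. snd (snd x)) \<in> borel_measurable P"
    by (rule measurable_compose[OF f2 borel_fst], rule measurable_compose[OF f2 borel_snd])
  have [measurable]: "\<omega> \<in> borel_measurable borel" "\<delta> \<in> borel_measurable borel" using weight delta by auto
  have N_meas[measurable]: "N \<in> borel_measurable borel"
    unfolding N_def by (rule borel_measurable_sq_norm_A[OF basis D_b_iii])
  have N0: "0 \<le> N w" for w unfolding N_def by (rule sq_norm_A_nonneg[OF basis D_b_iii])
  have k_meas[measurable]: "k \<in> borel_measurable borel" unfolding k_def by measurable
  have \<Delta>_meas[measurable]: "\<Delta> \<in> borel_measurable borel"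
    unfolding \<Delta>_def by (intro borel_measurable_scaleR measurable_compose[OF borel_fst]) measurable
  have V_meas[measurable]: "V \<in> borel_measurable P" unfolding V_def by measurable
  have g_le: "exp (- N w / 2) \<le> 1" for w using N0[of w] by simp

  have dist: "distributed P lborel (\<lambda>x. fst (snd x)) (\<lambda>z. ennreal (f_Z z))"
  proof -
    have "distr P lborel (\<lambda>x. fst (snd x)) = distr M lborel Z"
      unfolding P_def using f3 by (subst distr_distr) (auto simp: meas_P comp_def X0_def)
    then show ?thesis using D_b_density(2) by (auto simp: distributed_def)
  qed
  obtain C1 where C1: "0 < C1"
    "\<And>b y. 0 < b \<Longrightarrow> b \<le> 1 \<Longrightarrow> (\<integral>x. k ((1 / b) *\<^sub>R (y - fst (snd x))) \<partial>P) \<le> C1 * sqrt (b ^ CARD('q))"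
    "\<And>b. 0 < b \<Longrightarrow> b \<le> 1 \<Longrightarrow>
      (\<integral>p. k ((1 / b) *\<^sub>R (fst (snd (fst p)) - fst (snd (snd p)))) \<partial>(P \<Otimes>\<^sub>M P)) \<le> C1 * b ^ CARD('q)"
    using fk.kernel_bounds[OF iid.prob_space_P f3 dist D_b_density(1) D_b_i] unfolding k_def by blast

  have sub_F: "subalgebra M F"
  proof -
    have "(\<lambda>x. (Z x, W x)) \<in> borel_measurable M" by (intro borel_measurable_Pair) measurable
    then show ?thesis
      unfolding F_def generated_by_def subalgebra_def by (auto simp: sets_vimage_algebra2)
  qed
  have ZW_F: "(\<lambda>x. (Z x, W x)) \<in> borel_measurable F"
    unfolding F_def generated_by_def by (rule measurable_vimage_algebra1) simp
  have X0_F: "X0 \<in> measurable F C'"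
    unfolding C'_def by (rule measurable_vimage_algebra2) (use ZW_F in \<open>simp_all add: X0_def\<close>)
  have sub_C: "subalgebra P C'"
    using measurable_sets[OF f2] by (auto simp: subalgebra_def C'_def space_P sets_vimage_algebra2)
  have snd_C[measurable]: "snd \<in> borel_measurable C'" unfolding C'_def by (rule measurable_vimage_algebra1) simp
  have fs_C[measurable]: "(\<lambda>x. fst (snd x)) \<in> borel_measurable C'" and ss_C[measurable]: "(\<lambda>x. snd (snd x)) \<in> borel_measurable C'"
    by (rule measurable_compose[OF snd_C borel_fst], rule measurable_compose[OF snd_C borel_snd])
  have D_meas_C: "D \<in> borel_measurable C'" unfolding D_def by (rule measurable_compose[OF snd_C \<Delta>_meas])
  have D_meas: "D \<in> borel_measurable P" unfolding D_def by (rule measurable_compose[OF f2 \<Delta>_meas])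
  have nnP: "(\<integral>\<^sup>+x. f x \<partial>P) = (\<integral>\<^sup>+x. f (X0 x) \<partial>M)" if "f \<in> borel_measurable P" for f :: "_ \<Rightarrow> ennreal"
    using that nn_integral_distr[OF X0, of f] unfolding meas_P by (simp add: P_def)
  have intP: "(\<integral>x. f x \<partial>P) = (\<integral>x. f (X0 x) \<partial>M)" "integrable P f \<longleftrightarrow> integrable M (\<lambda>x. f (X0 x))"
    if "f \<in> borel_measurable P" for f :: "_ \<Rightarrow> real"
    using that integral_distr[OF X0, of f] integrable_distr_eq[OF X0, of f] unfolding meas_P by (simp_all add: P_def)
  have DX: "D (X0 x) = \<omega> (Z x) *\<^sub>R \<delta> (Z x, W x)" and VX: "V (X0 x) = \<omega> (Z x) *\<^sub>R U0 x" for x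
    by (simp_all add: D_def \<Delta>_def V_def X0_def)
  have D4_meas: "(\<lambda>x. norm (D x) ^ 4) \<in> borel_measurable P" using D_meas by measurable
  have D4: "integrable P (\<lambda>x. norm (D x) ^ 4)"
    unfolding intP(2)[OF D4_meas] DX by (rule delta(3))
  have D4_pos: "0 < (\<integral>x. norm (D x) ^ 4 \<partial>P)"
    unfolding intP(1)[OF D4_meas] DX by (rule delta(4))
  have D2: "integrable P (\<lambda>x. (norm (D x))\<^sup>2)"
  proof (rule iid.P.square_integrable_imp_integrable)
    show "integrable P (\<lambda>x. ((norm (D x))\<^sup>2)\<^sup>2)" using D4 by (simp flip: power_mult)
  qed (use D_meas in measurable)
  define v where "v = 1 + C"
  have v: "0 \<le> v" using D_c(2) by (simp add: v_def)
  \<comment> \<open>Pulled back along \<open>X0\<close>, a test function measurable for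
    \<open>C'\<close> becomes measurable for \<open>F\<close>, where the conditional moment bound is
    available.\<close>
  have V_var: "(\<integral>\<^sup>+x. ennreal ((norm (V x))\<^sup>2) * G x \<partial>P) \<le> (\<integral>\<^sup>+x. ennreal v * G x \<partial>P)"
    if G: "G \<in> borel_measurable C'" for G
  proof -
    have [measurable]: "G \<in> borel_measurable P" by (rule measurable_from_subalg[OF sub_C G])
    have GF: "(\<lambda>x. G (X0 x)) \<in> borel_measurable F" by (rule measurable_compose[OF X0_F G])
    have "(\<integral>\<^sup>+x. ennreal ((norm (V x))\<^sup>2) * G x \<partial>P) = (\<integral>\<^sup>+x. ennreal ((norm (\<omega> (Z x) *\<^sub>R U0 x))\<^sup>2) * G (X0 x) \<partial>M)"
      by (subst nnP) (simp_all add: VX)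
    also have "\<dots> \<le> (\<integral>\<^sup>+x. ennreal v * G (X0 x) \<partial>M)"
      unfolding v_def using D_c D_c_ii
      by (intro conditional_second_moment[OF prob sub_F _ _ _ _ GF, of _ \<nu>]) (auto simp: F_def)
    also have "\<dots> = (\<integral>\<^sup>+x. ennreal v * G x \<partial>P)"
      by (subst nnP) simp_all
    finally show ?thesis .
  qed
  have V2: "integrable M (\<lambda>x. norm (\<omega> (Z x) *\<^sub>R U0 x))"
  proof (rule square_integrable_imp_integrable)
    show "integrable M (\<lambda>x. (norm (\<omega> (Z x) *\<^sub>R U0 x))\<^sup>2)"
    proof (rule square_integrable_imp_integrable)
      show "integrable M (\<lambda>x. ((norm (\<omega> (Z x) *\<^sub>R U0 x))\<^sup>2)\<^sup>2)"
        using D_a by (simp only: power_mult[symmetric]) simp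
    qed measurable
  qed measurable
  have V_orth: "(\<integral>x. V x \<bullet> G x \<partial>P) = 0"
    if G: "G \<in> borel_measurable C'" and bound: "\<And>x. x \<in> space P \<Longrightarrow> norm (G x) \<le> K"
    for G :: "_ \<Rightarrow> 'u" and K
  proof -
    have [measurable]: "G \<in> borel_measurable P" by (rule measurable_from_subalg[OF sub_C G])
    have GX[measurable]: "(\<lambda>x. G (X0 x)) \<in> borel_measurable F" by (rule measurable_compose[OF X0_F G])
    have GM[measurable]: "(\<lambda>x. G (X0 x)) \<in> borel_measurable M" by (rule measurable_from_subalg[OF sub_F GX])
    have Z_F: "Z \<in> borel_measurable F" using measurable_compose[OF ZW_F borel_fst] by simp
    \<comment> \<open>The weight is moved to the test function because the conditional mean
      assumption concerns \<open>U0\<close> and not the weighted noise.\<close>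
    have "(\<integral>x. V x \<bullet> G x \<partial>P) = (\<integral>x. U0 x \<bullet> (\<omega> (Z x) *\<^sub>R G (X0 x)) \<partial>M)"
      by (subst intP) (simp_all add: VX)
    also have "\<dots> = 0"
    proof (rule is_cond_exp_zero_orthogonal[OF sub_F])
      show "is_cond_exp M F U0 (\<lambda>_. 0)" using cond_mean by (simp add: F_def)
      show "(\<lambda>x. \<omega> (Z x) *\<^sub>R G (X0 x)) \<in> borel_measurable F"
        by (intro borel_measurable_scaleR GX measurable_compose[OF Z_F]) measurable
      show "integrable M (\<lambda>x. norm (U0 x) * norm (\<omega> (Z x) *\<^sub>R G (X0 x)))"
      proof (rule Bochner_Integration.integrable_bound)
        show "integrable M (\<lambda>x. norm (\<omega> (Z x) *\<^sub>R U0 x) * K)" using V2 by simp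
        show "AE x in M. norm (norm (U0 x) * norm (\<omega> (Z x) *\<^sub>R G (X0 x))) \<le> norm (norm (\<omega> (Z x) *\<^sub>R U0 x) * K)"
        proof (rule AE_I2)
          fix x
          have K: "norm (G (X0 x)) \<le> K" using bound by (simp add: space_P)
          then have "0 \<le> K" using norm_ge_zero order_trans by blast
          moreover have "(\<bar>\<omega> (Z x)\<bar> * norm (U0 x)) * norm (G (X0 x)) \<le> (\<bar>\<omega> (Z x)\<bar> * norm (U0 x)) * K"
            using K by (intro mult_left_mono) auto
          ultimately show "norm (norm (U0 x) * norm (\<omega> (Z x) *\<^sub>R G (X0 x))) \<le> norm (norm (\<omega> (Z x) *\<^sub>R U0 x) * K)"
            by (simp add: abs_mult mult_ac)
        qed
      qed measurable
    qed
    finally show ?thesis .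
  qed

  have k_nonneg: "0 \<le> k u" and k_le: "k u \<le> fk.KB TYPE('q)" and k_minus: "k (- u) = k u" for u
    unfolding k_def by (rule fk.product_Kc_nonneg, rule fk.product_Kc_le, rule fk.product_Kc_minus)
  \<comment> \<open>The Gaussian factor is at most 1, so all size estimates reduce to
    \<open>k\<close>; positive semidefiniteness combines both factors.\<close>
  have kernel: "regression_kernel M X P (\<kappa> b) (fk.KB TYPE('q)) (C1 * sqrt (b ^ CARD('q))) C' V D v"
    if b: "0 < b" "b \<le> 1" for b
  proof
    show "(\<lambda>p. \<kappa> b (fst p) (snd p)) \<in> borel_measurable (P \<Otimes>\<^sub>M P)"
      "(\<lambda>p. \<kappa> b (fst p) (snd p)) \<in> borel_measurable (C' \<Otimes>\<^sub>M P)"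
      unfolding \<kappa>_def by measurable
    show "0 \<le> \<kappa> b x y" for x y unfolding \<kappa>_def using k_nonneg by simp
    have \<kappa>_le: "\<kappa> b x y \<le> k ((1 / b) *\<^sub>R (fst (snd x) - fst (snd y)))" for x y
      unfolding \<kappa>_def using k_nonneg g_le by (simp add: mult_left_le)
    then show "\<kappa> b x y \<le> fk.KB TYPE('q)" for x y using k_le order_trans by blast
    show "\<kappa> b x y = \<kappa> b y x" for x y
    proof -
      have "k ((1 / b) *\<^sub>R (fst (snd x) - fst (snd y))) = k ((1 / b) *\<^sub>R (fst (snd y) - fst (snd x)))"
        using k_minus[of "(1 / b) *\<^sub>R (fst (snd x) - fst (snd y))"] by (simp flip: scaleR_minus_right)
      moreover have "N (snd (snd x) - snd (snd y)) = N (snd (snd y) - snd (snd x))"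
        unfolding N_def sq_norm_A_def by (intro infsum_cong) (simp add: inner_diff_left power2_commute)
      ultimately show ?thesis by (simp add: \<kappa>_def)
    qed
    show "(\<integral>y. \<kappa> b x y \<partial>P) \<le> C1 * sqrt (b ^ CARD('q))" if "x \<in> space P" for x
    proof -
      have "(\<integral>y. \<kappa> b x y \<partial>P) \<le> (\<integral>y. k ((1 / b) *\<^sub>R (fst (snd x) - fst (snd y))) \<partial>P)"
      proof (rule integral_mono_AE')
        show "integrable P (\<lambda>y. k ((1 / b) *\<^sub>R (fst (snd x) - fst (snd y))))"
          by (rule iid.P.integrable_const_bound[of _ "fk.KB TYPE('q)"]) (use k_nonneg k_le in auto)
      qed (use \<kappa>_le k_nonneg in auto)
      then show ?thesis using C1(2)[OF b, of "fst (snd x)"] by linarith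
    qed
    show "C1 * sqrt (b ^ CARD('q)) > 0" using C1(1) b by simp
    have "psd TYPE('u) (\<lambda>x y. product_kernel fk.Kc ((1 / b) *\<^sub>R fst (snd x) - (1 / b) *\<^sub>R fst (snd y))
        * (exp (- N (snd (snd x) - snd (snd y)) / 2) * 1))"
      unfolding N_def by (intro fk.psd_product_Kc psd_gauss[OF basis D_b_iii] psd_one)
    then show "psd TYPE('u) (\<kappa> b)"
      by (simp add: \<kappa>_def[abs_def] k_def scaleR_diff_right)
    show "(\<integral>x. V x \<bullet> G x \<partial>P) = 0"
      if "G \<in> borel_measurable C'" "\<And>x. x \<in> space P \<Longrightarrow> norm (G x) \<le> K" for G K
      using V_orth[OF that] .
    show "(\<integral>\<^sup>+x. ennreal ((norm (V x))\<^sup>2) * G x \<partial>P) \<le> (\<integral>\<^sup>+x. ennreal v * G x \<partial>P)"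
      if "G \<in> borel_measurable C'" for G
      using V_var[OF that] .
  qed (rule sub_C V_meas D_meas_C D4 v)+

  \<comment> \<open>Otherwise D = 0 almost surely, against the positive fourth moment; this is where
    nontriviality of \<delta> enters.\<close>
  have spec_pos: "\<exists>s. 0 < spectral_form J \<phi> a P snd \<Delta> s"
  proof (rule ccontr)
    assume "\<not> (\<exists>s. 0 < spectral_form J \<phi> a P snd \<Delta> s)"
    then have "AE x in P. \<Delta> (snd x) = 0"
      using D2 by (intro spectral_form_zero_imp_AE_zero[OF basis D_b_iii iid f2 _ \<Delta>_meas])
        (auto simp: space_P D_def not_less)
    then have "(\<integral>x. norm (D x) ^ 4 \<partial>P) = 0"
      by (intro integral_eq_zero_AE) (auto simp: D_def elim!: eventually_mono)
    then show False using D4_pos by simp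
  qed
  then obtain s0 where s0: "0 < spectral_form J \<phi> a P snd \<Delta> s0" by blast
  have spec_nn: "0 \<le> spectral_form J \<phi> a P snd \<Delta> s" for s
    using D2 by (intro spectral_form_nonneg[OF basis D_b_iii iid f2 _ \<Delta>_meas]) (auto simp: space_P D_def)
  \<comment> \<open>Everything except the kernel in Z goes into the weight \<open>gg\<close>, so
    that \<open>scaled_kernel_lower_bound\<close> on the product law gives the lower bound cc h^q
    for the quadratic form.\<close>
  define gg where "gg p = (D (fst p) \<bullet> D (snd p)) * exp (- N (snd (snd (fst p)) - snd (snd (snd p))) / 2)" for p
  define \<zeta> where "\<zeta> p = fst (snd (fst p)) - fst (snd (snd p))" for p :: "('u \<times> (real ^ 'q) \<times> 'w) \<times> ('u \<times> (real ^ 'q) \<times> 'w)"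
  have spec_eq: "spectral_form J \<phi> a P snd \<Delta> s = (\<integral>p. gg p * cos (s \<bullet> \<zeta> p) \<partial>(P \<Otimes>\<^sub>M P))" for s
    by (simp add: spectral_form_def gg_def \<zeta>_def D_def N_def)
  have gg_int: "integrable (P \<Otimes>\<^sub>M P) gg"
    unfolding gg_def using D_meas D2 g_le
    by (intro iid.integrable_square_product[where B = 1]) (auto intro: order_trans)
  have \<zeta>_meas: "\<zeta> \<in> borel_measurable (P \<Otimes>\<^sub>M P)" unfolding \<zeta>_def by measurable
  obtain cc h0 where cc: "0 < cc" "0 < h0"
    "\<And>b. 0 < b \<Longrightarrow> b < h0 \<Longrightarrow> cc * b ^ CARD('q) \<le> (\<integral>p. gg p * k ((1 / b) *\<^sub>R \<zeta> p) \<partial>(P \<Otimes>\<^sub>M P))"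
    using fk.scaled_kernel_lower_bound[OF _ gg_int \<zeta>_meas, of s0] s0 spec_nn
    unfolding spec_eq k_def[symmetric] using iid.PP.finite_measure_axioms by blast

  define m2 where "m2 = (\<integral>x. (norm (D x))\<^sup>2 \<partial>P)"
  define m4 where "m4 = (\<integral>x. norm (D x) ^ 4 \<partial>P)"
  define s where "s n = sqrt (h n ^ CARD('q))" for n
  define B where "B = fk.KB TYPE('q)"
  define bound where "bound n = (128 * v * C1 / cc) * (1 / ((r n)\<^sup>2 * real n * s n)) + (128 * C1\<^sup>2 * m4 / cc\<^sup>2) * (1 / (real n * (s n)\<^sup>2))
      + 32 * (1 + z\<^sup>2) * B / cc\<^sup>2 * (4 * v\<^sup>2 * C1 * (1 / ((r n)\<^sup>2 * real n * s n))\<^sup>2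
        + 8 * v * C1 * m2 * (1 / ((r n)\<^sup>2 * real n * s n)) * (1 / (real n * (s n)\<^sup>2)) + 4 * B * m2\<^sup>2 * (1 / (real n * (s n)\<^sup>2))\<^sup>2)" for n
  define A where "A n = {x \<in> space M. z \<le> T_stat c (product_kernel Kt) \<omega> N n (h n)
      (\<lambda>i. U0s i x + r n *\<^sub>R \<delta> (Zs i x, Ws i x)) (\<lambda>i. Zs i x) (\<lambda>i. Ws i x)}" for n
  have s_sq: "(s n)\<^sup>2 = h n ^ CARD('q)" if "n \<ge> 1" for n
    using K_b(1)[OF that] by (simp add: s_def)

  have lim1: "(\<lambda>n. 1 / ((r n)\<^sup>2 * real n * s n)) \<longlonglongrightarrow> 0"
  proof -
    have "filterlim (\<lambda>n. (r n)\<^sup>2 * real n * s n) at_top sequentially"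
    proof (rule filterlim_mono_eventually[OF rate order_refl order_refl])
      show "\<forall>\<^sub>F n in sequentially. (r n)\<^sup>2 * real n * h n powr (real CARD('q) / 2) = (r n)\<^sup>2 * real n * s n"
        using eventually_ge_at_top[of 1]
      proof eventually_elim
        case (elim n)
        have "h n powr (real CARD('q) / 2) = sqrt (h n powr real CARD('q))"
          by (simp add: powr_half_sqrt[symmetric] powr_powr)
        then show ?case using K_b(1)[OF elim] by (simp add: s_def powr_realpow)
      qed
    qed
    then show ?thesis by (intro tendsto_divide_0[OF tendsto_const] filterlim_at_top_imp_at_infinity)
  qed
  have lim2: "(\<lambda>n. 1 / (real n * (s n)\<^sup>2)) \<longlonglongrightarrow> 0"
  proof -
    have "filterlim (\<lambda>n. real n * (s n)\<^sup>2) at_top sequentially"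
    proof (rule filterlim_at_top_mono[OF K_b(3)])
      show "\<forall>\<^sub>F n in sequentially. real n * h n ^ CARD('q) / ln (real n) \<le> real n * (s n)\<^sup>2"
        \<comment> \<open>For n >= 3 the logarithm is at least 1, so dropping the division only
          enlarges the term.\<close>
        using eventually_ge_at_top[of 3]
      proof eventually_elim
        case (elim n)
        have "exp 1 \<le> real n" using exp_le elim by linarith
        then have "1 \<le> ln (real n)" using elim by (simp add: ln_ge_iff)
        moreover have "0 \<le> real n * h n ^ CARD('q)" using K_b(1)[of n] elim by (simp add: less_imp_le)
        ultimately have "real n * h n ^ CARD('q) / ln (real n) \<le> real n * h n ^ CARD('q) / 1"
          by (intro divide_left_mono) auto
        then show ?case using s_sq[of n] elim by simp
      qed
    qed
    then show ?thesis by (intro tendsto_divide_0[OF tendsto_const] filterlim_at_top_imp_at_infinity)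
  qed
  \<comment> \<open>\<open>bound\<close> is a polynomial without constant term in the two null
    sequences of \<open>lim1\<close> and \<open>lim2\<close>.\<close>
  have lim_bound: "bound \<longlonglongrightarrow> 0"
  proof -
    have "bound \<longlonglongrightarrow> (128 * v * C1 / cc) * 0 + (128 * C1\<^sup>2 * m4 / cc\<^sup>2) * 0
      + 32 * (1 + z\<^sup>2) * B / cc\<^sup>2 * (4 * v\<^sup>2 * C1 * 0\<^sup>2 + 8 * v * C1 * m2 * 0 * 0 + 4 * B * m2\<^sup>2 * 0\<^sup>2)"
      unfolding bound_def[abs_def] by (intro tendsto_intros lim1 lim2)
    then show ?thesis by simp
  qed

  have h_small: "\<forall>\<^sub>F n in sequentially. h n < min 1 h0"
    using K_b(2) cc(2) by (intro order_tendstoD(2)[of _ 0]) auto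
  \<comment> \<open>The diverging product contains the factor r_n^2.\<close>
  have r_nz: "\<forall>\<^sub>F n in sequentially. r n \<noteq> 0"
  proof -
    have "\<forall>\<^sub>F n in sequentially. 1 \<le> (r n)\<^sup>2 * real n * h n powr (real CARD('q) / 2)"
      using rate by (simp add: filterlim_at_top)
    then show ?thesis by eventually_elim auto
  qed
  have lower: "\<forall>\<^sub>F n in sequentially. 1 - bound n \<le> measure M (A n)"
    using h_small r_nz eventually_ge_at_top[of 2]
  proof eventually_elim
    case (elim n)
    then have n: "n \<ge> 2" "n \<ge> 1" and h: "0 < h n" "h n \<le> 1" "h n < h0" and rn: "r n \<noteq> 0"
      using K_b(1)[of n] by auto
    interpret rk: regression_kernel M X P "\<kappa> (h n)" B "C1 * s n" C' V D v "r n"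
      using kernel[OF h(1,2)] by (simp add: B_def s_def)
    have s: "0 < s n" using h by (simp add: s_def)
    have form: "rk.form D D = (\<integral>p. gg p * k ((1 / h n) *\<^sub>R \<zeta> p) \<partial>(P \<Otimes>\<^sub>M P))"
      unfolding rk.form_def by (intro Bochner_Integration.integral_cong refl) (simp add: gg_def \<zeta>_def \<kappa>_def)
    have Q: "cc * (s n)\<^sup>2 \<le> rk.form D D" using cc(3)[OF h(1,3)] by (simp add: form s_sq[OF n(2)])
    have Q0: "0 < rk.form D D" using Q cc(1) s by (meson less_le_trans mult_pos_pos zero_less_power)
    have pair: "(\<integral>p. \<kappa> (h n) (fst p) (snd p) \<partial>(P \<Otimes>\<^sub>M P)) \<le> C1 * (s n)\<^sup>2"
    proof -
      have "(\<integral>p. \<kappa> (h n) (fst p) (snd p) \<partial>(P \<Otimes>\<^sub>M P))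
          \<le> (\<integral>p. k ((1 / h n) *\<^sub>R (fst (snd (fst p)) - fst (snd (snd p)))) \<partial>(P \<Otimes>\<^sub>M P))"
      proof (rule integral_mono_AE')
        show "integrable (P \<Otimes>\<^sub>M P) (\<lambda>p. k ((1 / h n) *\<^sub>R (fst (snd (fst p)) - fst (snd (snd p)))))"
          by (rule iid.PP.integrable_const_bound[of _ "fk.KB TYPE('q)"]) (use k_nonneg k_le in auto)
      qed (use k_nonneg g_le in \<open>auto simp: \<kappa>_def mult_left_le\<close>)
      then show ?thesis using C1(3)[OF h(1,2)] s_sq[OF n(2)] by simp
    qed
    \<comment> \<open>\<open>Bad\<close> is formed with the continuous kernel, whereas
      \<open>A n\<close> uses the given one; the two are compared almost surely below.\<close>
    define Bad where "Bad = {x \<in> space M. (\<Sum>i\<in>{1..n}. \<Sum>j\<in>{1..n} - {i}. rk.g (X i x, X j x))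
        \<le> \<bar>z\<bar> * sqrt (2 * (\<Sum>i\<in>{1..n}. \<Sum>j\<in>{1..n} - {i}. (rk.g (X i x, X j x))\<^sup>2))}"
    have "prob Bad \<le> bound n"
    proof -
      have "prob Bad \<le> (64 * (2 * (r n)\<^sup>2 * v * (C1 * s n) * rk.form D D + 2 * r n ^ 4 * (C1 * s n)\<^sup>2 * m4) / real n
      + 32 * (1 + z\<^sup>2) * (B * (4 * v\<^sup>2 * (C1 * (s n)\<^sup>2) + 8 * v * (r n)\<^sup>2 * (C1 * s n) * m2 + 4 * r n ^ 4 * B * m2\<^sup>2)) / (real n)\<^sup>2)
      / ((r n)\<^sup>2 * rk.form D D)\<^sup>2"
        unfolding Bad_def m2_def m4_def by (rule rk.selfnormalized_tail[OF n(1) rn Q0 pair])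
      also have "\<dots> \<le> bound n"
        unfolding bound_def
      proof (rule tail_bound_rate[OF _ rn s cc(1) _ v _ _ rk.B_nonneg Q])
        show "0 \<le> m2" "0 \<le> m4" unfolding m2_def m4_def by (simp_all add: integral_nonneg_AE)
      qed (use n C1(1) in auto)
      finally show ?thesis .
    qed
    have X_meas: "X i \<in> borel_measurable M" if "i \<in> {1..n}" for i
      using iid.measurable_X[of i] that by (simp add: measurable_cong_sets[OF refl sets_P])
    have Xm: "U0s i \<in> borel_measurable M" "Zs i \<in> borel_measurable M" "Ws i \<in> borel_measurable M"
      if "i \<in> {1..n}" for i
      using measurable_compose[OF X_meas[OF that] borel_fst]
        measurable_compose[OF measurable_compose[OF X_meas[OF that] borel_snd] borel_fst]
        measurable_compose[OF measurable_compose[OF X_meas[OF that] borel_snd] borel_snd]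
      by (simp_all add: X_def)
    have Bad_meas: "Bad \<in> sets M"
    proof -
      have "0 < integral\<^sup>L (P \<Otimes>\<^sub>M P) rk.g" using rn Q0 by (simp add: rk.integral_g)
      note m = iid.ustatistic_selfnormalized(1,2)[OF rk.g_meas rk.g_sym rk.g_sq(1) n(1) this]
      show ?thesis unfolding Bad_def using m by measurable
    qed
    have A_meas: "A n \<in> sets M"
    proof -
      define \<Phi> where "\<Phi> i j x = ((\<omega> (Zs i x) *\<^sub>R (U0s i x + r n *\<^sub>R \<delta> (Zs i x, Ws i x))) \<bullet> (\<omega> (Zs j x) *\<^sub>R (U0s j x + r n *\<^sub>R \<delta> (Zs j x, Ws j x))))"
        for i j x
      have m: "\<Phi> i j \<in> borel_measurable M" "(\<lambda>x. product_kernel Kt ((1 / h n) *\<^sub>R (Zs i x - Zs j x))) \<in> borel_measurable M"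
        "(\<lambda>x. exp (- N (Ws i x - Ws j x) / 2)) \<in> borel_measurable M"
        if ij: "i \<in> {1..n}" "j \<in> {1..n} - {i}" for i j
      proof -
        have j: "j \<in> {1..n}" using ij by simp
        note [measurable] = Xm[OF ij(1)] Xm[OF j]
        have [measurable]: "(\<lambda>x. \<delta> (Zs l x, Ws l x)) \<in> borel_measurable M" if "l \<in> {1..n}" for l
          using Xm[OF that] by (intro measurable_compose[OF borel_measurable_Pair \<open>\<delta> \<in> borel_measurable borel\<close>])
        show "\<Phi> i j \<in> borel_measurable M" unfolding \<Phi>_def using ij by measurable
        show "(\<lambda>x. product_kernel Kt ((1 / h n) *\<^sub>R (Zs i x - Zs j x))) \<in> borel_measurable M"
          by (rule measurable_compose[OF _ fk.product_Kt_meas]) measurable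
        show "(\<lambda>x. exp (- N (Ws i x - Ws j x) / 2)) \<in> borel_measurable M" by measurable
      qed
      have "(\<lambda>x. I_stat (product_kernel Kt) \<omega> N n (h n) (\<lambda>i. U0s i x + r n *\<^sub>R \<delta> (Zs i x, Ws i x)) (\<lambda>i. Zs i x) (\<lambda>i. Ws i x)) \<in> borel_measurable M"
        unfolding I_stat_def \<Phi>_def[symmetric]
        by (intro borel_measurable_times borel_measurable_const borel_measurable_sum m)
      moreover have "(\<lambda>x. v_stat (product_kernel Kt) \<omega> N n (h n) (\<lambda>i. U0s i x + r n *\<^sub>R \<delta> (Zs i x, Ws i x)) (\<lambda>i. Zs i x) (\<lambda>i. Ws i x)) \<in> borel_measurable M"
        unfolding v_stat_def v_sq_stat_def \<Phi>_def[symmetric]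
        by (rule measurable_compose[OF _ borel_measurable_sqrt], intro borel_measurable_times borel_measurable_const borel_measurable_sum borel_measurable_power m)
      ultimately show ?thesis unfolding A_def T_stat_def by measurable
    qed
    \<comment> \<open>Almost surely all finitely many kernel values of the sample agree for the two
      versions, and off \<open>Bad\<close> the statistic is then at least z by
      \<open>T_stat_ge\<close>.\<close>
    have good: "AE x in M. x \<in> space M - Bad \<longrightarrow> x \<in> A n"
    proof -
      have "AE x in M. \<forall>i\<in>{1..n}. \<forall>j\<in>{1..n} - {i}.
          product_kernel Kt ((1 / h n) *\<^sub>R (Zs i x - Zs j x)) = k ((1 / h n) *\<^sub>R (Zs i x - Zs j x))"
      proof (intro AE_finite_allI)
        fix i j assume ij: "i \<in> {1..n}" "j \<in> {1..n} - {i}"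
        show "AE x in M. product_kernel Kt ((1 / h n) *\<^sub>R (Zs i x - Zs j x)) = k ((1 / h n) *\<^sub>R (Zs i x - Zs j x))"
          using iid.AE_pair[OF fk.AE_kernel_eq[OF iid.prob_space_P dist h(1)], of i j] ij
          by (simp add: X_def k_def)
      qed auto
      then show ?thesis
      proof eventually_elim
        case (elim x)
        show ?case
        proof
          assume x: "x \<in> space M - Bad"
          have "z \<le> T_stat c (product_kernel Kt) \<omega> N n (h n)
            (\<lambda>i. U0s i x + r n *\<^sub>R \<delta> (Zs i x, Ws i x)) (\<lambda>i. Zs i x) (\<lambda>i. Ws i x)"
          proof (rule T_stat_ge[OF n(1) h(1), where G = "\<lambda>i j. rk.g (X i x, X j x)"])
            show "((\<omega> (Zs i x) *\<^sub>R (U0s i x + r n *\<^sub>R \<delta> (Zs i x, Ws i x))) \<bullet> (\<omega> (Zs j x) *\<^sub>R (U0s j x + r n *\<^sub>R \<delta> (Zs j x, Ws j x))))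
                * product_kernel Kt ((1 / h n) *\<^sub>R (Zs i x - Zs j x)) * exp (- N (Ws i x - Ws j x) / 2) = rk.g (X i x, X j x)"
              if "i \<in> {1..n}" "j \<in> {1..n} - {i}" for i j
              unfolding rk.g_def rk.Y_def using elim that
              by (simp add: X_def V_def D_def \<Delta>_def \<kappa>_def scaleR_add_right mult.commute[of "r n"])
            show "\<bar>z\<bar> * sqrt (2 * (\<Sum>i\<in>{1..n}. \<Sum>j\<in>{1..n} - {i}. (rk.g (X i x, X j x))\<^sup>2))
                < (\<Sum>i\<in>{1..n}. \<Sum>j\<in>{1..n} - {i}. rk.g (X i x, X j x))"
              using x by (auto simp: Bad_def not_le)
          qed
          then show "x \<in> A n" using x by (simp add: A_def)
        qed
      qed
    qed
    have "1 - bound n \<le> 1 - prob Bad" using \<open>prob Bad \<le> bound n\<close> by simp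
    also have "\<dots> = prob (space M - Bad)" by (rule prob_compl[OF Bad_meas, symmetric])
    also have "\<dots> \<le> prob (A n)"
      using good by (intro finite_measure_mono_AE A_meas) (auto elim!: eventually_mono)
    finally show ?case .
  qed
  have "(\<lambda>n. measure M (A n)) \<longlonglongrightarrow> 1"
  proof (rule tendsto_sandwich[OF lower])
    show "\<forall>\<^sub>F n in sequentially. measure M (A n) \<le> 1" by (simp add: prob_le_1)
    show "(\<lambda>n. 1 - bound n) \<longlonglongrightarrow> 1" using tendsto_diff[OF tendsto_const lim_bound, of 1] by simp
  qed simp
  then show "(\<lambda>n. measure M {x \<in> space M.
        quantile (density lborel std_normal_density) (1 - \<alpha>)
        \<le> T_stat c (product_kernel Kt) \<omega> (sq_norm_A J \<phi> a) n (h n)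
            (\<lambda>i. U0s i x + r n *\<^sub>R \<delta> (Zs i x, Ws i x)) (\<lambda>i. Zs i x) (\<lambda>i. Ws i x)})
    \<longlonglongrightarrow> 1"
    unfolding A_def z_def N_def .
qed

end
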